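(* Let $m\ge1$ and $\mathcal{O}=(0,+\infty)\times\mathbb{R}^m$ with points $x=(x_0,x_1,\dots,x_m)$. Let $\xi=\mathcal{W}$ be a spatially homogeneous Wiener process on $\mathbb{R}^m\cong\partial\mathcal{O}$ with spectral measure $\nu$, and let $u$ be the solution, with $u_0=0$, to $\frac{\partial u}{\partial t}=\Delta u$ on $(0,\infty)\times\mathcal{O}$, $u=\frac{\mathrm{d}\xi}{\mathrm{d}t}$ on $(0,\infty)\times\partial\mathcal{O}$, $u(0,\cdot)=u_0$. Then there is a constant $C$ such that for all $t>0$ and $x\in\mathcal{O}$ $$\mathbb{E}\,|u(t,x)|^2\le Ce^{t}\int_{\mathbb{R}^m}\left(x_0^{-2}\chi_{\{|y|\le1\}}+x_0^{-4}|y|^{-1/m}\chi_{\{|y|>1\}}\right)\nu(\mathrm{d}y).$$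
   Context: Homogeneous Wiener process: $\mathcal{W}$ is a Gaussian process with continuous trajectories in $\mathcal{S}'(\mathbb{R}^m)$ such that for each $\psi\in\mathcal{S}(\mathbb{R}^m)$, $t\mapsto(\mathcal{W}(t),\psi)$ is a one-dimensional Wiener process, with $\mathbb{E}(\mathcal{W}(t),\psi)(\mathcal{W}(s),\varphi)=(t\wedge s)\,Q(\psi,\varphi)$, and the law of $\mathcal{W}(t)$ is invariant under all translations of $\mathbb{R}^m$. Equivalently $Q(\psi,\varphi)=(\Gamma,\psi*\varphi_{(s)})$, $\varphi_{(s)}(x)=\overline{\varphi(-x)}$, where $\Gamma\in\mathcal{S}'(\mathbb{R}^m)$ is the Fourier transform of a positive symmetric tempered measure $\nu$ on $\mathbb{R}^m$ (tempered: $\int(1+|x|)^r\,\mathrm{d}\nu<\infty$ for some $r<0$); $\nu$ is the spectral measure. Fourier transform: $\mathcal{F}f(y)=\int_{\mathbb{R}^m}e^{i\langle z,y\rangle}f(z)\,\mathrm{d}z$. Solution: $\partial\mathcal{O}=\{0\}\times\mathbb{R}^m$ is identified with $\mathbb{R}^m$; $\mathbf{n}$ is the inward unit normal. The unique weak solution of the heat problem with $u_0=0$ (and $\xi(0)=0$) is identified inside the domain with the smooth random field $$u(t,x)=\int_0^t\left(\xi(s),\Delta_x\frac{\partial G}{\partial\mathbf{n}_y}(t-s,x,\cdot)\Big|_{\partial\mathcal{O}}\right)\mathrm{d}s,\qquad t>0,\ x\in\mathcal{O},$$ where $G$ is the heat kernel of $\mathcal{O}$ with homogeneous Dirichlet boundary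 conditions. The right-hand side of the estimate may be infinite. *)

theory Defs
  imports "HOL-Probability.Probability"
begin

text \<open>Schwartz functions and tempered distributions\<close>

definition partial_deriv :: "'a::euclidean_space \<Rightarrow> ('a \<Rightarrow> real) \<Rightarrow> 'a \<Rightarrow> real" where
  "partial_deriv b f x = deriv (\<lambda>h. f (x + h *\<^sub>R b)) 0"

primrec iter_partial_deriv :: "'a::euclidean_space list \<Rightarrow> ('a \<Rightarrow> real) \<Rightarrow> 'a \<Rightarrow> real" where
  "iter_partial_deriv [] f = f"
| "iter_partial_deriv (b # bs) f = partial_deriv b (iter_partial_deriv bs f)"

definition laplacian :: "('a::euclidean_space \<Rightarrow> real) \<Rightarrow> 'a \<Rightarrow> real" where
  "laplacian f x = (\<Sum>b\<in>Basis. iter_partial_deriv [b, b] f x)"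

text \<open>Differentiability below is total (Frechet) differentiability; requiring it of all
  iterated partial derivatives is the same as requiring the function to be smooth.\<close>

definition schwartz :: "('a::euclidean_space \<Rightarrow> real) set" where
  "schwartz = {f. \<forall>bs \<in> lists Basis.
      iter_partial_deriv bs f differentiable_on UNIV \<and>
      (\<forall>k::nat. bounded (range (\<lambda>x. (1 + norm x) ^ k * iter_partial_deriv bs f x)))}"

definition schwartz_seminorm :: "nat \<Rightarrow> 'a::euclidean_space list \<Rightarrow> ('a \<Rightarrow> real) \<Rightarrow> real" where
  "schwartz_seminorm k bs f = (SUP x. (1 + norm x) ^ k * \<bar>iter_partial_deriv bs f x\<bar>)"

definition schwartz_tendsto ::
  "(nat \<Rightarrow> 'a::euclidean_space \<Rightarrow> real) \<Rightarrow> ('a \<Rightarrow> real) \<Rightarrow> bool" where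
  "schwartz_tendsto F f \<longleftrightarrow>
     (\<forall>k. \<forall>bs \<in> lists Basis. (\<lambda>n. schwartz_seminorm k bs (\<lambda>x. F n x - f x)) \<longlonglongrightarrow> 0)"

text \<open>Real tempered distributions. A distribution is a functional on all functions of which only
  the values on \<^term>\<open>schwartz\<close> matter. The topology of the Schwartz space comes from
  countably many seminorms, so continuity is sequential continuity.\<close>

definition tempered_distribution :: "(('a::euclidean_space \<Rightarrow> real) \<Rightarrow> real) \<Rightarrow> bool" where
  "tempered_distribution T \<longleftrightarrow>
     (\<forall>f\<in>schwartz. \<forall>g\<in>schwartz. T (\<lambda>x. f x + g x) = T f + T g) \<and>
     (\<forall>c. \<forall>f\<in>schwartz. T (\<lambda>x. c * f x) = c * T f) \<and>
     (\<forall>F f. (\<forall>n. F n \<in> schwartz) \<longrightarrow> f \<in> schwartz \<longrightarrow> schwartz_tendsto F f \<longrightarrow>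
        (\<lambda>n. T (F n)) \<longlonglongrightarrow> T f)"


text \<open>Gaussian and Wiener processes\<close>

text \<open>Normal law with mean \<open>a\<close> and variance \<open>v\<close>; a point mass if \<open>v = 0\<close>.\<close>

definition gaussian_law :: "real \<Rightarrow> real \<Rightarrow> real measure" where
  "gaussian_law a v =
     (if v = 0 then return borel a else density lborel (\<lambda>z. ennreal (normal_density a (sqrt v) z)))"

text \<open>One-dimensional Wiener process, not necessarily standard: \<open>q\<close> is the variance at time 1.\<close>

definition wiener_process :: "'w measure \<Rightarrow> (real \<Rightarrow> 'w \<Rightarrow> real) \<Rightarrow> bool" where
  "wiener_process M B \<longleftrightarrow>
     (\<forall>t\<ge>0. B t \<in> borel_measurable M) \<and>
     (AE \<omega> in M. B 0 \<omega> = 0) \<and>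
     (\<forall>\<omega>\<in>space M. continuous_on {0..} (\<lambda>t. B t \<omega>)) \<and>
     (\<exists>q\<ge>0. \<forall>s t. 0 \<le> s \<longrightarrow> s < t \<longrightarrow>
        distr M borel (\<lambda>\<omega>. B t \<omega> - B s \<omega>) = gaussian_law 0 (q * (t - s))) \<and>
     (\<forall>(n::nat) \<tau>. 0 \<le> \<tau> 0 \<longrightarrow> mono \<tau> \<longrightarrow>
        prob_space.indep_vars M (\<lambda>_. borel) (\<lambda>i \<omega>. B (\<tau> (Suc i)) \<omega> - B (\<tau> i) \<omega>) {..<n})"

definition gaussian_process ::
  "'w measure \<Rightarrow> (real \<Rightarrow> 'w \<Rightarrow> ('a::euclidean_space \<Rightarrow> real) \<Rightarrow> real) \<Rightarrow> bool" where
  "gaussian_process M W \<longleftrightarrow>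
     (\<forall>t\<ge>0. \<forall>\<psi>\<in>schwartz. (\<lambda>\<omega>. W t \<omega> \<psi>) \<in> borel_measurable M) \<and>
     (\<forall>(n::nat) c \<tau> \<psi>. (\<forall>i<n. 0 \<le> \<tau> i \<and> \<psi> i \<in> schwartz) \<longrightarrow>
        (\<exists>a. \<exists>v\<ge>0. distr M borel (\<lambda>\<omega>. \<Sum>i<n. c i * W (\<tau> i) \<omega> (\<psi> i)) = gaussian_law a v))"

text \<open>Law of a random tempered distribution, on the sigma-algebra generated by the evaluations at
  Schwartz functions (which is the Borel sigma-algebra of the space of tempered distributions).\<close>

definition distribution_law ::
  "'w measure \<Rightarrow> ('w \<Rightarrow> ('a::euclidean_space \<Rightarrow> real) \<Rightarrow> real)
     \<Rightarrow> (('a \<Rightarrow> real) \<Rightarrow> real) measure" where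
  "distribution_law M X =
     distr M (Pi\<^sub>M schwartz (\<lambda>_. borel)) (\<lambda>\<omega>. restrict (X \<omega>) schwartz)"

definition translate ::
  "'a::euclidean_space \<Rightarrow> (('a \<Rightarrow> real) \<Rightarrow> real) \<Rightarrow> ('a \<Rightarrow> real) \<Rightarrow> real" where
  "translate h T \<psi> = T (\<lambda>x. \<psi> (x + h))"

text \<open>Trajectories are continuous in the weak topology of the space of tempered distributions; for
  curves defined on a half-line this is equivalent to continuity in the strong topology.\<close>

definition homogeneous_wiener_process ::
  "'w measure \<Rightarrow> (('a::euclidean_space \<Rightarrow> real) \<Rightarrow> ('a \<Rightarrow> real) \<Rightarrow> real)
     \<Rightarrow> (real \<Rightarrow> 'w \<Rightarrow> ('a \<Rightarrow> real) \<Rightarrow> real) \<Rightarrow> bool" where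
  "homogeneous_wiener_process M Q W \<longleftrightarrow>
     prob_space M \<and>
     (\<forall>t\<ge>0. \<forall>\<omega>\<in>space M. tempered_distribution (W t \<omega>)) \<and>
     (\<forall>\<omega>\<in>space M. \<forall>\<psi>\<in>schwartz. continuous_on {0..} (\<lambda>t. W t \<omega> \<psi>)) \<and>
     gaussian_process M W \<and>
     (\<forall>\<psi>\<in>schwartz. wiener_process M (\<lambda>t \<omega>. W t \<omega> \<psi>)) \<and>
     (\<forall>t\<ge>0. \<forall>s\<ge>0. \<forall>\<psi>\<in>schwartz. \<forall>\<phi>\<in>schwartz.
        (\<integral>\<omega>. W t \<omega> \<psi> * W s \<omega> \<phi> \<partial>M) = min t s * Q \<psi> \<phi>) \<and>
     (\<forall>t\<ge>0. \<forall>h. distribution_law M (\<lambda>\<omega>. translate h (W t \<omega>)) = distribution_law M (W t))"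


text \<open>Spectral measure\<close>

definition fourier :: "('a::euclidean_space \<Rightarrow> complex) \<Rightarrow> 'a \<Rightarrow> complex" where
  "fourier f y = (\<integral>z. exp (\<i> * complex_of_real (z \<bullet> y)) * f z \<partial>lborel)"

text \<open>The Fourier transform of a measure as a distribution: \<open>(F \<nu>, f) = (\<nu>, F f)\<close>.\<close>

definition fourier_measure :: "'a::euclidean_space measure \<Rightarrow> ('a \<Rightarrow> complex) \<Rightarrow> complex" where
  "fourier_measure \<nu> f = (\<integral>y. fourier f y \<partial>\<nu>)"

definition convolution ::
  "('a::euclidean_space \<Rightarrow> complex) \<Rightarrow> ('a \<Rightarrow> complex) \<Rightarrow> 'a \<Rightarrow> complex" where
  "convolution f g x = (\<integral>z. f (x - z) * g z \<partial>lborel)"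

definition reflect_cnj :: "('a::euclidean_space \<Rightarrow> complex) \<Rightarrow> 'a \<Rightarrow> complex" where
  "reflect_cnj f x = cnj (f (- x))"

definition symmetric_tempered_measure :: "'a::euclidean_space measure \<Rightarrow> bool" where
  "symmetric_tempered_measure \<nu> \<longleftrightarrow>
     sets \<nu> = sets borel \<and>
     distr \<nu> borel uminus = \<nu> \<and>
     (\<exists>r<0. (\<integral>\<^sup>+ y. ennreal ((1 + norm y) powr r) \<partial>\<nu>) < \<infinity>)"

definition spectral_measure ::
  "(('a::euclidean_space \<Rightarrow> real) \<Rightarrow> ('a \<Rightarrow> real) \<Rightarrow> real) \<Rightarrow> 'a measure \<Rightarrow> bool" where
  "spectral_measure Q \<nu> \<longleftrightarrow>
     symmetric_tempered_measure \<nu> \<and>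
     (\<forall>\<psi>\<in>schwartz. \<forall>\<phi>\<in>schwartz.
        complex_of_real (Q \<psi> \<phi>) =
        fourier_measure \<nu>
          (convolution (\<lambda>x. complex_of_real (\<psi> x)) (reflect_cnj (\<lambda>x. complex_of_real (\<phi> x)))))"


text \<open>Dirichlet heat kernel\<close>

text \<open>Bounded classical solutions of the heat equation on a domain with zero boundary values.\<close>

definition dirichlet_heat_solution ::
  "'a::euclidean_space set \<Rightarrow> ('a \<Rightarrow> real) \<Rightarrow> (real \<Rightarrow> 'a \<Rightarrow> real) \<Rightarrow> bool" where
  "dirichlet_heat_solution D f v \<longleftrightarrow>
     continuous_on ({0..} \<times> closure D) (\<lambda>(t, x). v t x) \<and>
     bounded ((\<lambda>(t, x). v t x) ` ({0..} \<times> closure D)) \<and>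
     (\<forall>t>0. v t differentiable_on D \<and> (\<forall>b\<in>Basis. partial_deriv b (v t) differentiable_on D)) \<and>
     (\<forall>t>0. \<forall>x\<in>D. ((\<lambda>s. v s x) has_real_derivative laplacian (v t) x) (at t)) \<and>
     (\<forall>t>0. \<forall>x\<in>frontier D. v t x = 0) \<and>
     (\<forall>x\<in>closure D. v 0 x = f x)"

text \<open>The heat kernel is the kernel, continuous up to the boundary, of the solution operator.
  Bounded solutions are unique by the maximum principle, so for \<open>t > 0\<close> the kernel is uniquely
  determined on \<open>D \<times> closure D\<close>.\<close>

definition dirichlet_heat_kernel ::
  "'a::euclidean_space set \<Rightarrow> (real \<Rightarrow> 'a \<Rightarrow> 'a \<Rightarrow> real) \<Rightarrow> bool" where
  "dirichlet_heat_kernel D G \<longleftrightarrow>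
     (\<forall>t>0. continuous_on (closure D \<times> closure D) (\<lambda>(x, y). G t x y)) \<and>
     (\<forall>f. continuous_on UNIV f \<longrightarrow> compact (closure {x. f x \<noteq> 0}) \<longrightarrow>
          closure {x. f x \<noteq> 0} \<subseteq> D \<longrightarrow>
        dirichlet_heat_solution D f
          (\<lambda>t x. if t = 0 then f x else (LINT y:D|lborel. G t x y * f y)))"


text \<open>The boundary value problem on the half-space; points are \<open>x = (x\<^sub>0, x')\<close> and the boundary point
  \<open>(0, y)\<close> is identified with \<open>y\<close>.\<close>

definition half_space :: "(real \<times> (real ^ 'm)) set" where
  "half_space = {0<..} \<times> UNIV"

definition inward_normal :: "real \<times> (real ^ 'm)" where
  "inward_normal = (1, 0)"

definition normal_deriv :: "(real \<times> (real ^ 'm) \<Rightarrow> real) \<Rightarrow> real \<times> (real ^ 'm) \<Rightarrow> real" where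
  "normal_deriv g z = vector_derivative (\<lambda>h. g (z + h *\<^sub>R inward_normal)) (at 0 within {0..})"

definition boundary_kernel ::
  "(real \<Rightarrow> real \<times> (real ^ 'm) \<Rightarrow> real \<times> (real ^ 'm) \<Rightarrow> real)
     \<Rightarrow> real \<Rightarrow> real \<times> (real ^ 'm) \<Rightarrow> real ^ 'm \<Rightarrow> real" where
  "boundary_kernel G r x y = laplacian (\<lambda>z. normal_deriv (G r z) (0, y)) x"

definition boundary_noise_solution ::
  "(real \<Rightarrow> real \<times> (real ^ 'm) \<Rightarrow> real \<times> (real ^ 'm) \<Rightarrow> real)
     \<Rightarrow> (real \<Rightarrow> 'w \<Rightarrow> (real ^ 'm \<Rightarrow> real) \<Rightarrow> real)
     \<Rightarrow> real \<Rightarrow> real \<times> (real ^ 'm) \<Rightarrow> 'w \<Rightarrow> real" where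
  "boundary_noise_solution G \<xi> t x \<omega> = (LBINT s:{0..t}. \<xi> s \<omega> (boundary_kernel G (t - s) x))"

end

theory Submission imports Defs begin

text \<open>By the maximum principle the Dirichlet heat kernel is the one obtained by reflection, so the
  kernel \<open>\<Delta>\<^sub>x \<partial>G/\<partial>n\<^sub>y\<close> is \<open>\<partial>\<^sub>r k\<^sub>r\<close>, where \<open>k\<^sub>r\<close> is the Poisson kernel, whose Fourier transform in
  \<open>y\<close> has modulus \<open>g\<^sub>r(\<eta>) = x\<^sub>0 r\<inverse> (4 \<pi> r)\<^sup>-\<^sup>1\<^sup>/\<^sup>2 exp (- x\<^sub>0\<^sup>2/4r - r |\<eta>|\<^sup>2)\<close>. Hence \<open>u(t, x) = \<integral>\<^sub>0\<^sup>t W(s)(\<psi>\<^sub>s) ds\<close>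
  with \<open>E W(s)(\<psi>\<^sub>s) W(s')(\<psi>\<^sub>s') = min s s' \<integral> g'\<^sub>t\<^sub>-\<^sub>s g'\<^sub>t\<^sub>-\<^sub>s' d\<nu>\<close>. Writing \<open>min s s' = \<integral> 1(\<sigma> < s) 1(\<sigma> < s') d\<sigma>\<close>,
  this is also the covariance of \<open>1(\<sigma> < s) g'\<^sub>t\<^sub>-\<^sub>s(\<eta>)\<close> on the measure space \<open>[0, t) \<times> \<nu>\<close>, so
  \<open>E u\<^sup>2 = \<integral>\<integral>\<^sub>0\<^sup>t g\<^sub>r(\<eta>)\<^sup>2 dr \<nu>(d\<eta>)\<close>, and the inner integral is bounded by \<open>2 x\<^sub>0\<^sup>-\<^sup>2\<close> and by
  \<open>2 x\<^sub>0\<^sup>-\<^sup>4 |\<eta>|\<^sup>-\<^sup>2\<close>.\<close>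

subsection \<open>The maximum principle\<close>

text \<open>The solution is a pathwise Lebesgue integral, so no stochastic calculus enters; the
  difficulty sits at s = t, where the kernel degenerates. Since x_0 > 0, the factor exp (- x_0^2 /
  4r) beats every power of 1/r, so |g'_r(\<eta>)| \<le> C (1 + |\<eta>|^2)^(-p) uniformly in 0 < r
  \<le> t, for every p. As \<nu> is tempered, the second moments of W(s)(\<psi>_s) are bounded
  uniformly in s, and Fubini applies even when the right-hand side of the estimate is infinite. The
  same decay gives g_0 = 0, so the integral of g'_(t-s) over \<sigma> < s < t is exactly
  g_(t-\<sigma>): the Laplacian in the kernel is undone by the time integral. Each final bound
  sacrifices one of the two decaying factors of g_r^2: dropping exp (- 2 r |\<eta>|^2) serves low
  frequencies, taking the supremum of the other factor serves high ones, and 1/m \<le> 2 then yields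
  the weight |\<eta>|^(-1/m). The kernel \<open>G\<close> is known only through the solutions that
  it generates, hence the detour through uniqueness.\<close>

lemma second_deriv_nonpos_at_max:
  fixes g g' :: "real \<Rightarrow> real"
  assumes "d > 0"
    and g: "\<And>h. \<bar>h\<bar> < d \<Longrightarrow> (g has_real_derivative g' h) (at h)"
    and g': "(g' has_real_derivative c) (at 0)"
    and max: "\<And>h. \<bar>h\<bar> < d \<Longrightarrow> g h \<le> g 0"
  shows "c \<le> 0"
proof (rule ccontr)
  assume "\<not> c \<le> 0"
  then have c: "c > 0" by simp
  have "g' 0 = 0"
    by (rule DERIV_local_max[OF g[of 0] \<open>d > 0\<close>]) (use \<open>d > 0\<close> max in auto)
  \<comment> \<open>A positive second derivative makes \<open>g'\<close> positive just to the right
    of its zero, so \<open>g\<close> would climb above its maximum.\<close>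
  then obtain e where e: "e > 0" "\<And>h. 0 < h \<Longrightarrow> h < e \<Longrightarrow> g' h > 0"
    using DERIV_pos_inc_right[OF g' c] by auto
  define h where "h = min d e / 2"
  have h: "0 < h" "h < d" "h < e" using \<open>d > 0\<close> e by (auto simp: h_def)
  have "g 0 < g h"
  proof (rule DERIV_pos_imp_increasing_open[OF h(1)])
    fix x assume "0 < x" "x < h"
    then show "\<exists>y. DERIV g x :> y \<and> y > 0" using g[of x] e(2)[of x] h by (intro exI[of _ "g' x"]) auto
  next
    show "continuous_on {0..h} g"
      by (intro continuous_at_imp_continuous_on ballI) (use h in \<open>auto intro: DERIV_isCont[OF g]\<close>)
  qed
  with max[of h] h show False by auto
qed

lemma partial_derivI:
  assumes "((\<lambda>h. f (x + h *\<^sub>R b)) has_real_derivative c) (at 0)"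
  shows "partial_deriv b f x = c"
  unfolding partial_deriv_def using assms by (rule DERIV_imp_deriv)

lemma has_partial_deriv:
  assumes "f differentiable (at x)"
  shows "((\<lambda>h. f (x + h *\<^sub>R b)) has_real_derivative partial_deriv b f x) (at 0)"
proof -
  obtain f' where f': "(f has_derivative f') (at x)" using assms by (auto simp: differentiable_def)
  have "((\<lambda>h. x + h *\<^sub>R b) has_derivative (\<lambda>h. h *\<^sub>R b)) (at (0::real))"
    by (auto intro!: derivative_eq_intros)
  from has_derivative_compose[OF this, of f f'] f'
  have "((\<lambda>h. f (x + h *\<^sub>R b)) has_derivative (\<lambda>h. f' (h *\<^sub>R b))) (at 0)" by simp
  also have "(\<lambda>h. f' (h *\<^sub>R b)) = (\<lambda>h. h * f' b)"
    using has_derivative_linear[OF f'] by (simp add: linear_scale)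
  finally have "((\<lambda>h. f (x + h *\<^sub>R b)) has_real_derivative f' b) (at 0)"
    by (auto simp: has_field_derivative_def mult.commute[of _ "f' b"])
  with partial_derivI[OF this] show ?thesis by simp
qed

lemma has_partial_deriv_along:
  assumes "f differentiable (at (x + h *\<^sub>R b))"
  shows "((\<lambda>h. f (x + h *\<^sub>R b)) has_real_derivative partial_deriv b f (x + h *\<^sub>R b)) (at h)"
proof -
  have "((\<lambda>k. f (x + h *\<^sub>R b + k *\<^sub>R b)) has_real_derivative partial_deriv b f (x + h *\<^sub>R b)) (at 0)"
    by (rule has_partial_deriv[OF assms])
  then show ?thesis
    using DERIV_shift[of "\<lambda>h. f (x + h *\<^sub>R b)" "partial_deriv b f (x + h *\<^sub>R b)" 0 h]
    by (simp add: algebra_simps)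
qed

text \<open>The one-dimensional test is applied along each axis to f - e |.|^2; each axis
  contributes the second derivative 2 e of the quadratic.\<close>

lemma laplacian_le_at_max:
  fixes f :: "'a::euclidean_space \<Rightarrow> real"
  assumes "open D" "x \<in> D"
    and f: "f differentiable_on D" "\<And>b. b \<in> Basis \<Longrightarrow> partial_deriv b f differentiable_on D"
    and max: "\<And>y. y \<in> D \<Longrightarrow> f y - e * (norm y)\<^sup>2 \<le> f x - e * (norm x)\<^sup>2"
  shows "laplacian f x \<le> 2 * e * real DIM('a)"
proof -
  obtain d where d: "d > 0" "ball x d \<subseteq> D" using assms open_contains_ball by blast
  have "iter_partial_deriv [b, b] f x \<le> 2 * e" if b: "b \<in> Basis" for b
  proof -
    have inD: "x + h *\<^sub>R b \<in> D" if "\<bar>h\<bar> < d" for h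
      using d that b by (auto simp: dist_norm subset_eq)
    have "iter_partial_deriv [b, b] f x - 2 * e \<le> 0"
    proof (rule second_deriv_nonpos_at_max[OF d(1)])
      fix h :: real assume h: "\<bar>h\<bar> < d"
      have "f differentiable (at (x + h *\<^sub>R b))"
        using f(1) inD[OF h] \<open>open D\<close> by (auto simp: differentiable_on_eq_differentiable_at)
      from has_partial_deriv_along[OF this]
      show "((\<lambda>h. f (x + h *\<^sub>R b) - e * ((norm x)\<^sup>2 + 2 * h * (x \<bullet> b) + h\<^sup>2)) has_real_derivative
          partial_deriv b f (x + h *\<^sub>R b) - e * (2 * (x \<bullet> b) + 2 * h)) (at h)"
        by (auto intro!: derivative_eq_intros)
    next
      have "partial_deriv b f differentiable (at x)"
        using f(2)[OF b] assms(1,2) by (auto simp: differentiable_on_eq_differentiable_at)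
      from has_partial_deriv[OF this, of b]
      show "((\<lambda>h. partial_deriv b f (x + h *\<^sub>R b) - e * (2 * (x \<bullet> b) + 2 * h)) has_real_derivative
          iter_partial_deriv [b, b] f x - 2 * e) (at 0)"
        by (auto intro!: derivative_eq_intros)
    next
      fix h :: real assume h: "\<bar>h\<bar> < d"
      have "(norm (x + h *\<^sub>R b))\<^sup>2 = (norm x)\<^sup>2 + 2 * h * (x \<bullet> b) + h\<^sup>2"
        unfolding power2_norm_eq_inner inner_add_left inner_add_right inner_scaleR_left inner_scaleR_right
        using b by (simp add: inner_commute[of b x] inner_same_Basis power2_eq_square algebra_simps)
      with max[OF inD[OF h]]
      show "f (x + h *\<^sub>R b) - e * ((norm x)\<^sup>2 + 2 * h * (x \<bullet> b) + h\<^sup>2)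
        \<le> f (x + 0 *\<^sub>R b) - e * ((norm x)\<^sup>2 + 2 * 0 * (x \<bullet> b) + 0\<^sup>2)"
        by simp
    qed
    then show ?thesis by simp
  qed
  then have "laplacian f x \<le> (\<Sum>b\<in>(Basis::'a set). 2 * e)"
    unfolding laplacian_def by (intro sum_mono)
  then show ?thesis by (simp add: mult.commute)
qed

lemma partial_deriv_diff:
  assumes "f differentiable (at x)" "g differentiable (at x)"
  shows "partial_deriv b (\<lambda>x. f x - g x) x = partial_deriv b f x - partial_deriv b g x"
  by (rule partial_derivI) (intro derivative_intros has_partial_deriv assms)

lemma partial_deriv_cong:
  assumes "open D" "x \<in> D" "\<And>y. y \<in> D \<Longrightarrow> f y = g y"
  shows "partial_deriv b f x = partial_deriv b g x"
proof -
  obtain d where d: "d > 0" "ball x d \<subseteq> D" using assms open_contains_ball by blast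
  have "((\<lambda>h. x + h *\<^sub>R b) \<longlongrightarrow> x) (at (0::real))" by (auto intro!: tendsto_eq_intros)
  then have "\<forall>\<^sub>F h in at 0. x + h *\<^sub>R b \<in> D"
    using assms(1,2) by (rule topological_tendstoD)
  then have "\<forall>\<^sub>F h in nhds 0. f (x + h *\<^sub>R b) = g (x + h *\<^sub>R b)"
    using assms by (auto simp: eventually_at_filter elim!: eventually_mono)
  then show ?thesis unfolding partial_deriv_def by (rule deriv_cong_ev) simp
qed

lemma laplacian_cong:
  assumes "open D" "x \<in> D" "\<And>y. y \<in> D \<Longrightarrow> f y = g y"
  shows "laplacian f x = laplacian g x"
  unfolding laplacian_def
  using assms by (auto intro!: sum.cong partial_deriv_cong[of D])

lemma laplacian_diff:
  assumes "open D" "x \<in> D" "f differentiable_on D" "g differentiable_on D"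
    and "\<And>b. b \<in> Basis \<Longrightarrow> partial_deriv b f differentiable_on D"
    and "\<And>b. b \<in> Basis \<Longrightarrow> partial_deriv b g differentiable_on D"
  shows "laplacian (\<lambda>x. f x - g x) x = laplacian f x - laplacian g x"
proof -
  have at: "u differentiable (at y)" if "u differentiable_on D" "y \<in> D" for u :: "'a \<Rightarrow> real" and y
    using that \<open>open D\<close> by (auto simp: differentiable_on_eq_differentiable_at)
  have "partial_deriv b (partial_deriv b (\<lambda>x. f x - g x)) x
      = partial_deriv b (\<lambda>x. partial_deriv b f x - partial_deriv b g x) x" for b
    by (rule partial_deriv_cong[OF assms(1,2)]) (auto intro!: partial_deriv_diff at assms)
  also have "\<dots> b = partial_deriv b (partial_deriv b f) x - partial_deriv b (partial_deriv b g) x"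
    if "b \<in> Basis" for b
    using that by (auto intro!: partial_deriv_diff at assms)
  finally show ?thesis unfolding laplacian_def by (simp add: sum_subtractf)
qed

lemma differentiable_on_transform:
  assumes "f differentiable_on S" "\<And>x. x \<in> S \<Longrightarrow> g x = f x"
  shows "g differentiable_on S"
  using assms unfolding differentiable_on_def
  by (metis differentiable_transform_within zero_less_one)

section \<open>Uniqueness of bounded solutions\<close>

lemma dirichlet_heat_solution_diff:
  assumes "open D" "dirichlet_heat_solution D f v" "dirichlet_heat_solution D g w"
  shows "dirichlet_heat_solution D (\<lambda>x. f x - g x) (\<lambda>t x. v t x - w t x)"
proof -
  note v = assms(2)[unfolded dirichlet_heat_solution_def]
  note w = assms(3)[unfolded dirichlet_heat_solution_def]
  have at: "u differentiable (at y)" if "u differentiable_on D" "y \<in> D" for u :: "'a \<Rightarrow> real" and y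
    using that \<open>open D\<close> by (auto simp: differentiable_on_eq_differentiable_at)
  have "continuous_on ({0..} \<times> closure D) (\<lambda>(t, x). v t x - w t x)"
    using v w by (auto simp: case_prod_unfold intro!: continuous_intros)
  moreover have "bounded ((\<lambda>(t, x). v t x - w t x) ` ({0..} \<times> closure D))"
    using bounded_minus_comp[of "\<lambda>(t, x). v t x" "{0..} \<times> closure D" "\<lambda>(t, x). w t x"] v w
    by (simp add: case_prod_unfold)
  moreover have "(\<lambda>x. v t x - w t x) differentiable_on D" if "t > 0" for t
    using v w that by (intro differentiable_on_diff) auto
  moreover have "partial_deriv b (\<lambda>x. v t x - w t x) differentiable_on D" if "t > 0" "b \<in> Basis" for t b
  proof -
    have "(\<lambda>x. partial_deriv b (v t) x - partial_deriv b (w t) x) differentiable_on D"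
      using v w that by (intro differentiable_on_diff) auto
    moreover have "partial_deriv b (\<lambda>x. v t x - w t x) x
        = partial_deriv b (v t) x - partial_deriv b (w t) x" if "x \<in> D" for x
      using v w that \<open>t > 0\<close> by (intro partial_deriv_diff at) auto
    ultimately show ?thesis by (rule differentiable_on_transform)
  qed
  moreover have "((\<lambda>s. v s x - w s x) has_real_derivative laplacian (\<lambda>x. v t x - w t x) x) (at t)"
    if "t > 0" "x \<in> D" for t x
  proof -
    have "laplacian (\<lambda>x. v t x - w t x) x = laplacian (v t) x - laplacian (w t) x"
      using v w that by (intro laplacian_diff[OF \<open>open D\<close>]) auto
    then show ?thesis using v w that by (auto intro!: derivative_intros)
  qed
  ultimately show ?thesis
    unfolding dirichlet_heat_solution_def using v w by auto
qed

text \<open>The comparison function is \<open>\<epsilon> (|x|\<^sup>2 + (2 n + 1) t)\<close>, a strict supersolution that dominates any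
  bounded function at infinity.\<close>

lemma dirichlet_heat_solution_nonpos:
  fixes D :: "'a::euclidean_space set"
  assumes "open D" and sol: "dirichlet_heat_solution D (\<lambda>_. 0) z"
    and "t \<ge> 0" "x \<in> closure D"
  shows "z t x \<le> 0"
proof (rule ccontr)
  assume pos: "\<not> z t x \<le> 0"
  note z = sol[unfolded dirichlet_heat_solution_def]
  \<comment> \<open>One more than the Laplacian 2 n of the squared norm; this unit of slack yields
    the final contradiction.\<close>
  define N where "N = 2 * real DIM('a) + 1"
  obtain B where B: "\<And>s y. s \<ge> 0 \<Longrightarrow> y \<in> closure D \<Longrightarrow> \<bar>z s y\<bar> \<le> B"
  proof -
    have "bounded ((\<lambda>p. z (fst p) (snd p)) ` ({0..} \<times> closure D))"
      using z by (simp add: case_prod_unfold)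
    then obtain B where "\<forall>p\<in>{0..} \<times> closure D. norm (z (fst p) (snd p)) \<le> B"
      unfolding bounded_iff by blast
    then show ?thesis using that[of B] by force
  qed
  \<comment> \<open>Chosen so that the comparison function at (t, x) is at most half of
    \<open>z t x\<close>.\<close>
  define e where "e = z t x / (2 * ((norm x)\<^sup>2 + N * t + 1))"
  have den: "(norm x)\<^sup>2 + N * t + 1 > 0"
    using \<open>t \<ge> 0\<close> by (auto simp: N_def intro!: add_nonneg_pos add_nonneg_nonneg mult_nonneg_nonneg)
  have e: "e > 0" using pos den by (auto simp: e_def)
  define \<phi> where "\<phi> = (\<lambda>(s, y). z s y - e * ((norm y)\<^sup>2 + N * s))"
  have "e * ((norm x)\<^sup>2 + N * t) < z t x"
  proof -
    have "e * ((norm x)\<^sup>2 + N * t) \<le> e * ((norm x)\<^sup>2 + N * t + 1)" using e by simp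
    also have "\<dots> = z t x / 2" using den by (simp add: e_def field_simps)
    finally show ?thesis using pos by simp
  qed
  then have \<phi>pos: "\<phi> (t, x) > 0" by (simp add: \<phi>_def)
  \<comment> \<open>Beyond this radius the squared norm exceeds R, because R is at least 1, and
    \<open>e * R\<close> exceeds B. So the maximum over the compact set \<open>K\<close> is a
    maximum over all of \<open>{0..t} \<times> closure D\<close>.\<close>
  define R where "R = B / e + 1"
  define K where "K = {0..t} \<times> (closure D \<inter> cball 0 R)"
  have B0: "B \<ge> 0" using B[OF assms(3,4)] by linarith
  then have R: "R \<ge> 1" using e by (auto simp: R_def)
  have out: "\<phi> (s, y) < 0" if "s \<in> {0..t}" "y \<in> closure D" "y \<notin> cball 0 R" for s y
  proof -
    have "norm y > R" using that by (simp add: dist_norm)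
    then have "(norm y)\<^sup>2 > R" using R
      by (smt (verit) mult_le_cancel_left1 power2_eq_square)
    then have "e * R < e * (norm y)\<^sup>2" using e by simp
    moreover have "B < e * R" using e by (simp add: R_def field_simps)
    ultimately have "B < e * (norm y)\<^sup>2" by linarith
    moreover have "e * (N * s) \<ge> 0" using e that by (auto simp: N_def)
    ultimately show ?thesis using B[of s y] that by (auto simp: \<phi>_def algebra_simps)
  qed
  have "compact K" unfolding K_def by (intro compact_Times compact_Icc closed_Int_compact) auto
  moreover have xK: "(t, x) \<in> K" using out[of t x] \<phi>pos assms by (auto simp: K_def)
  moreover have "continuous_on K \<phi>"
  proof -
    have "continuous_on ({0..} \<times> closure D) (\<lambda>p. z (fst p) (snd p))"
      using z by (simp add: case_prod_unfold)
    then have "continuous_on K (\<lambda>p. z (fst p) (snd p))"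
      by (rule continuous_on_subset) (auto simp: K_def)
    then show ?thesis unfolding \<phi>_def case_prod_unfold by (intro continuous_intros)
  qed
  ultimately obtain p where p: "p \<in> K" "\<And>q. q \<in> K \<Longrightarrow> \<phi> q \<le> \<phi> p"
    using continuous_attains_sup[of K \<phi>] by blast
  obtain s y where sy: "p = (s, y)" by (cases p)
  have s: "0 \<le> s" "s \<le> t" and y: "y \<in> closure D" using p(1) by (auto simp: K_def sy)
  have max: "\<phi> (s', y') \<le> \<phi> (s, y)" if "s' \<in> {0..t}" "y' \<in> closure D" for s' y'
  proof (cases "y' \<in> cball 0 R")
    case True
    then show ?thesis using p(2)[of "(s', y')"] that by (auto simp: K_def sy)
  next
    case False
    then show ?thesis using out[OF that False] \<phi>pos p(2)[OF xK] by (auto simp: sy)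
  qed
  have syp: "\<phi> (s, y) > 0" using p(2)[OF xK] \<phi>pos by (simp add: sy)
  then have zsy: "z s y > 0"
  proof -
    have "e * ((norm y)\<^sup>2 + N * s) \<ge> 0"
      using e s by (auto simp: N_def intro!: mult_nonneg_nonneg add_nonneg_nonneg)
    then show ?thesis using syp by (simp add: \<phi>_def)
  qed
  then have "s \<noteq> 0" using z y by auto
  with s have s0: "s > 0" by simp
  have yD: "y \<in> D"
  proof (rule ccontr)
    assume "y \<notin> D"
    then have "y \<in> frontier D" using y \<open>open D\<close> by (simp add: frontier_def interior_open)
    then show False using z s0 zsy by auto
  qed
  have der: "((\<lambda>s. z s y) has_real_derivative laplacian (z s) y) (at s)" using z s0 yD by auto
  have "laplacian (z s) y \<le> 2 * e * real DIM('a)"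
  proof (rule laplacian_le_at_max[OF \<open>open D\<close> yD])
    show "z s y' - e * (norm y')\<^sup>2 \<le> z s y - e * (norm y)\<^sup>2" if "y' \<in> D" for y'
      using max[of s y'] s that closure_subset[of D] by (auto simp: \<phi>_def algebra_simps)
  qed (use z s0 in auto)
  \<comment> \<open>The maximum may sit at the final time s = t, where only earlier times are
    available for comparison; hence the derivative is tested from the left.\<close>
  moreover have "laplacian (z s) y - e * N \<ge> 0"
  proof (rule ccontr)
    assume neg: "\<not> laplacian (z s) y - e * N \<ge> 0"
    have "((\<lambda>s. z s y - e * ((norm y)\<^sup>2 + N * s)) has_real_derivative laplacian (z s) y - e * N) (at s)"
      using der by (auto intro!: derivative_eq_intros)
    from DERIV_neg_dec_left[OF this] neg
    obtain d where d: "d > 0" "\<And>h. 0 < h \<Longrightarrow> h < d \<Longrightarrow> \<phi> (s, y) < \<phi> (s - h, y)"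
      by (auto simp: \<phi>_def)
    define h where "h = min s d / 2"
    have "0 < h" "h < d" "h \<le> s" using s0 d by (auto simp: h_def)
    then show False using d(2)[of h] max[of "s - h" y] s y by auto
  qed
  ultimately show False using e by (auto simp: N_def algebra_simps)
qed

lemma dirichlet_heat_solution_unique:
  assumes "open D" "dirichlet_heat_solution D f v" "dirichlet_heat_solution D f w"
    and "t \<ge> 0" "x \<in> closure D"
  shows "v t x = w t x"
  using dirichlet_heat_solution_nonpos[OF assms(1), of "\<lambda>t x. v t x - w t x"]
    dirichlet_heat_solution_nonpos[OF assms(1), of "\<lambda>t x. w t x - v t x"]
    dirichlet_heat_solution_diff[OF assms(1,2,3)] dirichlet_heat_solution_diff[OF assms(1,3,2)]
    assms(4,5)
  by fastforce

subsection \<open>Gaussian integrals and Fourier transforms\<close>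

text \<open>Rescaling by s = sqrt (2 a) reduces this to the characteristic function of the standard
  normal law.\<close>

lemma gaussian_fourier_real:
  fixes a y :: real
  assumes "a > 0"
  shows "has_bochner_integral lborel (\<lambda>z. iexp (z * y) * complex_of_real (exp (- a * z\<^sup>2)))
    (complex_of_real (sqrt (pi / a) * exp (- y\<^sup>2 / (4 * a))))"
proof -
  define s where "s = sqrt (2 * a)"
  have s: "s > 0" "s\<^sup>2 = 2 * a" using assms by (auto simp: s_def)
  let ?f = "\<lambda>x. iexp (y / s * x) * complex_of_real (exp (- x\<^sup>2 / 2))"
  have meas: "(\<lambda>x::real. iexp (y / s * x)) \<in> borel_measurable borel" by measurable
  have "integrable std_normal_distribution (\<lambda>x. iexp (y / s * x))"
    using prob_space.finite_measure[OF prob_space_normal_density[of 1 0]] 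
    by (intro finite_measure.integrable_const_bound[where B=1]) auto
  then have 1: "integrable lborel (\<lambda>x. std_normal_density x *\<^sub>R iexp (y / s * x))"
    by (subst (asm) integrable_density) (use meas in \<open>auto simp: normal_density_nonneg\<close>)
  have "char std_normal_distribution (y / s) = (\<integral>x. std_normal_density x *\<^sub>R iexp (y / s * x) \<partial>lborel)"
    unfolding char_def by (subst integral_density) (use meas in \<open>auto simp: normal_density_nonneg\<close>)
  with 1 have "has_bochner_integral lborel (\<lambda>x. std_normal_density x *\<^sub>R iexp (y / s * x))
      (complex_of_real (exp (- (y / s)\<^sup>2 / 2)))"
    by (simp add: has_bochner_integral_iff char_std_normal_distribution)
  then have "has_bochner_integral lborel (\<lambda>x. sqrt (2 * pi) *\<^sub>R (std_normal_density x *\<^sub>R iexp (y / s * x)))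
      (sqrt (2 * pi) *\<^sub>R complex_of_real (exp (- (y / s)\<^sup>2 / 2)))"
    by (rule has_bochner_integral_scaleR_right)
  also have "(\<lambda>x. sqrt (2 * pi) *\<^sub>R (std_normal_density x *\<^sub>R iexp (y / s * x))) = ?f"
    by (auto simp: std_normal_density_def scaleR_conv_of_real fun_eq_iff)
  finally have "has_bochner_integral lborel ?f (complex_of_real (sqrt (2 * pi) * exp (- (y / s)\<^sup>2 / 2)))"
    by (simp add: scaleR_conv_of_real)
  then have "has_bochner_integral lborel (\<lambda>x. ?f (0 + s * x))
      (complex_of_real (sqrt (2 * pi) * exp (- (y / s)\<^sup>2 / 2)) /\<^sub>R \<bar>s\<bar>)"
    by (rule lborel_has_bochner_integral_real_affine_iff[THEN iffD1, rotated]) (use s in auto)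
  also have "(\<lambda>x. ?f (0 + s * x)) = (\<lambda>z. iexp (z * y) * complex_of_real (exp (- a * z\<^sup>2)))"
  proof
    fix z
    have "y / s * (0 + s * z) = z * y" using s(1) by simp
    moreover have "- (0 + s * z)\<^sup>2 / 2 = - a * z\<^sup>2" by (simp add: power_mult_distrib s(2))
    ultimately show "?f (0 + s * z) = iexp (z * y) * complex_of_real (exp (- a * z\<^sup>2))" by metis
  qed
  also have "complex_of_real (sqrt (2 * pi) * exp (- (y / s)\<^sup>2 / 2)) /\<^sub>R \<bar>s\<bar>
      = complex_of_real (sqrt (pi / a) * exp (- y\<^sup>2 / (4 * a)))"
  proof -
    have "sqrt (2 * pi) / s = sqrt (pi / a)"
      using assms by (simp add: s_def real_sqrt_divide real_sqrt_mult)
    moreover have "- (y / s)\<^sup>2 / 2 = - y\<^sup>2 / (4 * a)" using s by (simp add: power_divide)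
    ultimately have "sqrt (2 * pi) * exp (- (y / s)\<^sup>2 / 2) / s = sqrt (pi / a) * exp (- y\<^sup>2 / (4 * a))"
      by (metis times_divide_eq_left)
    moreover have "complex_of_real c /\<^sub>R \<bar>s\<bar> = complex_of_real (c / s)" for c
      using s(1) by (simp add: scaleR_conv_of_real divide_inverse mult.commute)
    ultimately show ?thesis by metis
  qed
  finally show ?thesis .
qed

text \<open>Integrand and measure both factor over the coordinates: \<open>lborel\<close> is the
  image of a product of one-dimensional Lebesgue measures under \<open>?T\<close>.\<close>

lemma gaussian_fourier:
  fixes y :: "'a::euclidean_space"
  assumes "a > 0"
  shows "has_bochner_integral lborel
    (\<lambda>z. exp (\<i> * complex_of_real (z \<bullet> y)) * complex_of_real (exp (- a * (norm z)\<^sup>2)))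
    (complex_of_real ((pi / a) powr (real DIM('a) / 2) * exp (- (norm y)\<^sup>2 / (4 * a))))"
proof -
  interpret product_sigma_finite "\<lambda>_::'a. lborel :: real measure" ..
  let ?f = "\<lambda>z::'a. exp (\<i> * complex_of_real (z \<bullet> y)) * complex_of_real (exp (- a * (norm z)\<^sup>2))"
  let ?g = "\<lambda>(b::'a) z. iexp (z * (y \<bullet> b)) * complex_of_real (exp (- a * z\<^sup>2))"
  let ?T = "\<lambda>u::'a \<Rightarrow> real. \<Sum>b\<in>Basis. u b *\<^sub>R b"
  have eq: "?f (?T u) = (\<Prod>b\<in>Basis. ?g b (u b))" for u
  proof -
    have "?T u \<bullet> y = (\<Sum>b\<in>Basis. u b * (y \<bullet> b))"
      by (simp only: inner_sum_left inner_scaleR_left inner_commute[of y])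
    moreover have "(norm (?T u))\<^sup>2 = (\<Sum>b\<in>Basis. (u b)\<^sup>2)"
      unfolding power2_norm_eq_inner
      by (simp add: euclidean_inner[of "?T u" "?T u"] inner_sum_left_Basis power2_eq_square)
    ultimately show ?thesis
      by (simp add: prod.distrib sum_distrib_left flip: of_real_prod exp_sum)
  qed
  have int: "integrable lborel (?g b)" for b
    using gaussian_fourier_real[OF assms, of "y \<bullet> b"] by (simp add: has_bochner_integral_iff)
  have meas: "?f \<in> borel_measurable borel" by measurable
  have "integrable (Pi\<^sub>M Basis (\<lambda>_. lborel)) (\<lambda>u. \<Prod>b\<in>Basis. ?g b (u b))"
    by (intro product_integrable_prod int) auto
  then have "integrable (Pi\<^sub>M Basis (\<lambda>_. lborel)) (\<lambda>u. ?f (?T u))" unfolding eq .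
  then have "integrable lborel ?f"
    by (subst lborel_eq, subst integrable_distr_eq) (use meas in auto)
  moreover have "integral\<^sup>L lborel ?f = complex_of_real ((pi / a) powr (real DIM('a) / 2) * exp (- (norm y)\<^sup>2 / (4 * a)))"
  proof -
    have "integral\<^sup>L lborel ?f = (\<integral>u. ?f (?T u) \<partial>Pi\<^sub>M Basis (\<lambda>_. lborel))"
      by (subst lborel_eq, subst integral_distr) (use meas in auto)
    also have "\<dots> = (\<integral>u. (\<Prod>b\<in>Basis. ?g b (u b)) \<partial>Pi\<^sub>M Basis (\<lambda>_. lborel))"
      unfolding eq ..
    also have "\<dots> = (\<Prod>b\<in>(Basis::'a set). integral\<^sup>L lborel (?g b))"
      by (intro product_integral_prod int) auto
    also have "\<dots> = (\<Prod>b\<in>(Basis::'a set). complex_of_real (sqrt (pi / a) * exp (- (y \<bullet> b)\<^sup>2 / (4 * a))))"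
      using gaussian_fourier_real[OF assms] by (intro prod.cong refl) (simp add: has_bochner_integral_iff)
    also have "\<dots> = complex_of_real (sqrt (pi / a) ^ DIM('a) * exp (\<Sum>b\<in>Basis. - (y \<bullet> b)\<^sup>2 / (4 * a)))"
      by (simp add: prod.distrib exp_sum flip: of_real_prod)
    also have "(\<Sum>b\<in>Basis. - (y \<bullet> b)\<^sup>2 / (4 * a)) = - (norm y)\<^sup>2 / (4 * a)"
      unfolding power2_norm_eq_inner
      by (simp add: euclidean_inner[of y y] power2_eq_square sum_negf sum_divide_distrib)
    also have "sqrt (pi / a) ^ DIM('a) = (pi / a) powr (real DIM('a) / 2)"
      using assms by (simp add: powr_half_sqrt[symmetric] powr_powr powr_realpow[symmetric])
    finally show ?thesis .
  qed
  ultimately show ?thesis by (simp add: has_bochner_integral_iff)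
qed

lemma
  fixes a :: real
  assumes "a > 0"
  shows integrable_gaussian: "integrable lborel (\<lambda>z::'a::euclidean_space. exp (- a * (norm z)\<^sup>2))"
    and integral_gaussian: "(\<integral>z. exp (- a * (norm (z::'a::euclidean_space))\<^sup>2) \<partial>lborel) = (pi / a) powr (real DIM('a) / 2)"
  using gaussian_fourier[OF assms, of "0::'a"]
  by (auto simp: has_bochner_integral_iff complex_of_real_integrable_eq simp del: of_real_exp)

text \<open>Half of the exponential is spent on the factor q, by u \<le> exp u at u = a q /
  2.\<close>

lemma mult_exp_minus_le:
  fixes a q :: real
  assumes "a > 0" "q \<ge> 0"
  shows "q * exp (- a * q) \<le> 2 / a * exp (- (a / 2) * q)"
proof -
  have "a / 2 * q \<le> exp (a / 2 * q)" using exp_ge_add_one_self[of "a / 2 * q"] by linarith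
  then have "a / 2 * q * exp (- a * q) \<le> exp (a / 2 * q) * exp (- a * q)"
    by (intro mult_right_mono) auto
  also have "\<dots> = exp (- (a / 2) * q)" by (simp add: field_simps flip: exp_add)
  finally show ?thesis using assms by (simp add: field_simps)
qed

lemma integrable_norm2_gaussian:
  assumes "a > 0"
  shows "integrable lborel (\<lambda>z::'a::euclidean_space. (norm z)\<^sup>2 * exp (- a * (norm z)\<^sup>2))"
  using mult_exp_minus_le[OF assms] assms
  by (intro Bochner_Integration.integrable_bound
      [OF integrable_mult_right[OF integrable_gaussian[of "a / 2"], of "2 / a"]]) auto

text \<open>This is minus the derivative in a of the plain Gaussian transform, taken under the
  integral by dominated convergence.\<close>

lemma norm2_gaussian_fourier:
  fixes y :: "'a::euclidean_space"
  assumes a: "a > 0"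
  shows "has_bochner_integral lborel
    (\<lambda>z. exp (\<i> * complex_of_real (z \<bullet> y)) * complex_of_real ((norm z)\<^sup>2 * exp (- a * (norm z)\<^sup>2)))
    (complex_of_real ((real DIM('a) / (2 * a) - (norm y)\<^sup>2 / (4 * a\<^sup>2))
      * (pi / a) powr (real DIM('a) / 2) * exp (- (norm y)\<^sup>2 / (4 * a))))"
proof -
  define \<Phi> where "\<Phi> = (\<lambda>a. (pi / a) powr (real DIM('a) / 2) * exp (- (norm y)\<^sup>2 / (4 * a)))"
  define \<Phi>' where "\<Phi>' = - (real DIM('a) / (2 * a) - (norm y)\<^sup>2 / (4 * a\<^sup>2)) * \<Phi> a"
  define e where "e = (\<lambda>z. exp (\<i> * complex_of_real (z \<bullet> y)))"
  \<comment> \<open>The increments of a are positive, so \<open>exp (- (a + h n) * q)\<close> never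
    exceeds \<open>exp (- a * q)\<close> for q \<ge> 0, and one integrable function dominates all
    difference quotients.\<close>
  define h where "h = (\<lambda>n. 1 / real (Suc n))"
  define d where "d = (\<lambda>n (z::'a). (exp (- (a + h n) * (norm z)\<^sup>2) - exp (- a * (norm z)\<^sup>2)) / h n)"
  have h: "h \<longlonglongrightarrow> 0" "h n > 0" for n
    unfolding h_def using LIMSEQ_inverse_real_of_nat by (auto simp: inverse_eq_divide)
  have [measurable]: "e \<in> borel_measurable borel" unfolding e_def by measurable
  have [simp]: "norm (e z) = 1" for z by (simp add: e_def norm_exp_i_times)
  have int: "has_bochner_integral lborel (\<lambda>z. e z * complex_of_real (exp (- b * (norm z)\<^sup>2))) (complex_of_real (\<Phi> b))"
    if "b > 0" for b
    using gaussian_fourier[OF that, of y] by (simp add: e_def \<Phi>_def)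
  have dint: "(\<integral>z. e z * complex_of_real (d n z) \<partial>lborel) = complex_of_real ((\<Phi> (a + h n) - \<Phi> a) / h n)" for n
  proof -
    have "has_bochner_integral lborel
      (\<lambda>z. (e z * complex_of_real (exp (- (a + h n) * (norm z)\<^sup>2)) - e z * complex_of_real (exp (- a * (norm z)\<^sup>2))) / complex_of_real (h n))
      ((complex_of_real (\<Phi> (a + h n)) - complex_of_real (\<Phi> a)) / complex_of_real (h n))"
      using a h(2)[of n] by (intro has_bochner_integral_divide_zero has_bochner_integral_diff int) auto
    then show ?thesis
      by (simp add: has_bochner_integral_iff d_def diff_divide_distrib right_diff_distrib)
  qed
  have d_lim: "(\<lambda>n. d n z) \<longlonglongrightarrow> - (norm z)\<^sup>2 * exp (- a * (norm z)\<^sup>2)" for z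
  proof -
    have "((\<lambda>b. exp (- b * (norm z)\<^sup>2)) has_real_derivative - (norm z)\<^sup>2 * exp (- a * (norm z)\<^sup>2)) (at a)"
      by (auto intro!: derivative_eq_intros)
    then have "((\<lambda>k. (exp (- (a + k) * (norm z)\<^sup>2) - exp (- a * (norm z)\<^sup>2)) / k) \<longlongrightarrow> - (norm z)\<^sup>2 * exp (- a * (norm z)\<^sup>2)) (at 0)"
      unfolding DERIV_def .
    then show ?thesis unfolding d_def
      by (rule filterlim_compose) (use h in \<open>auto simp: filterlim_at intro!: always_eventually less_imp_neq[THEN not_sym]\<close>)
  qed
  have d_bound: "\<bar>d n z\<bar> \<le> (norm z)\<^sup>2 * exp (- a * (norm z)\<^sup>2)" for n z
  proof -
    let ?q = "(norm z)\<^sup>2"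
    have "exp (- (a + h n) * ?q) = exp (- a * ?q) * exp (- h n * ?q)"
      by (simp add: algebra_simps flip: exp_add)
    then have "exp (- (a + h n) * ?q) - exp (- a * ?q) = - (exp (- a * ?q) * (1 - exp (- h n * ?q)))"
      by (simp only: right_diff_distrib mult_1_right minus_diff_eq)
    moreover have "exp (- h n * ?q) \<le> 1" using h(2)[of n] by simp
    ultimately have "\<bar>exp (- (a + h n) * ?q) - exp (- a * ?q)\<bar> = exp (- a * ?q) * (1 - exp (- h n * ?q))"
      by (simp only: abs_minus_cancel abs_mult abs_exp_cancel)
    also have "\<dots> \<le> exp (- a * ?q) * (h n * ?q)"
      using exp_ge_add_one_self[of "- h n * ?q"] by (intro mult_left_mono) auto
    finally show ?thesis using h(2)[of n] by (simp add: d_def field_simps)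
  qed
  let ?w = "\<lambda>z::'a. (norm z)\<^sup>2 * exp (- a * (norm z)\<^sup>2)"
  have "(\<lambda>n. \<integral>z. e z * complex_of_real (d n z) \<partial>lborel) \<longlonglongrightarrow> (\<integral>z. e z * complex_of_real (- ?w z) \<partial>lborel)"
  proof (rule integral_dominated_convergence[where w="?w"])
    show "AE z in lborel. (\<lambda>n. e z * complex_of_real (d n z)) \<longlonglongrightarrow> e z * complex_of_real (- ?w z)"
      using d_lim by (intro always_eventually allI tendsto_intros) auto
    show "AE z in lborel. norm (e z * complex_of_real (d n z)) \<le> ?w z" for n
      using d_bound by (auto simp: norm_mult)
  qed (use integrable_norm2_gaussian[OF a] in \<open>auto simp: d_def\<close>)
  moreover have "(\<lambda>n. complex_of_real ((\<Phi> (a + h n) - \<Phi> a) / h n)) \<longlonglongrightarrow> complex_of_real \<Phi>'"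
  proof -
    have "(\<Phi> has_real_derivative \<Phi>') (at a)"
    proof -
      have "(pi / a) powr ((real DIM('a) - 2) / 2) = (pi / a) powr (real DIM('a) / 2) * (a / pi)"
        using a by (simp add: diff_divide_distrib powr_diff)
      then show ?thesis
      unfolding \<Phi>_def \<Phi>'_def using a
      by (auto intro!: derivative_eq_intros simp: powr_diff field_simps power2_eq_square)
    qed
    then have "((\<lambda>k. (\<Phi> (a + k) - \<Phi> a) / k) \<longlongrightarrow> \<Phi>') (at 0)" by (simp add: DERIV_def)
    then have "(\<lambda>n. (\<Phi> (a + h n) - \<Phi> a) / h n) \<longlonglongrightarrow> \<Phi>'"
      by (rule filterlim_compose) (use h in \<open>auto simp: filterlim_at intro!: always_eventually less_imp_neq[THEN not_sym]\<close>)
    then show ?thesis by (rule tendsto_of_real)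
  qed
  ultimately have "(\<integral>z. e z * complex_of_real (- ?w z) \<partial>lborel) = complex_of_real \<Phi>'"
    unfolding dint by (rule LIMSEQ_unique)
  then have "(\<integral>z. e z * complex_of_real (?w z) \<partial>lborel) = complex_of_real (- \<Phi>')"
    by (simp add: minus_equation_iff[of _ "complex_of_real \<Phi>'"])
  moreover have "integrable lborel (\<lambda>z. e z * complex_of_real (?w z))"
    by (rule Bochner_Integration.integrable_bound[OF integrable_norm2_gaussian[OF a]]) (auto simp: norm_mult norm_power)
  ultimately have "has_bochner_integral lborel (\<lambda>z. e z * complex_of_real (?w z)) (complex_of_real (- \<Phi>'))"
    unfolding has_bochner_integral_iff by blast
  moreover have "- \<Phi>' = (real DIM('a) / (2 * a) - (norm y)\<^sup>2 / (4 * a\<^sup>2))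
      * (pi / a) powr (real DIM('a) / 2) * exp (- (norm y)\<^sup>2 / (4 * a))"
    unfolding \<Phi>'_def \<Phi>_def by (simp only: mult_minus_left minus_minus mult.assoc)
  ultimately show ?thesis unfolding e_def by metis
qed

section \<open>The Fourier transform under translation, reflection and convolution\<close>

lemma lborel_integral_translate:
  fixes f :: "'a::euclidean_space \<Rightarrow> 'b::{banach, second_countable_topology}"
  assumes "f \<in> borel_measurable borel"
  shows "integrable lborel (\<lambda>x. f (c + x)) \<longleftrightarrow> integrable lborel f"
    and "(\<integral>x. f (c + x) \<partial>lborel) = integral\<^sup>L lborel f"
  using assms integrable_distr_eq[of "(+) c" lborel borel f] integral_distr[of "(+) c" lborel borel f]
  by (auto simp: lborel_distr_plus)

lemma lborel_distr_uminus_euclidean: "distr lborel borel uminus = (lborel :: 'a::euclidean_space measure)"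
  by (subst lborel_affine[of "-1" 0]) (auto simp: density_1 one_ennreal_def[symmetric])

lemma lborel_integral_uminus:
  fixes f :: "'a::euclidean_space \<Rightarrow> 'b::{banach, second_countable_topology}"
  assumes "f \<in> borel_measurable borel"
  shows "integrable lborel (\<lambda>x. f (- x)) \<longleftrightarrow> integrable lborel f"
    and "(\<integral>x. f (- x) \<partial>lborel) = integral\<^sup>L lborel f"
  using assms integrable_distr_eq[of uminus lborel borel f] integral_distr[of uminus lborel borel f]
  by (auto simp: lborel_distr_uminus_euclidean)

lemma fourier_reflect_cnj:
  assumes [measurable]: "f \<in> borel_measurable borel"
  shows "fourier (reflect_cnj f) y = cnj (fourier f y)"
proof -
  have "fourier (reflect_cnj f) y = (\<integral>z. cnj (exp (\<i> * complex_of_real (- z \<bullet> y)) * f (- z)) \<partial>lborel)"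
    unfolding fourier_def reflect_cnj_def by (simp add: exp_cnj)
  also have "\<dots> = cnj (\<integral>z. exp (\<i> * complex_of_real (- z \<bullet> y)) * f (- z) \<partial>lborel)"
    by (rule Bochner_Integration.integral_cnj)
  also have "(\<integral>z. exp (\<i> * complex_of_real (- z \<bullet> y)) * f (- z) \<partial>lborel) = fourier f y"
    unfolding fourier_def
    by (rule lborel_integral_uminus(2)[of "\<lambda>z. exp (\<i> * complex_of_real (z \<bullet> y)) * f z"]) measurable
  finally show ?thesis .
qed

lemma fourier_translate:
  assumes [measurable]: "f \<in> borel_measurable borel"
  shows "fourier (\<lambda>z. f (z - c)) y = exp (\<i> * complex_of_real (c \<bullet> y)) * fourier f y"
proof -
  have "fourier (\<lambda>z. f (z - c)) y = (\<integral>z. exp (\<i> * complex_of_real ((c + z) \<bullet> y)) * f (c + z - c) \<partial>lborel)"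
    unfolding fourier_def
    by (rule lborel_integral_translate(2)[symmetric, of "\<lambda>z. exp (\<i> * complex_of_real (z \<bullet> y)) * f (z - c)"]) measurable
  also have "\<dots> = (\<integral>z. exp (\<i> * complex_of_real (c \<bullet> y)) * (exp (\<i> * complex_of_real (z \<bullet> y)) * f z) \<partial>lborel)"
    by (simp add: inner_add_left exp_add distrib_left mult.assoc)
  finally show ?thesis by (simp add: fourier_def)
qed

text \<open>Fubini; the L1 norm of \<open>f (x - z)\<close> in x does not depend on z, which makes
  the double integral absolutely convergent.\<close>

lemma fourier_convolution:
  fixes f g :: "'a::euclidean_space \<Rightarrow> complex"
  assumes f: "integrable lborel f" and g: "integrable lborel g"
  shows "fourier (convolution f g) y = fourier f y * fourier g y"
proof -
  have [measurable]: "f \<in> borel_measurable borel" "g \<in> borel_measurable borel" using f g by auto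
  let ?e = "\<lambda>x. exp (\<i> * complex_of_real (x \<bullet> y))"
  let ?F = "\<lambda>(z, x). ?e x * (f (x - z) * g z)"
  have nf: "integrable lborel (\<lambda>x. norm (f (x - z)))" "(\<integral>x. norm (f (x - z)) \<partial>lborel) = (\<integral>x. norm (f x) \<partial>lborel)" for z
    using lborel_integral_translate[of "\<lambda>x. norm (f x)" "- z"] f by auto
  have F: "integrable (lborel \<Otimes>\<^sub>M lborel) ?F"
  proof (rule lborel_pair.Fubini_integrable)
    show "integrable lborel (\<lambda>z. \<integral>x. norm (?F (z, x)) \<partial>lborel)"
      using g by (simp add: norm_mult nf norm_exp_i_times)
    show "AE z in lborel. integrable lborel (\<lambda>x. ?F (z, x))"
    proof (intro always_eventually allI)
      fix z
      have "integrable lborel (\<lambda>x. norm (f (x - z)) * norm (g z))"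
        by (intro integrable_mult_left nf)
      then show "integrable lborel (\<lambda>x. ?F (z, x))"
        by (rule Bochner_Integration.integrable_bound) (auto simp: norm_mult norm_exp_i_times)
    qed
  qed measurable
  have "fourier (convolution f g) y = (\<integral>x. (\<integral>z. ?F (z, x) \<partial>lborel) \<partial>lborel)"
    unfolding fourier_def convolution_def by simp
  also have "\<dots> = (\<integral>z. (\<integral>x. ?F (z, x) \<partial>lborel) \<partial>lborel)"
    using F by (subst lborel_pair.Fubini_integral) auto
  also have "\<dots> = (\<integral>z. fourier f y * (?e z * g z) \<partial>lborel)"
  proof (rule Bochner_Integration.integral_cong[OF refl])
    fix z
    have "(\<integral>x. ?F (z, x) \<partial>lborel) = (\<integral>x. ?e x * f (x - z) * g z \<partial>lborel)" by (simp add: mult.assoc)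
    also have "\<dots> = (\<integral>x. ?e x * f (x - z) \<partial>lborel) * g z" by (rule integral_mult_left_zero)
    also have "(\<integral>x. ?e x * f (x - z) \<partial>lborel) = ?e z * fourier f y"
      using fourier_translate[of f z y] by (simp add: fourier_def)
    finally show "(\<integral>x. ?F (z, x) \<partial>lborel) = fourier f y * (?e z * g z)" by (simp add: mult_ac)
  qed
  also have "\<dots> = fourier f y * fourier g y" unfolding fourier_def by (rule integral_mult_right_zero)
  finally show ?thesis .
qed

subsection \<open>The heat kernel of the whole space\<close>

lemma partial_deriv_eqI:
  assumes "(f has_derivative f') (at x)"
  shows "partial_deriv b f x = f' b"
proof -
  have "((\<lambda>h. x + h *\<^sub>R b) has_derivative (\<lambda>h. h *\<^sub>R b)) (at (0::real))"
    by (auto intro!: derivative_eq_intros)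
  from has_derivative_compose[OF this, of f f'] assms
  have "((\<lambda>h. f (x + h *\<^sub>R b)) has_derivative (\<lambda>h. f' (h *\<^sub>R b))) (at 0)" by simp
  also have "(\<lambda>h. f' (h *\<^sub>R b)) = (\<lambda>h. f' b * h)"
    using has_derivative_linear[OF assms] by (simp add: linear_scale mult.commute)
  finally show ?thesis
    by (intro partial_derivI) (simp add: has_field_derivative_def)
qed

text \<open>The density of the centred normal law with variance 2 t in each coordinate. At t = 0 the
  value is 0 and not a point mass, so initial values are always supplied separately.\<close>

definition heat_kernel :: "real \<Rightarrow> 'a::euclidean_space \<Rightarrow> real" where
  "heat_kernel t z = (4 * pi * t) powr (- (real DIM('a) / 2)) * exp (- (norm z)\<^sup>2 / (4 * t))"

lemma heat_kernel_nonneg: "heat_kernel t z \<ge> 0"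
  by (simp add: heat_kernel_def)

lemma continuous_on_heat_kernel [continuous_intros]:
  assumes "continuous_on S f"
  shows "continuous_on S (\<lambda>x. heat_kernel t (f x))"
  unfolding heat_kernel_def divide_inverse by (intro continuous_intros assms)

lemma heat_kernel_measurable [measurable]: "heat_kernel t \<in> borel_measurable borel"
  by (intro borel_measurable_continuous_onI continuous_intros)

lemma
  assumes "t > 0"
  shows integrable_heat_kernel: "integrable lborel (heat_kernel t :: 'a::euclidean_space \<Rightarrow> real)"
    and integral_heat_kernel: "integral\<^sup>L lborel (heat_kernel t :: 'a \<Rightarrow> real) = 1"
proof -
  have eq: "heat_kernel t = (\<lambda>z::'a. (4 * pi * t) powr (- (real DIM('a) / 2)) * exp (- (1 / (4 * t)) * (norm z)\<^sup>2))"
    by (simp add: heat_kernel_def fun_eq_iff)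
  have t: "1 / (4 * t) > 0" using assms by simp
  show "integrable lborel (heat_kernel t :: 'a \<Rightarrow> real)"
    unfolding eq by (intro integrable_mult_right integrable_gaussian[OF t])
  show "integral\<^sup>L lborel (heat_kernel t :: 'a \<Rightarrow> real) = 1"
    unfolding eq integral_mult_right_zero integral_gaussian[OF t]
    using assms by (simp add: powr_minus mult_ac)
qed

text \<open>Parabolic scaling moves the dependence on t from the kernel into the argument of the
  initial datum, where continuity down to t = 0 is visible.\<close>

lemma heat_kernel_scale:
  assumes "t > 0"
  shows "sqrt t ^ DIM('a) * heat_kernel t (sqrt t *\<^sub>R (z::'a::euclidean_space)) = heat_kernel 1 z"
proof -
  have "sqrt t ^ DIM('a) = t powr (real DIM('a) / 2)"
    using assms by (simp add: powr_half_sqrt[symmetric] powr_powr powr_realpow[symmetric])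
  then show ?thesis
    using assms by (simp add: heat_kernel_def powr_mult powr_minus power_mult_distrib field_simps)
qed

text \<open>Derivatives are written as inner products with an explicit vector field because
  \<open>kernel_integral_has_derivative\<close> asks for that form; it is applied to the kernel and
  again to its partial derivatives.\<close>

lemma heat_kernel_has_derivative:
  assumes "t > 0"
  shows "(heat_kernel t has_derivative (\<lambda>h. h \<bullet> (- (heat_kernel t z / (2 * t)) *\<^sub>R z))) (at z)"
  unfolding heat_kernel_def power2_norm_eq_inner using assms
  by (auto intro!: derivative_eq_intros simp: fun_eq_iff inner_commute field_simps)

lemma heat_kernel_partial_has_derivative:
  assumes "t > 0"
  shows "((\<lambda>z. b \<bullet> (- (heat_kernel t z / (2 * t)) *\<^sub>R z)) has_derivative
    (\<lambda>h. h \<bullet> (- (heat_kernel t z / (2 * t)) *\<^sub>R b + ((z \<bullet> b) * heat_kernel t z / (4 * t\<^sup>2)) *\<^sub>R z))) (at z)"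
proof -
  have "((\<lambda>z. - (1 / (2 * t)) * ((b \<bullet> z) * heat_kernel t z)) has_derivative
      (\<lambda>h. - (1 / (2 * t)) * ((b \<bullet> z) * (h \<bullet> (- (heat_kernel t z / (2 * t)) *\<^sub>R z)) + (b \<bullet> h) * heat_kernel t z))) (at z)"
    by (intro has_derivative_mult_right has_derivative_mult heat_kernel_has_derivative assms
        has_derivative_inner_right has_derivative_ident)
  also have "(\<lambda>h. - (1 / (2 * t)) * ((b \<bullet> z) * (h \<bullet> (- (heat_kernel t z / (2 * t)) *\<^sub>R z)) + (b \<bullet> h) * heat_kernel t z))
      = (\<lambda>h. h \<bullet> (- (heat_kernel t z / (2 * t)) *\<^sub>R b + ((z \<bullet> b) * heat_kernel t z / (4 * t\<^sup>2)) *\<^sub>R z))"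
    using assms
    by (simp add: fun_eq_iff inner_add_right inner_diff_right inner_commute[of b] power2_eq_square field_simps)
  finally show ?thesis by (simp add: mult_ac)
qed

lemma heat_kernel_has_time_derivative:
  assumes "t > 0"
  shows "((\<lambda>t. heat_kernel t (z::'a::euclidean_space)) has_real_derivative
    ((norm z)\<^sup>2 / (4 * t\<^sup>2) - real DIM('a) / (2 * t)) * heat_kernel t z) (at t)"
proof -
  let ?n = "real DIM('a) / 2"
  have "(4 * pi * t) powr (- ?n - 1) = (4 * pi * t) powr (- ?n) / (4 * pi * t)"
    using assms by (simp add: powr_diff)
  moreover have "((\<lambda>t. (4 * pi * t) powr (- ?n)) has_real_derivative - ?n * (4 * pi * t) powr (- ?n - 1) * (4 * pi)) (at t)"
    using assms by (auto intro!: derivative_eq_intros)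
  ultimately have "((\<lambda>t. (4 * pi * t) powr (- ?n)) has_real_derivative - ?n * ((4 * pi * t) powr (- ?n) / (4 * pi * t)) * (4 * pi)) (at t)"
    by (simp only:)
  then have 1: "((\<lambda>t. (4 * pi * t) powr (- ?n)) has_real_derivative (- real DIM('a) / (2 * t)) * (4 * pi * t) powr (- ?n)) (at t)"
    by (rule DERIV_cong) (use assms in \<open>simp add: field_simps\<close>)
  have 2: "((\<lambda>t. exp (- (norm z)\<^sup>2 / (4 * t))) has_real_derivative (norm z)\<^sup>2 / (4 * t\<^sup>2) * exp (- (norm z)\<^sup>2 / (4 * t))) (at t)"
    using assms by (auto intro!: derivative_eq_intros simp: field_simps power2_eq_square)
  show ?thesis
    unfolding heat_kernel_def by (rule DERIV_cong[OF DERIV_mult[OF 1 2]]) (simp add: algebra_simps)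
qed

section \<open>Convolution with the heat kernel\<close>

lemma
  fixes u :: "'a::euclidean_space \<Rightarrow> 'b::euclidean_space"
  assumes "continuous_on UNIV u" and "\<And>y. y \<notin> cbox a b \<Longrightarrow> u y = 0"
  shows integrable_compact_support: "integrable lborel u"
    and integral_compact_support: "integral\<^sup>L lborel u = integral (cbox a b) u"
proof -
  have "set_integrable lborel (cbox a b) u"
    unfolding set_integrable_def
    by (rule borel_integrable_compact) (use assms(1) continuous_on_subset in \<open>auto\<close>)
  moreover have "(\<lambda>y. indicator (cbox a b) y *\<^sub>R u y) = u"
    using assms(2) by (auto simp: fun_eq_iff indicator_def)
  ultimately show "integrable lborel u" "integral\<^sup>L lborel u = integral (cbox a b) u"
    using set_borel_integral_eq_integral(2)[of "cbox a b" u]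
    by (simp_all add: set_integrable_def set_lebesgue_integral_def)
qed

lemma continuous_on_diff_compose:
  fixes k :: "'a::euclidean_space \<Rightarrow> 'b::topological_space"
  assumes "continuous_on UNIV k"
  shows "continuous_on S (\<lambda>y. k (x - y))" and "continuous_on T (\<lambda>p. k (fst p - snd p))"
  by (auto intro!: continuous_on_compose2[OF assms] continuous_intros)

text \<open>Since f lives in a box, the Leibniz rule on that box suffices. It wants the derivative
  as a continuous map into bounded linear functionals, hence
  \<open>blinfun_inner_left\<close>.\<close>

lemma kernel_integral_has_derivative:
  fixes k :: "'a::euclidean_space \<Rightarrow> real"
  assumes k: "\<And>z. (k has_derivative (\<lambda>h. h \<bullet> g z)) (at z)" and g: "continuous_on UNIV g"
    and f: "continuous_on UNIV f" "\<And>y. y \<notin> cbox a b \<Longrightarrow> f y = 0"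
  shows "((\<lambda>x. \<integral>y. k (x - y) * f y \<partial>lborel) has_derivative
    (\<lambda>h. \<integral>y. (h \<bullet> g (x - y)) * f y \<partial>lborel)) (at x)"
proof -
  have fc: "continuous_on S f" for S using f(1) continuous_on_subset by blast
  have kc: "continuous_on UNIV k"
    using k by (intro continuous_at_imp_continuous_on ballI) (blast intro: has_derivative_continuous)
  define D where "D = (\<lambda>x y. f y *\<^sub>R blinfun_inner_left (g (x - y)))"
  have "((\<lambda>x. integral (cbox a b) (\<lambda>y. k (x - y) * f y)) has_derivative blinfun_apply (integral (cbox a b) (D x))) (at x within UNIV)"
  proof (rule leibniz_rule)
    show "((\<lambda>x. k (x - y) * f y) has_derivative blinfun_apply (D x y)) (at x within UNIV)" for x y
    proof -
      have "((\<lambda>x. x - y) has_derivative (\<lambda>h. h)) (at x)" by (auto intro!: derivative_eq_intros)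
      from has_derivative_compose[OF this k]
      have "((\<lambda>x. k (x - y)) has_derivative (\<lambda>h. h \<bullet> g (x - y))) (at x)" .
      then show ?thesis
        by (auto intro!: derivative_eq_intros simp: D_def fun_eq_iff blinfun.scaleR_left)
    qed
    show "(\<lambda>y. k (x - y) * f y) integrable_on cbox a b" for x
      by (intro integrable_continuous continuous_intros fc continuous_on_diff_compose kc)
    show "continuous_on (UNIV \<times> cbox a b) (\<lambda>(x, y). D x y)"
      unfolding D_def case_prod_unfold
      by (intro continuous_intros continuous_on_diff_compose g continuous_on_compose2[OF f(1)]) auto
  qed auto
  moreover have "integral (cbox a b) (\<lambda>y. k (x - y) * f y) = (\<integral>y. k (x - y) * f y \<partial>lborel)" for x
    by (intro integral_compact_support[symmetric] continuous_intros fc continuous_on_diff_compose kc) (use f(2) in auto)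
  moreover have "blinfun_apply (integral (cbox a b) (D x)) = (\<lambda>h. \<integral>y. (h \<bullet> g (x - y)) * f y \<partial>lborel)"
  proof
    fix h
    have "D x integrable_on cbox a b"
      unfolding D_def by (intro integrable_continuous continuous_intros fc continuous_on_diff_compose g)
    then have "blinfun_apply (integral (cbox a b) (D x)) h = integral (cbox a b) (\<lambda>y. (h \<bullet> g (x - y)) * f y)"
      by (simp add: blinfun_apply_integral D_def blinfun.scaleR_left mult.commute)
    also have "\<dots> = (\<integral>y. (h \<bullet> g (x - y)) * f y \<partial>lborel)"
      by (intro integral_compact_support[symmetric] continuous_intros fc continuous_on_diff_compose g) (use f(2) in auto)
    finally show "blinfun_apply (integral (cbox a b) (D x)) h = (\<integral>y. (h \<bullet> g (x - y)) * f y \<partial>lborel)" .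
  qed
  ultimately show ?thesis by simp
qed

text \<open>Substitution y = x - sqrt t z. The right-hand side, unlike the left, still carries the
  initial datum at t = 0.\<close>

lemma heat_convolution_rescale:
  fixes f :: "'a::euclidean_space \<Rightarrow> real"
  assumes "t > 0" and [measurable]: "f \<in> borel_measurable borel"
  shows "(\<integral>y. heat_kernel t (x - y) * f y \<partial>lborel) = (\<integral>z. heat_kernel 1 z * f (x - sqrt t *\<^sub>R z) \<partial>lborel)"
proof -
  let ?F = "\<lambda>y. heat_kernel t (x - y) * f y"
  have s: "- sqrt t \<noteq> 0" using assms by simp
  have "integral\<^sup>L lborel ?F = (\<integral>z. (\<bar>- sqrt t\<bar> ^ DIM('a)) *\<^sub>R ?F (x + (- sqrt t) *\<^sub>R z) \<partial>lborel)"
    by (subst lborel_affine[OF s, of x], subst integral_density) (auto simp: integral_distr)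
  also have "\<dots> = (\<integral>z. heat_kernel 1 z * f (x - sqrt t *\<^sub>R z) \<partial>lborel)"
    using assms(1) by (intro Bochner_Integration.integral_cong refl) (simp flip: heat_kernel_scale[OF assms(1)])
  finally show ?thesis .
qed

text \<open>Dominated convergence, with B times the kernel as majorant.\<close>

lemma continuous_on_heat_convolution:
  fixes f :: "'a::euclidean_space \<Rightarrow> real"
  assumes f: "continuous_on UNIV f" and B: "\<And>y. \<bar>f y\<bar> \<le> B"
  shows "continuous_on UNIV (\<lambda>(t, x). \<integral>z. heat_kernel 1 z * f (x - sqrt t *\<^sub>R z) \<partial>lborel)"
proof (rule continuous_on_sequentiallyI)
  fix u :: "nat \<Rightarrow> real \<times> 'a" and p assume u: "u \<longlonglongrightarrow> p"
  have [measurable]: "f \<in> borel_measurable borel" using f by (rule borel_measurable_continuous_onI)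
  have "(\<lambda>n. \<integral>z. heat_kernel 1 z * f (snd (u n) - sqrt (fst (u n)) *\<^sub>R z) \<partial>lborel)
      \<longlonglongrightarrow> (\<integral>z. heat_kernel 1 z * f (snd p - sqrt (fst p) *\<^sub>R z) \<partial>lborel)"
  proof (rule integral_dominated_convergence[where w="\<lambda>z. heat_kernel 1 z * B"])
    have "(\<lambda>n. f (snd (u n) - sqrt (fst (u n)) *\<^sub>R z)) \<longlonglongrightarrow> f (snd p - sqrt (fst p) *\<^sub>R z)" for z
      by (rule continuous_on_tendsto_compose[OF f]) (auto intro!: tendsto_intros u)
    then show "AE z in lborel. (\<lambda>n. heat_kernel 1 z * f (snd (u n) - sqrt (fst (u n)) *\<^sub>R z))
        \<longlonglongrightarrow> heat_kernel 1 z * f (snd p - sqrt (fst p) *\<^sub>R z)"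
      by (intro always_eventually allI tendsto_intros)
    show "AE z in lborel. norm (heat_kernel 1 z * f (snd (u n) - sqrt (fst (u n)) *\<^sub>R z)) \<le> heat_kernel 1 z * B" for n
      using B by (auto simp: abs_mult heat_kernel_nonneg intro!: mult_left_mono)
  qed (auto intro!: integrable_mult_left integrable_heat_kernel)
  then show "(\<lambda>n. case u n of (t, x) \<Rightarrow> \<integral>z. heat_kernel 1 z * f (x - sqrt t *\<^sub>R z) \<partial>lborel)
      \<longlonglongrightarrow> (case p of (t, x) \<Rightarrow> \<integral>z. heat_kernel 1 z * f (x - sqrt t *\<^sub>R z) \<partial>lborel)"
    by (simp add: case_prod_unfold)
qed

lemma heat_convolution_solution:
  fixes f :: "'a::euclidean_space \<Rightarrow> real"
  assumes f: "continuous_on UNIV f" and supp: "\<And>y. norm y > R \<Longrightarrow> f y = 0"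
  shows "dirichlet_heat_solution UNIV f
    (\<lambda>t x. if t = 0 then f x else (\<integral>y. heat_kernel t (x - y) * f y \<partial>lborel))"
    (is "dirichlet_heat_solution UNIV f ?V")
proof -
  obtain c :: 'a where "cball 0 R \<subseteq> cbox (- c) c" using bounded_subset_cbox_symmetric[OF bounded_cball] by blast
  then have box: "f y = 0" if "y \<notin> cbox (- c) c" for y using that supp[of y] by (force simp: subset_eq)
  have fc: "continuous_on S f" for S using f continuous_on_subset by blast
  have [measurable]: "f \<in> borel_measurable borel" using f by (rule borel_measurable_continuous_onI)
  have "bounded (f ` cbox (- c) c)"
    by (intro compact_imp_bounded compact_continuous_image fc compact_cbox)
  then obtain B where B: "\<And>y. y \<in> cbox (- c) c \<Longrightarrow> \<bar>f y\<bar> \<le> B" by (auto simp: bounded_iff)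
  have B: "\<bar>f y\<bar> \<le> \<bar>B\<bar>" for y using B[of y] box[of y] by (cases "y \<in> cbox (- c) c") auto
  \<comment> \<open>At t = 0 the rescaled integral is f x times the mass 1 of the kernel, so one
    formula covers the initial value.\<close>
  have V: "?V t x = (\<integral>z. heat_kernel 1 z * f (x - sqrt t *\<^sub>R z) \<partial>lborel)" if "t \<ge> 0" for t x
    using that integral_heat_kernel[where 'a='a, of 1] by (simp add: heat_convolution_rescale)
  have "continuous_on ({0..} \<times> UNIV) (\<lambda>(t, x). ?V t x)"
  proof -
    have "continuous_on ({0..} \<times> UNIV) (\<lambda>(t, x). \<integral>z. heat_kernel 1 z * f (x - sqrt t *\<^sub>R z) \<partial>lborel)"
      using continuous_on_heat_convolution[OF f B] by (rule continuous_on_subset) auto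
    then show ?thesis by (subst continuous_on_cong[OF refl]) (auto simp: V)
  qed
  moreover have "bounded ((\<lambda>(t, x). ?V t x) ` ({0..} \<times> UNIV))"
  proof -
    have "\<bar>?V t x\<bar> \<le> \<bar>B\<bar>" if "t \<ge> 0" for t x
    proof -
      have "norm (\<integral>z. heat_kernel 1 z * f (x - sqrt t *\<^sub>R z) \<partial>lborel) \<le> (\<integral>z. heat_kernel 1 (z::'a) * \<bar>B\<bar> \<partial>lborel)"
      proof (rule integral_norm_bound[THEN order_trans], rule integral_mono_AE')
        show "integrable lborel (\<lambda>z::'a. heat_kernel 1 z * \<bar>B\<bar>)"
          by (intro integrable_mult_left integrable_heat_kernel) simp
      qed (use B in \<open>auto simp: abs_mult heat_kernel_nonneg intro!: mult_left_mono mult_nonneg_nonneg\<close>)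
      then show ?thesis using V[OF that] by (simp add: integral_heat_kernel)
    qed
    then show ?thesis
      unfolding bounded_iff by (intro exI[of _ "\<bar>B\<bar>"]) (auto simp del: if_split)
  qed
  moreover have V1: "(?V t has_derivative (\<lambda>h. \<integral>y. (h \<bullet> (- (heat_kernel t (x - y) / (2 * t)) *\<^sub>R (x - y))) * f y \<partial>lborel)) (at x)"
    if "t > 0" for t x
  proof -
    have "((\<lambda>x. \<integral>y. heat_kernel t (x - y) * f y \<partial>lborel) has_derivative
        (\<lambda>h. \<integral>y. (h \<bullet> (- (heat_kernel t (x - y) / (2 * t)) *\<^sub>R (x - y))) * f y \<partial>lborel)) (at x)"
      by (rule kernel_integral_has_derivative[OF heat_kernel_has_derivative[OF that] _ f box])
        (intro continuous_intros, use that in simp)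
    then show ?thesis using that by simp
  qed
  moreover have pV: "partial_deriv b (?V t) = (\<lambda>x. \<integral>y. (b \<bullet> (- (heat_kernel t (x - y) / (2 * t)) *\<^sub>R (x - y))) * f y \<partial>lborel)"
    if "t > 0" for t b
    using V1[OF that] by (intro ext partial_deriv_eqI)
  moreover have V2: "((\<lambda>x. \<integral>y. (b \<bullet> (- (heat_kernel t (x - y) / (2 * t)) *\<^sub>R (x - y))) * f y \<partial>lborel) has_derivative
     (\<lambda>h. \<integral>y. (h \<bullet> (- (heat_kernel t (x - y) / (2 * t)) *\<^sub>R b
       + (((x - y) \<bullet> b) * heat_kernel t (x - y) / (4 * t\<^sup>2)) *\<^sub>R (x - y))) * f y \<partial>lborel)) (at x)"
    if "t > 0" for t b x
    by (rule kernel_integral_has_derivative[OF heat_kernel_partial_has_derivative[OF that] _ f box])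
      (intro continuous_intros, use that in simp_all)
  \<comment> \<open>The time derivative of the kernel. Both sides of the heat equation will be
    reduced to the integral of \<open>T t (x - y) * f y\<close>.\<close>
  define T where "T = (\<lambda>t (z::'a). ((norm z)\<^sup>2 / (4 * t\<^sup>2) - real DIM('a) / (2 * t)) * heat_kernel t z)"
  have lap: "laplacian (?V t) x = (\<integral>y. T t (x - y) * f y \<partial>lborel)" if t: "t > 0" for t x
  proof -
    let ?g = "\<lambda>b z. b \<bullet> (- (heat_kernel t z / (2 * t)) *\<^sub>R b + ((z \<bullet> b) * heat_kernel t z / (4 * t\<^sup>2)) *\<^sub>R (z::'a))"
    have "partial_deriv b (partial_deriv b (?V t)) x = (\<integral>y. ?g b (x - y) * f y \<partial>lborel)" for b
      unfolding pV[OF t] by (rule partial_deriv_eqI[OF V2[OF t]])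
    then have "laplacian (?V t) x = (\<Sum>b\<in>Basis. \<integral>y. ?g b (x - y) * f y \<partial>lborel)"
      by (simp add: laplacian_def)
    also have "\<dots> = (\<integral>y. (\<Sum>b\<in>Basis. ?g b (x - y) * f y) \<partial>lborel)"
      by (intro Bochner_Integration.integral_sum[symmetric] integrable_compact_support[of _ "- c" c])
        (intro continuous_intros fc, use t box in simp_all)
    also have "(\<lambda>y. \<Sum>b\<in>Basis. ?g b (x - y) * f y) = (\<lambda>y. T t (x - y) * f y)"
    proof -
      have "(\<Sum>b\<in>Basis. ?g b z) = T t z" for z
      proof -
        have "(\<Sum>b\<in>Basis. ?g b z) = (\<Sum>b\<in>Basis. - (heat_kernel t z / (2 * t)) + heat_kernel t z / (4 * t\<^sup>2) * (z \<bullet> b)\<^sup>2)"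
          by (intro sum.cong refl) (simp add: inner_add_right inner_diff_right inner_same_Basis inner_commute[of _ z] power2_eq_square)
        also have "\<dots> = - (real DIM('a) * (heat_kernel t z / (2 * t))) + heat_kernel t z / (4 * t\<^sup>2) * (norm z)\<^sup>2"
          unfolding sum.distrib sum_distrib_left[symmetric] power2_norm_eq_inner euclidean_inner[of z z]
          by (simp add: power2_eq_square)
        finally show ?thesis by (simp add: T_def algebra_simps)
      qed
      then show ?thesis by (simp add: sum_distrib_right[symmetric])
    qed
    finally show ?thesis .
  qed
  have "((\<lambda>s. ?V s x) has_real_derivative laplacian (?V t) x) (at t)" if t: "t > 0" for t x
  proof -
    have "((\<lambda>s. integral (cbox (- c) c) (\<lambda>y. heat_kernel s (x - y) * f y)) has_real_derivative
        integral (cbox (- c) c) (\<lambda>y. T t (x - y) * f y)) (at t within {0<..})"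
    proof (rule leibniz_rule_field_derivative)
      show "((\<lambda>s. heat_kernel s (x - y) * f y) has_real_derivative T s (x - y) * f y) (at s within {0<..})"
        if "s \<in> {0<..}" for s y
        using that unfolding T_def
        by (intro DERIV_cmult_right has_field_derivative_at_within[OF heat_kernel_has_time_derivative]) auto
      show "(\<lambda>y. heat_kernel s (x - y) * f y) integrable_on cbox (- c) c" for s
        by (intro integrable_continuous continuous_intros fc)
      show "continuous_on ({0<..} \<times> cbox (- c) c) (\<lambda>(s, y). T s (x - y) * f y)"
      proof -
        have "continuous_on ({0<..} \<times> cbox (- c) c) (\<lambda>p. f (snd p))"
          by (rule continuous_on_compose2[OF f]) (intro continuous_intros, simp)
        then show ?thesis
          unfolding T_def heat_kernel_def case_prod_unfold
          by (intro continuous_intros) (simp_all add: mem_Times_iff less_imp_neq[THEN not_sym])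
      qed
    qed (use t in auto)
    then have "((\<lambda>s. integral (cbox (- c) c) (\<lambda>y. heat_kernel s (x - y) * f y)) has_real_derivative
        integral (cbox (- c) c) (\<lambda>y. T t (x - y) * f y)) (at t)"
      using t at_within_open[of t "{0<..}"] by simp
    moreover have "integral (cbox (- c) c) (\<lambda>y. T t (x - y) * f y) = laplacian (?V t) x"
      unfolding lap[OF t]
      by (rule integral_compact_support[symmetric])
        (unfold T_def, intro continuous_intros fc, use t box in simp_all)
    moreover have "integral (cbox (- c) c) (\<lambda>y. heat_kernel s (x - y) * f y) = ?V s x" if "s > 0" for s
      using that by (subst integral_compact_support[symmetric]) (auto intro!: continuous_intros fc simp: box)
    ultimately have "((\<lambda>s. integral (cbox (- c) c) (\<lambda>y. heat_kernel s (x - y) * f y)) has_real_derivative laplacian (?V t) x) (at t)"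
      and eq: "\<And>s. s \<in> {0<..} \<Longrightarrow> integral (cbox (- c) c) (\<lambda>y. heat_kernel s (x - y) * f y) = ?V s x"
      by auto
    from this(1) show ?thesis
      by (rule has_field_derivative_transform_within_open[OF _ open_greaterThan _ eq]) (use t in auto)
  qed
  moreover have "?V t differentiable_on UNIV" if "t > 0" for t
    using V1[OF that] by (auto simp: differentiable_on_def differentiable_def)
  moreover have "partial_deriv b (?V t) differentiable_on UNIV" if "t > 0" for t b
    unfolding pV[OF that] using V2[OF that] by (auto simp: differentiable_on_def differentiable_def)
  ultimately show ?thesis
    unfolding dirichlet_heat_solution_def by simp
qed

subsection \<open>The heat kernel of the half-space\<close>

lemma open_half_space: "open (half_space :: (real \<times> (real ^ 'm)) set)"
  unfolding half_space_def by (intro open_Times) auto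

lemma closure_half_space: "closure (half_space :: (real \<times> (real ^ 'm)) set) = {0..} \<times> UNIV"
  unfolding half_space_def by (simp add: closure_Times)

lemma frontier_half_space: "frontier (half_space :: (real \<times> (real ^ 'm)) set) = {0} \<times> UNIV"
  unfolding frontier_def closure_half_space interior_open[OF open_half_space]
  by (auto simp: half_space_def)

section \<open>Reflection in the boundary and the method of images\<close>

definition reflection :: "real \<times> 'b::euclidean_space \<Rightarrow> real \<times> 'b" where
  "reflection z = (- fst z, snd z)"

lemma norm_reflection [simp]: "norm (reflection z) = norm z"
  by (simp add: reflection_def norm_prod_def)

lemma reflection_involution [simp]: "reflection (reflection z) = z"
  by (simp add: reflection_def)

lemma continuous_on_reflection [continuous_intros]:
  "continuous_on S f \<Longrightarrow> continuous_on S (\<lambda>x. reflection (f x))"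
  unfolding reflection_def by (intro continuous_intros)

lemma lborel_distr_reflection: "distr lborel borel reflection = (lborel :: (real \<times> 'b::euclidean_space) measure)"
proof -
  \<comment> \<open>Diagonal entries of the reflection: -1 on the normal direction, whose basis
    vector has first component 1, and 1 on all others.\<close>
  define c where "c = (\<lambda>j::real \<times> 'b. 1 - 2 * fst j)"
  have c: "\<bar>c j\<bar> = 1" if "j \<in> Basis" for j
    using that by (auto simp: c_def Basis_prod_def)
  have "0 + (\<Sum>j\<in>Basis. (c j * (x \<bullet> j)) *\<^sub>R j) = reflection x" for x
  proof (rule euclidean_eqI)
    fix b :: "real \<times> 'b" assume "b \<in> Basis"
    then have "(0 + (\<Sum>j\<in>Basis. (c j * (x \<bullet> j)) *\<^sub>R j)) \<bullet> b = c b * (x \<bullet> b)"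
      by (simp only: add_0_left inner_sum_left_Basis)
    also have "\<dots> = reflection x \<bullet> b"
      using \<open>b \<in> Basis\<close> by (auto simp: c_def Basis_prod_def reflection_def inner_prod_def)
    finally show "(0 + (\<Sum>j\<in>Basis. (c j * (x \<bullet> j)) *\<^sub>R j)) \<bullet> b = reflection x \<bullet> b" .
  qed
  then have T: "(\<lambda>x. 0 + (\<Sum>j\<in>Basis. (c j * (x \<bullet> j)) *\<^sub>R j)) = reflection" by (rule ext)
  have "c j \<noteq> 0" if "j \<in> Basis" for j using c[OF that] by auto
  then have "(lborel :: (real \<times> 'b) measure) = density (distr lborel borel reflection) (\<lambda>_. \<Prod>j\<in>Basis. \<bar>c j\<bar>)"
    using lborel_affine_euclidean[of c 0] unfolding T by simp
  also have "(\<lambda>_. ennreal (\<Prod>j\<in>Basis. \<bar>c j\<bar>)) = (\<lambda>_. 1)" using c by simp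
  finally show ?thesis by (simp add: density_1)
qed

lemma lborel_integral_reflection:
  fixes u :: "real \<times> 'b::euclidean_space \<Rightarrow> real"
  assumes "u \<in> borel_measurable borel"
  shows "(\<integral>y. u (reflection y) \<partial>lborel) = integral\<^sup>L lborel u"
proof -
  have "(reflection :: real \<times> 'b \<Rightarrow> _) \<in> borel_measurable borel"
    by (intro borel_measurable_continuous_onI continuous_intros)
  then show ?thesis
    using assms integral_distr[of reflection lborel borel u] by (simp add: lborel_distr_reflection)
qed

definition half_space_kernel :: "real \<Rightarrow> real \<times> (real ^ 'm) \<Rightarrow> real \<times> (real ^ 'm) \<Rightarrow> real" where
  "half_space_kernel t x y = heat_kernel t (x - y) - heat_kernel t (x - reflection y)"

lemma half_space_kernel_boundary: "fst x = 0 \<Longrightarrow> half_space_kernel t x y = 0"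
proof -
  assume "fst x = 0"
  then have "x - reflection y = reflection (x - y)" by (simp add: reflection_def prod_eq_iff)
  then show ?thesis by (simp add: half_space_kernel_def heat_kernel_def)
qed

lemma continuous_on_half_space_kernel:
  "continuous_on S (half_space_kernel t x)"
  unfolding half_space_kernel_def by (intro continuous_intros)

text \<open>The image kernel acting on f is the whole-space kernel acting on the odd extension
  \<open>F\<close>, so this solution is the restriction of one on the whole space. The initial value
  keeps the reflected term so that the formula also holds off the half-space; on the closed
  half-space that term vanishes.\<close>

lemma half_space_solution:
  fixes f :: "real \<times> (real ^ 'm) \<Rightarrow> real"
  assumes f: "continuous_on UNIV f" and cpt: "compact (closure {x. f x \<noteq> 0})"
    and supp: "closure {x. f x \<noteq> 0} \<subseteq> half_space"
  shows "dirichlet_heat_solution half_space f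
    (\<lambda>t x. if t = 0 then f x - f (reflection x) else (LINT y:half_space|lborel. half_space_kernel t x y * f y))"
    (is "dirichlet_heat_solution _ f ?w")
proof -
  obtain R where R: "norm x \<le> R" if "x \<in> closure {x. f x \<noteq> 0}" for x
    using compact_imp_bounded[OF cpt] by (auto simp: bounded_iff)
  have fR: "f x = 0" if "norm x > R" for x
    using R[of x] that closure_subset[of "{x. f x \<noteq> 0}"] by (cases "f x = 0") auto
  have f0: "f x = 0" if "x \<notin> half_space" for x
    using supp that closure_subset[of "{x. f x \<noteq> 0}"] by (cases "f x = 0") auto
  obtain c :: "real \<times> (real ^ 'm)" where "cball 0 R \<subseteq> cbox (- c) c" using bounded_subset_cbox_symmetric[OF bounded_cball] by blast
  then have box: "f y = 0" if "y \<notin> cbox (- c) c" for y using that fR[of y] by (force simp: subset_eq)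
  have box': "f (reflection y) = 0" if "y \<notin> cbox (- c) c" for y
    using that fR[of "reflection y"] \<open>cball 0 R \<subseteq> cbox (- c) c\<close> by (force simp: subset_eq)
  have [measurable]: "f \<in> borel_measurable borel" using f by (rule borel_measurable_continuous_onI)
  have fc: "continuous_on S f" for S using f continuous_on_subset by blast
  have frc: "continuous_on S (\<lambda>y. f (reflection y))" for S
    by (rule continuous_on_compose2[OF f]) (auto intro!: continuous_intros)
  define F where "F = (\<lambda>y. f y - f (reflection y))"
  have w: "?w t x = (if t = 0 then F x else (\<integral>y. heat_kernel t (x - y) * F y \<partial>lborel))" for t x
  proof -
    have 1: "integrable lborel (\<lambda>y. heat_kernel t (x - y) * f y)"
      by (rule integrable_compact_support[of _ "- c" c]) (auto intro!: continuous_intros fc simp: box)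
    have 2: "integrable lborel (\<lambda>y. heat_kernel t (x - reflection y) * f y)"
      by (rule integrable_compact_support[of _ "- c" c]) (auto intro!: continuous_intros fc simp: box)
    have 3: "integrable lborel (\<lambda>y. heat_kernel t (x - y) * f (reflection y))"
      by (rule integrable_compact_support[of _ "- c" c]) (auto intro!: continuous_intros frc simp: box')
    have [measurable]: "(reflection :: real \<times> (real^'m) \<Rightarrow> _) \<in> borel_measurable borel"
      by (intro borel_measurable_continuous_onI continuous_intros)
    have "(LINT y:half_space|lborel. half_space_kernel t x y * f y)
        = (\<integral>y. heat_kernel t (x - y) * f y - heat_kernel t (x - reflection y) * f y \<partial>lborel)"
      unfolding set_lebesgue_integral_def half_space_kernel_def
      by (intro Bochner_Integration.integral_cong refl) (auto simp: indicator_def f0 algebra_simps)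
    also have "\<dots> = (\<integral>y. heat_kernel t (x - y) * f y \<partial>lborel) - (\<integral>y. heat_kernel t (x - reflection y) * f y \<partial>lborel)"
      by (rule Bochner_Integration.integral_diff[OF 1 2])
    also have "(\<integral>y. heat_kernel t (x - reflection y) * f y \<partial>lborel) = (\<integral>y. heat_kernel t (x - y) * f (reflection y) \<partial>lborel)"
      using lborel_integral_reflection[of "\<lambda>y. heat_kernel t (x - y) * f (reflection y)"] by simp
    also have "(\<integral>y. heat_kernel t (x - y) * f y \<partial>lborel) - \<dots> = (\<integral>y. heat_kernel t (x - y) * F y \<partial>lborel)"
      unfolding F_def right_diff_distrib by (rule Bochner_Integration.integral_diff[OF 1 3, symmetric])
    finally show ?thesis by (simp add: F_def)
  qed
  have sol: "dirichlet_heat_solution UNIV F ?w"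
    unfolding w by (rule heat_convolution_solution[where R=R]) (auto simp: F_def fR intro!: continuous_intros fc frc)
  note S = sol[unfolded dirichlet_heat_solution_def]
  show ?thesis
    unfolding dirichlet_heat_solution_def
  proof (intro conjI allI ballI impI)
    show "continuous_on ({0..} \<times> closure half_space) (\<lambda>(t, x). ?w t x)"
      by (rule continuous_on_subset[OF conjunct1[OF S]]) auto
    show "bounded ((\<lambda>(t, x). ?w t x) ` ({0..} \<times> closure half_space))"
      by (rule bounded_subset[OF conjunct1[OF conjunct2[OF S]]]) auto
    show "?w t differentiable_on half_space" if "t > 0" for t
      using S that by (meson differentiable_on_subset subset_UNIV)
    show "partial_deriv b (?w t) differentiable_on half_space" if "t > 0" "b \<in> Basis" for t b
      using S that by (meson differentiable_on_subset subset_UNIV)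
    show "((\<lambda>s. ?w s x) has_real_derivative laplacian (?w t) x) (at t)" if "t > 0" for t x
      using S that by blast
    show "?w t x = 0" if "t > 0" "x \<in> frontier half_space" for t x
      using that by (auto simp: frontier_half_space half_space_kernel_boundary)
    show "?w 0 x = f x" if "x \<in> closure half_space" for x
    proof -
      have "reflection x \<notin> half_space" using that[unfolded closure_half_space] by (auto simp: half_space_def reflection_def)
      then show ?thesis by (simp add: f0)
    qed
  qed
qed

text \<open>The fundamental lemma of the calculus of variations, with tents as test
  functions.\<close>

lemma continuous_zero_if_test_integrals_zero:
  fixes k :: "'a::euclidean_space \<Rightarrow> real"
  assumes "open D" and k: "continuous_on D k"
    and test: "\<And>f. continuous_on UNIV f \<Longrightarrow> compact (closure {x. f x \<noteq> 0}) \<Longrightarrow>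
      closure {x. f x \<noteq> 0} \<subseteq> D \<Longrightarrow> (LINT y:D|lborel. k y * f y) = 0"
    and "z \<in> D"
  shows "k z = 0"
proof (rule ccontr)
  assume kz: "k z \<noteq> 0"
  have "isCont k z" using k \<open>open D\<close> \<open>z \<in> D\<close> by (simp add: continuous_on_eq_continuous_at)
  then obtain d1 where d1: "d1 > 0" "\<And>y. dist y z < d1 \<Longrightarrow> \<bar>k y - k z\<bar> < \<bar>k z\<bar> / 2"
    using kz unfolding continuous_at_eps_delta dist_real_def
    by (metis half_gt_zero zero_less_abs_iff)
  obtain d2 where d2: "d2 > 0" "cball z d2 \<subseteq> D" using \<open>open D\<close> \<open>z \<in> D\<close> open_contains_cball by blast
  define d where "d = min d1 d2 / 2"
  have d: "d > 0" "d < d1" "d < d2" using d1 d2 by (auto simp: d_def)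
  \<comment> \<open>A tent of radius d, at least 1/2 on the concentric ball of radius d / 2.\<close>
  define f where "f = (\<lambda>y. max 0 (1 - dist y z / d))"
  have "{y. f y \<noteq> 0} \<subseteq> cball z d" using d by (auto simp: f_def max_def dist_commute split: if_splits)
  then have cl: "closure {y. f y \<noteq> 0} \<subseteq> cball z d" by (rule closure_minimal) auto
  have fc: "continuous_on S f" for S unfolding f_def by (intro continuous_intros) (use d in auto)
  have "compact (closure {y. f y \<noteq> 0})"
    using cl bounded_subset bounded_cball by (auto simp: compact_eq_bounded_closed)
  moreover have "closure {y. f y \<noteq> 0} \<subseteq> D" using cl d d2 by force
  ultimately have zero: "(LINT y:D|lborel. k y * f y) = 0" using test fc by blast
  \<comment> \<open>The constant factor \<open>k z\<close> makes the integrand nonnegative whatever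
    the sign of \<open>k z\<close>.\<close>
  let ?g = "\<lambda>y. indicator (cball z d) y *\<^sub>R (k z * (k y * f y))"
  have g0: "(\<integral>y. ?g y \<partial>lborel) = 0"
  proof -
    have "(\<lambda>y. indicator D y *\<^sub>R (k y * f y)) = (\<lambda>y. indicator (cball z d) y *\<^sub>R (k y * f y))"
    proof
      fix y
      have "y \<in> cball z d \<and> y \<in> D" if "f y \<noteq> 0"
        using that \<open>{y. f y \<noteq> 0} \<subseteq> cball z d\<close> d d2 by (auto simp: subset_eq)
      then show "indicator D y *\<^sub>R (k y * f y) = indicator (cball z d) y *\<^sub>R (k y * f y)"
        by (cases "f y = 0") (auto simp: indicator_def)
    qed
    then have "(\<integral>y. indicator (cball z d) y *\<^sub>R (k y * f y) \<partial>lborel) = 0"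
      using zero by (simp add: set_lebesgue_integral_def)
    then have "k z * (\<integral>y. indicator (cball z d) y *\<^sub>R (k y * f y) \<partial>lborel) = 0" by simp
    then show ?thesis by (simp add: mult.left_commute flip: integral_mult_right_zero)
  qed
  have int: "integrable lborel ?g"
    by (intro borel_integrable_compact continuous_intros fc continuous_on_subset[OF k]) (use d d2 in force)+
  have low: "indicator (cball z (d / 2)) y * ((k z)\<^sup>2 / 4) \<le> ?g y" for y
  proof (cases "y \<in> cball z d")
    case True
    then have "\<bar>k y - k z\<bar> < \<bar>k z\<bar> / 2" using d1(2)[of y] d by (simp add: dist_commute)
    then have "k z * k y \<ge> (k z)\<^sup>2 / 2"
      by (auto simp: power2_eq_square abs_if mult_left_le_imp_le split: if_splits intro: mult_left_mono
          dest: mult_left_mono[of _ _ "k z"] mult_left_mono_neg[of _ _ "k z"])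
    moreover have "f y \<ge> 0" by (simp add: f_def)
    ultimately have 1: "(k z)\<^sup>2 / 2 * f y \<le> k z * k y * f y" by (rule mult_right_mono)
    have 2: "f y \<ge> 1 / 2" if "y \<in> cball z (d / 2)"
    proof -
      have "dist y z / d \<le> 1 / 2" using that d by (simp add: dist_commute field_simps)
      then show ?thesis unfolding f_def by linarith
    qed
    have "indicator (cball z (d / 2)) y * ((k z)\<^sup>2 / 4) \<le> (k z)\<^sup>2 / 2 * f y"
    proof (cases "y \<in> cball z (d / 2)")
      case True
      then show ?thesis using mult_left_mono[OF 2[OF True], of "(k z)\<^sup>2 / 2"] by simp
    next
      case False
      then show ?thesis by (simp add: f_def)
    qed
    also note 1
    also have "k z * k y * f y = ?g y" using True by (simp add: mult.assoc)
    finally show ?thesis .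
  next
    case False
    then show ?thesis using d by (auto simp: indicator_def)
  qed
  have "(\<integral>y. indicator (cball z (d / 2)) y * ((k z)\<^sup>2 / 4) \<partial>lborel) \<le> (\<integral>y. ?g y \<partial>lborel)"
    by (intro integral_mono int low integrable_mult_left integrable_real_indicator) (use emeasure_bounded_finite[OF bounded_cball[of z "d / 2"]] in auto)
  then have "measure lborel (cball z (d / 2)) * (k z)\<^sup>2 \<le> 0" using g0 by simp
  moreover have "measure lborel (cball z (d / 2)) > 0"
    using content_cball_pos[of "d / 2" z] d by simp
  ultimately show False using kz by (simp add: mult_le_0_iff)
qed

text \<open>Both kernels turn a test function into bounded solutions with the same initial values,
  so uniqueness equates their integrals against it; continuity in y makes the equality
  pointwise.\<close>

lemma dirichlet_heat_kernel_half_space: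
  fixes G :: "real \<Rightarrow> real \<times> (real ^ 'm) \<Rightarrow> real \<times> (real ^ 'm) \<Rightarrow> real"
  assumes G: "dirichlet_heat_kernel half_space G" and t: "t > 0"
    and x: "x \<in> closure half_space" and y: "y \<in> closure half_space"
  shows "G t x y = half_space_kernel t x y"
proof -
  let ?D = "half_space :: (real \<times> (real ^ 'm)) set"
  have "continuous_on (closure ?D \<times> closure ?D) (\<lambda>(x, y). G t x y)"
    using G t by (simp add: dirichlet_heat_kernel_def)
  then have Gc: "continuous_on (closure ?D) (G t x)"
    using x by (intro continuous_on_compose2[where f="\<lambda>y. (x, y)" and g="\<lambda>(x, y). G t x y" and s="closure ?D", simplified])
      (auto intro!: continuous_intros)
  let ?k = "\<lambda>y. G t x y - half_space_kernel t x y"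
  have kc: "continuous_on (closure ?D) ?k"
    by (intro continuous_intros Gc continuous_on_half_space_kernel)
  have "?k z = 0" if "z \<in> ?D" for z
  proof (rule continuous_zero_if_test_integrals_zero[OF open_half_space continuous_on_subset[OF kc closure_subset] _ that])
    fix f :: "real \<times> (real ^ 'm) \<Rightarrow> real"
    assume f: "continuous_on UNIV f" "compact (closure {x. f x \<noteq> 0})" "closure {x. f x \<noteq> 0} \<subseteq> half_space"
    let ?K = "closure {x. f x \<noteq> 0}"
    have KD: "?K \<subseteq> closure ?D" using f(3) closure_subset by blast
    have int: "set_integrable lborel ?D (\<lambda>y. u y * f y)" if "continuous_on (closure ?D) u" for u
    proof -
      have "integrable lborel (\<lambda>y. indicator ?K y *\<^sub>R (u y * f y))"
        by (intro borel_integrable_compact f(2) continuous_intros continuous_on_subset[OF that KD] continuous_on_subset[OF f(1)]) auto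
      also have "(\<lambda>y. indicator ?K y *\<^sub>R (u y * f y)) = (\<lambda>y. indicator ?D y *\<^sub>R (u y * f y))"
      proof
        fix y show "indicator ?K y *\<^sub>R (u y * f y) = indicator ?D y *\<^sub>R (u y * f y)"
          using f(3) closure_subset[of "{x. f x \<noteq> 0}"] by (cases "f y = 0") (auto simp: indicator_def)
      qed
      finally show ?thesis by (simp add: set_integrable_def)
    qed
    have "dirichlet_heat_solution ?D f (\<lambda>t x. if t = 0 then f x else (LINT y:?D|lborel. G t x y * f y))"
      using G f by (simp add: dirichlet_heat_kernel_def)
    from dirichlet_heat_solution_unique[OF open_half_space this half_space_solution[OF f], of t x] t x
    have "(LINT y:?D|lborel. G t x y * f y) = (LINT y:?D|lborel. half_space_kernel t x y * f y)" by simp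
    then show "(LINT y:?D|lborel. ?k y * f y) = 0"
      unfolding left_diff_distrib
      by (subst set_integral_diff(2)[OF int[OF Gc] int[OF continuous_on_half_space_kernel]]) simp
  qed
  \<comment> \<open>Passage to y on the boundary, which is where the normal derivative is
    taken.\<close>
  then have "?k y = 0" by (rule continuous_constant_on_closure[OF kc _ y])
  then show ?thesis by simp
qed

section \<open>The Poisson kernel and its Laplacian\<close>

lemma normal_deriv_half_space_kernel:
  fixes G :: "real \<Rightarrow> real \<times> (real ^ 'm) \<Rightarrow> real \<times> (real ^ 'm) \<Rightarrow> real"
  assumes G: "dirichlet_heat_kernel half_space G" and r: "r > 0" and z: "z \<in> half_space"
  shows "normal_deriv (G r z) (0, y) = fst z / r * heat_kernel r (z - (0, y))"
proof -
  let ?w = "z - (0, y)" and ?e = "(1, 0) :: real \<times> (real ^ 'm)"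
  let ?g = "\<lambda>h. heat_kernel r (?w - h *\<^sub>R ?e) - heat_kernel r (?w + h *\<^sub>R ?e)"
  \<comment> \<open>\<open>G\<close> is described only on the closed half-space, so the identity
    needs h \<ge> 0 and yields a one-sided derivative.\<close>
  have eq: "G r z ((0, y) + h *\<^sub>R inward_normal) = ?g h" if "h \<ge> 0" for h
  proof -
    have "G r z ((0, y) + h *\<^sub>R inward_normal) = half_space_kernel r z ((0, y) + h *\<^sub>R inward_normal)"
      using that z closure_subset[of half_space]
      by (intro dirichlet_heat_kernel_half_space[OF G r]) (auto simp: closure_half_space inward_normal_def)
    also have "\<dots> = ?g h"
      by (simp add: half_space_kernel_def inward_normal_def reflection_def prod_eq_iff algebra_simps
          arg_cong[of _ _ "heat_kernel r"] minus_prod_def)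
    finally show ?thesis .
  qed
  have "(?g has_vector_derivative fst z / r * heat_kernel r ?w) (at 0)"
  proof -
    define w e where "w = ?w" and "e = ?e"
    have ew: "e \<bullet> w = fst z" by (simp add: w_def e_def inner_prod_def)
    have "((\<lambda>h. w - h *\<^sub>R e) has_derivative (\<lambda>h. - (h *\<^sub>R e))) (at (0::real))"
      "((\<lambda>h. w + h *\<^sub>R e) has_derivative (\<lambda>h. h *\<^sub>R e)) (at (0::real))"
      by (auto intro!: derivative_eq_intros)
    note d = this[THEN has_derivative_compose, OF heat_kernel_has_derivative[OF r]]
    \<comment> \<open>The source and its image contribute equally, \<open>fst z / (2 * r)\<close>
      times the kernel each.\<close>
    have "((\<lambda>h. heat_kernel r (w - h *\<^sub>R e) - heat_kernel r (w + h *\<^sub>R e)) has_derivative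
        (\<lambda>h. h *\<^sub>R (fst z / r * heat_kernel r w))) (at 0)"
      by (rule has_derivative_eq_rhs[OF has_derivative_diff[OF d]])
        (use r in \<open>auto simp: fun_eq_iff ew field_simps\<close>)
    then show ?thesis unfolding has_vector_derivative_def w_def e_def .
  qed
  then have "(?g has_vector_derivative fst z / r * heat_kernel r ?w) (at 0 within {0..})"
    by (rule has_vector_derivative_at_within)
  then have "((\<lambda>h. G r z ((0, y) + h *\<^sub>R inward_normal)) has_vector_derivative fst z / r * heat_kernel r ?w) (at 0 within {0..})"
    by (rule has_vector_derivative_transform[rotated 2]) (auto simp: eq)
  moreover have "at (0::real) within {0..} \<noteq> bot"
    by (simp add: at_within_Ici_at_right trivial_limit_at_right_real)
  ultimately show ?thesis
    unfolding normal_deriv_def by (intro vector_derivative_within)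
qed

text \<open>Product rule: as c \<bullet> e = 0, the cross term of the two gradients is - (x
  \<bullet> e) / r times the kernel, which raises the dimension n in the usual factor to n +
  2.\<close>

lemma laplacian_linear_heat_kernel:
  fixes c e x :: "'a::euclidean_space"
  assumes r: "r > 0" and ce: "c \<bullet> e = 0"
  shows "laplacian (\<lambda>z. (z \<bullet> e) * heat_kernel r (z - c)) x
    = (x \<bullet> e) * ((norm (x - c))\<^sup>2 / (4 * r\<^sup>2) - (real DIM('a) + 2) / (2 * r)) * heat_kernel r (x - c)"
proof -
  define H where "H = (\<lambda>z. heat_kernel r (z - c))"
  have H: "(H has_derivative (\<lambda>h. - (h \<bullet> (z - c)) / (2 * r) * H z)) (at z)" for z
  proof -
    have "((\<lambda>z. z - c) has_derivative (\<lambda>h. h)) (at z)" by (auto intro!: derivative_eq_intros)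
    from has_derivative_compose[OF this heat_kernel_has_derivative[OF r]]
    show ?thesis unfolding H_def
      by (rule has_derivative_eq_rhs) (use r in \<open>auto simp: fun_eq_iff inner_diff_right field_simps\<close>)
  qed
  have p1: "partial_deriv b (\<lambda>z. (z \<bullet> e) * H z) = (\<lambda>z. ((b \<bullet> e) - (z \<bullet> e) * (b \<bullet> (z - c)) / (2 * r)) * H z)" for b
  proof
    fix z
    have "((\<lambda>z. (z \<bullet> e) * H z) has_derivative (\<lambda>h. (z \<bullet> e) * (- (h \<bullet> (z - c)) / (2 * r) * H z) + (h \<bullet> e) * H z)) (at z)"
      by (auto intro!: derivative_eq_intros H)
    from partial_deriv_eqI[OF this, of b]
    show "partial_deriv b (\<lambda>z. (z \<bullet> e) * H z) z = ((b \<bullet> e) - (z \<bullet> e) * (b \<bullet> (z - c)) / (2 * r)) * H z"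
      using r by (simp add: field_simps)
  qed
  have p2: "partial_deriv b (partial_deriv b (\<lambda>z. (z \<bullet> e) * H z)) x
      = ((x \<bullet> e) * ((x - c) \<bullet> b)\<^sup>2 / (4 * r\<^sup>2) - (x \<bullet> e) / (2 * r) - (e \<bullet> b) * ((x - c) \<bullet> b) / r) * H x"
    if b: "b \<in> Basis" for b
  proof -
    have "((\<lambda>z. ((b \<bullet> e) - (z \<bullet> e) * (b \<bullet> (z - c)) / (2 * r)) * H z) has_derivative
      (\<lambda>h. ((b \<bullet> e) - (x \<bullet> e) * (b \<bullet> (x - c)) / (2 * r)) * (- (h \<bullet> (x - c)) / (2 * r) * H x)
        + (- ((x \<bullet> e) * (b \<bullet> h) + (h \<bullet> e) * (b \<bullet> (x - c))) / (2 * r)) * H x)) (at x)"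
      using r by (auto intro!: derivative_eq_intros H simp: fun_eq_iff field_simps)
    from partial_deriv_eqI[OF this, of b]
    have "partial_deriv b (partial_deriv b (\<lambda>z. (z \<bullet> e) * H z)) x
        = ((b \<bullet> e) - (x \<bullet> e) * (b \<bullet> (x - c)) / (2 * r)) * (- (b \<bullet> (x - c)) / (2 * r) * H x)
        + (- ((x \<bullet> e) * (b \<bullet> b) + (b \<bullet> e) * (b \<bullet> (x - c))) / (2 * r)) * H x"
      unfolding p1 .
    moreover have "b \<bullet> b = 1" "(x - c) \<bullet> b = b \<bullet> (x - c)" "e \<bullet> b = b \<bullet> e"
      using b by (simp_all add: inner_same_Basis inner_commute)
    moreover obtain u v w where "b \<bullet> (x - c) = u" "x \<bullet> e = v" "b \<bullet> e = w" by blast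
    ultimately show ?thesis using r by (simp add: field_simps power2_eq_square)
  qed
  have "laplacian (\<lambda>z. (z \<bullet> e) * H z) x
      = (\<Sum>b\<in>Basis. ((x \<bullet> e) * ((x - c) \<bullet> b)\<^sup>2 / (4 * r\<^sup>2) - (x \<bullet> e) / (2 * r) - (e \<bullet> b) * ((x - c) \<bullet> b) / r) * H x)"
    unfolding laplacian_def by (intro sum.cong refl) (simp add: p2)
  also have "\<dots> = ((x \<bullet> e) * (\<Sum>b\<in>Basis. ((x - c) \<bullet> b)\<^sup>2) / (4 * r\<^sup>2) - real DIM('a) * ((x \<bullet> e) / (2 * r))
      - (\<Sum>b\<in>Basis. (e \<bullet> b) * ((x - c) \<bullet> b)) / r) * H x"
    by (simp add: sum_subtractf sum_distrib_left sum_distrib_right[symmetric] sum_divide_distrib)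
  also have "(\<Sum>b\<in>Basis. ((x - c) \<bullet> b)\<^sup>2) = (norm (x - c))\<^sup>2"
    unfolding power2_norm_eq_inner by (simp add: euclidean_inner[of "x - c" "x - c"] power2_eq_square)
  also have "(\<Sum>b\<in>Basis. (e \<bullet> b) * ((x - c) \<bullet> b)) = x \<bullet> e"
    unfolding euclidean_inner[of e "x - c", symmetric] using ce by (simp add: inner_diff_right inner_commute)
  also have "((x \<bullet> e) * (norm (x - c))\<^sup>2 / (4 * r\<^sup>2) - real DIM('a) * ((x \<bullet> e) / (2 * r)) - x \<bullet> e / r) * H x
      = (x \<bullet> e) * ((norm (x - c))\<^sup>2 / (4 * r\<^sup>2) - (real DIM('a) + 2) / (2 * r)) * H x"
    using r by (simp add: field_simps power2_eq_square)
  finally show ?thesis unfolding H_def .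
qed

text \<open>The constant m + 3 is the dimension m + 1 of the half-space plus the 2 from the cross
  term.\<close>

lemma boundary_kernel_eq:
  fixes G :: "real \<Rightarrow> real \<times> (real ^ 'm) \<Rightarrow> real \<times> (real ^ 'm) \<Rightarrow> real"
  assumes G: "dirichlet_heat_kernel half_space G" and r: "r > 0" and x: "x \<in> half_space"
  shows "boundary_kernel G r x y = fst x / r * ((norm (x - (0, y)))\<^sup>2 / (4 * r\<^sup>2) - (real CARD('m) + 3) / (2 * r))
    * heat_kernel r (x - (0, y))"
proof -
  let ?e = "(1 / r, 0) :: real \<times> (real ^ 'm)"
  have "boundary_kernel G r x y = laplacian (\<lambda>z. (z \<bullet> ?e) * heat_kernel r (z - (0, y))) x"
    unfolding boundary_kernel_def
    by (rule laplacian_cong[OF open_half_space x])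
      (simp add: normal_deriv_half_space_kernel[OF G r] inner_prod_def)
  also have "\<dots> = (x \<bullet> ?e) * ((norm (x - (0, y)))\<^sup>2 / (4 * r\<^sup>2) - (real DIM(real \<times> (real ^ 'm)) + 2) / (2 * r))
      * heat_kernel r (x - (0, y))"
    by (rule laplacian_linear_heat_kernel[OF r]) (simp add: inner_prod_def)
  finally show ?thesis by (simp add: inner_prod_def algebra_simps)
qed

subsection \<open>Gaussian families of Schwartz functions\<close>

lemma iter_partial_deriv_diff:
  assumes "\<And>bs. bs \<in> lists Basis \<Longrightarrow> iter_partial_deriv bs f differentiable_on UNIV"
    and "\<And>bs. bs \<in> lists Basis \<Longrightarrow> iter_partial_deriv bs g differentiable_on UNIV"
    and "bs \<in> lists Basis"
  shows "iter_partial_deriv bs (\<lambda>x. f x - g x) = (\<lambda>x. iter_partial_deriv bs f x - iter_partial_deriv bs g x)"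
  using assms(3)
proof (induction bs)
  case (Cons b bs)
  then have "bs \<in> lists Basis" by simp
  then have "partial_deriv b (\<lambda>x. iter_partial_deriv bs f x - iter_partial_deriv bs g x) x
      = partial_deriv b (iter_partial_deriv bs f) x - partial_deriv b (iter_partial_deriv bs g) x" for x
    using assms(1,2) by (intro partial_deriv_diff) (auto simp: differentiable_on_def)
  moreover have "iter_partial_deriv bs (\<lambda>x. f x - g x) = (\<lambda>x. iter_partial_deriv bs f x - iter_partial_deriv bs g x)"
    using Cons by simp
  ultimately show ?case by (simp only: iter_partial_deriv.simps)
qed simp

text \<open>Linear combinations of \<open>k(a) p(y) exp (- a |y - c|\<^sup>2)\<close> with \<open>p\<close> a polynomial: this class is closed
  under partial derivatives in \<open>y\<close>, and every member is Schwartz, depending continuously on \<open>a > 0\<close>.\<close>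

inductive gauss_family :: "'a::euclidean_space \<Rightarrow> (real \<Rightarrow> 'a \<Rightarrow> real) \<Rightarrow> bool" for c where
  base: "continuous_on {0<..} k \<Longrightarrow> real_polynomial_function p \<Longrightarrow>
    gauss_family c (\<lambda>a y. k a * (p y * exp (- a * (norm (y - c))\<^sup>2)))"
| add: "gauss_family c F \<Longrightarrow> gauss_family c F' \<Longrightarrow> gauss_family c (\<lambda>a y. F a y + F' a y)"

lemma real_polynomial_function_inner_diff: "real_polynomial_function (\<lambda>y. (y - c) \<bullet> b)"
  unfolding inner_diff_left
  by (intro real_polynomial_function_diff real_polynomial_function.intros(1,2) bounded_linear_inner_left)

lemma real_polynomial_function_has_partial_deriv:
  assumes "real_polynomial_function p"
  shows "\<exists>p'. real_polynomial_function p' \<and> (\<forall>y. ((\<lambda>h. p (y + h *\<^sub>R b)) has_real_derivative p' y) (at 0))"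
  using assms
proof induction
  case (linear f)
  then interpret bounded_linear f .
  show ?case
    by (rule exI[of _ "\<lambda>_. f b"]) (auto simp: add scale intro!: derivative_eq_intros)
next
  case (const c)
  show ?case by (rule exI[of _ "\<lambda>_. 0"]) auto
next
  case (add f g)
  then obtain f' g' where "real_polynomial_function f'" "real_polynomial_function g'"
    "\<And>y. ((\<lambda>h. f (y + h *\<^sub>R b)) has_real_derivative f' y) (at 0)"
    "\<And>y. ((\<lambda>h. g (y + h *\<^sub>R b)) has_real_derivative g' y) (at 0)" by metis
  then show ?case by (intro exI[of _ "\<lambda>y. f' y + g' y"]) (auto intro!: derivative_intros)
next
  case (mult f g)
  then obtain f' g' where "real_polynomial_function f'" "real_polynomial_function g'"
    "\<And>y. ((\<lambda>h. f (y + h *\<^sub>R b)) has_real_derivative f' y) (at 0)"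
    "\<And>y. ((\<lambda>h. g (y + h *\<^sub>R b)) has_real_derivative g' y) (at 0)" by metis
  with mult.hyps show ?case
    by (intro exI[of _ "\<lambda>y. f' y * g y + g' y * f y"]) (auto intro!: derivative_eq_intros)
qed

lemma gaussian_has_partial_deriv:
  fixes b c y :: "'a::real_inner"
  shows "((\<lambda>h. exp (- a * (norm (y + h *\<^sub>R b - c))\<^sup>2)) has_real_derivative
    - (2 * a) * ((y - c) \<bullet> b) * exp (- a * (norm (y - c))\<^sup>2)) (at 0)"
proof -
  have eq: "(norm (y + h *\<^sub>R b - c))\<^sup>2 = (norm (y - c))\<^sup>2 + 2 * h * ((y - c) \<bullet> b) + h\<^sup>2 * (b \<bullet> b)" for h
  proof -
    have "y + h *\<^sub>R b - c = (y - c) + h *\<^sub>R b" by simp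
    then show ?thesis
      by (simp only: power2_norm_eq_inner inner_add_left inner_add_right inner_scaleR_left inner_scaleR_right
          inner_commute[of b "y - c"]) (simp add: power2_eq_square algebra_simps)
  qed
  show ?thesis unfolding eq by (auto intro!: derivative_eq_intros)
qed

text \<open>Differentiating the exponential adds the factor - 2 a to the coefficient and (y - c)
  \<bullet> b to the polynomial. One \<open>F'\<close> serves all a, so continuity in a is inherited
  by derivatives of every order.\<close>

lemma gauss_family_has_partial_deriv:
  assumes "gauss_family c F"
  shows "\<exists>F'. gauss_family c F' \<and> (\<forall>a y. ((\<lambda>h. F a (y + h *\<^sub>R b)) has_real_derivative F' a y) (at 0))"
  using assms
proof induction
  case (base k p)
  then obtain p' where p': "real_polynomial_function p'"
    "\<And>y. ((\<lambda>h. p (y + h *\<^sub>R b)) has_real_derivative p' y) (at 0)"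
    using real_polynomial_function_has_partial_deriv by metis
  let ?F' = "\<lambda>a y. k a * (p' y * exp (- a * (norm (y - c))\<^sup>2))
    + (- 2 * a * k a) * ((p y * ((y - c) \<bullet> b)) * exp (- a * (norm (y - c))\<^sup>2))"
  have "gauss_family c ?F'"
    using base p'
    by (intro gauss_family.intros real_polynomial_function.intros(4) real_polynomial_function_inner_diff continuous_intros)
  moreover have "((\<lambda>h. k a * (p (y + h *\<^sub>R b) * exp (- a * (norm (y + h *\<^sub>R b - c))\<^sup>2))) has_real_derivative ?F' a y) (at 0)" for a y
    by (rule DERIV_cong[OF DERIV_cmult[OF DERIV_mult[OF p'(2) gaussian_has_partial_deriv]]]) (simp add: algebra_simps)
  ultimately show ?case by blast
next
  case (add F G)
  then obtain F' G' where "gauss_family c F'" "gauss_family c G'"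
    "\<And>a y. ((\<lambda>h. F a (y + h *\<^sub>R b)) has_real_derivative F' a y) (at 0)"
    "\<And>a y. ((\<lambda>h. G a (y + h *\<^sub>R b)) has_real_derivative G' a y) (at 0)" by metis
  then show ?case
    by (intro exI[of _ "\<lambda>a y. F' a y + G' a y"] conjI gauss_family.add allI derivative_intros)
qed

lemma gauss_family_iter_partial_deriv:
  assumes "gauss_family c F"
  shows "\<exists>F'. gauss_family c F' \<and> (\<forall>a. iter_partial_deriv bs (F a) = F' a)"
proof (induction bs)
  case Nil
  then show ?case using assms by auto
next
  case (Cons b bs)
  then obtain F' where F': "gauss_family c F'" "\<And>a. iter_partial_deriv bs (F a) = F' a" by blast
  from gauss_family_has_partial_deriv[OF F'(1), of b] obtain F'' where
    "gauss_family c F''" "\<And>a y. ((\<lambda>h. F' a (y + h *\<^sub>R b)) has_real_derivative F'' a y) (at 0)" by blast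
  then show ?case by (intro exI[of _ F'']) (auto simp: F'(2) fun_eq_iff intro!: partial_derivI)
qed

lemma gauss_family_differentiable:
  assumes "gauss_family c F"
  shows "F a differentiable_on UNIV"
  using assms
proof induction
  case (base k p)
  have "p differentiable (at y)" for y
    using base(2) by (rule differentiable_at_real_polynomial_function)
  moreover have "(\<lambda>y. exp (- a * (norm (y - c))\<^sup>2)) differentiable (at y)" for y
    unfolding power2_norm_eq_inner differentiable_def by (rule exI) (rule derivative_eq_intros refl)+
  ultimately show ?case
    unfolding differentiable_on_def by (intro ballI differentiable_mult) auto
next
  case (add F G)
  then show ?case by (intro differentiable_on_add)
qed

section \<open>Weighted bounds and continuity in the parameter\<close>

lemma real_polynomial_function_bound:
  assumes "real_polynomial_function p"
  shows "\<exists>C n. \<forall>y. \<bar>p y\<bar> \<le> C * (1 + norm y) ^ n"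
  using assms
proof induction
  case (linear f)
  then interpret bounded_linear f .
  obtain K where K: "K \<ge> 0" "\<And>y. norm (f y) \<le> norm y * K" using nonneg_bounded by blast
  have "\<bar>f y\<bar> \<le> K * (1 + norm y) ^ 1" for y
    using K(2)[of y] K(1) by (simp add: algebra_simps)
  then show ?case by blast
next
  case (const c)
  show ?case by (rule exI[of _ "\<bar>c\<bar>"], rule exI[of _ 0]) simp
next
  case (add f g)
  then obtain C n C' n' where *: "\<And>y. \<bar>f y\<bar> \<le> C * (1 + norm y) ^ n" "\<And>y. \<bar>g y\<bar> \<le> C' * (1 + norm y) ^ n'" by metis
  have "\<bar>f y + g y\<bar> \<le> (\<bar>C\<bar> + \<bar>C'\<bar>) * (1 + norm y) ^ (n + n')" for y
  proof -
    have "C * (1 + norm y) ^ n \<le> \<bar>C\<bar> * (1 + norm y) ^ (n + n')"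
      by (intro mult_mono power_increasing) auto
    moreover have "C' * (1 + norm y) ^ n' \<le> \<bar>C'\<bar> * (1 + norm y) ^ (n + n')"
      by (intro mult_mono power_increasing) auto
    ultimately show ?thesis using *[of y] by (simp add: distrib_right)
  qed
  then show ?case by blast
next
  case (mult f g)
  then obtain C n C' n' where *: "\<And>y. \<bar>f y\<bar> \<le> C * (1 + norm y) ^ n" "\<And>y. \<bar>g y\<bar> \<le> C' * (1 + norm y) ^ n'" by metis
  have "\<bar>f y * g y\<bar> \<le> (C * C') * (1 + norm y) ^ (n + n')" for y
    using mult_mono[OF *[of y]] order_trans[OF abs_ge_zero *(1)[of y]] by (simp add: abs_mult power_add mult_ac)
  then show ?case by blast
qed

text \<open>A single term of the exponential series is at most its sum.\<close>

lemma power_le_fact_exp: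
  fixes u :: real
  assumes "u \<ge> 0"
  shows "u ^ n \<le> fact n * exp u"
proof -
  have "(\<Sum>i\<in>{n}. u ^ i /\<^sub>R fact i) \<le> (\<Sum>i. u ^ i /\<^sub>R fact i)"
    using assms by (intro sum_le_suminf summable_exp_generic) auto
  then have "u ^ n / fact n \<le> exp u" by (simp add: exp_def divide_inverse mult.commute)
  then show ?thesis by (simp add: field_simps)
qed

text \<open>With u = |y - c|, the witness combines 1 + |y| \<le> (1 + |c|) (1 + u), the bound n! exp
  (1 + u) for (1 + u)^n, and u - a u^2 \<le> 1 / (4 a), a completed square.\<close>

lemma polynomial_gaussian_bounded:
  fixes c :: "'a::euclidean_space"
  assumes "a > 0"
  shows "\<exists>C\<ge>0. \<forall>y::'a. (1 + norm y) ^ n * exp (- a * (norm (y - c))\<^sup>2) \<le> C"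
proof (intro exI[of _ "(1 + norm c) ^ n * (fact n * exp (1 + 1 / (4 * a)))"] conjI allI)
  fix y :: 'a
  let ?u = "norm (y - c)"
  have "norm y \<le> norm c + ?u" using norm_triangle_ineq[of c "y - c"] by simp
  then have "1 + norm y \<le> (1 + norm c) * (1 + ?u)"
    using mult_nonneg_nonneg[OF norm_ge_zero[of c] norm_ge_zero[of "y - c"]]
    unfolding distrib_left distrib_right by linarith
  then have "(1 + norm y) ^ n \<le> (1 + norm c) ^ n * (1 + ?u) ^ n"
    by (metis power_mono power_mult_distrib add_nonneg_nonneg norm_ge_zero zero_le_one)
  also have "(1 + ?u) ^ n \<le> fact n * exp (1 + ?u)" by (rule power_le_fact_exp) simp
  finally have "(1 + norm y) ^ n \<le> (1 + norm c) ^ n * (fact n * exp (1 + ?u))" by (simp add: mult_left_mono)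
  then have "(1 + norm y) ^ n * exp (- a * ?u\<^sup>2) \<le> (1 + norm c) ^ n * (fact n * exp (1 + ?u)) * exp (- a * ?u\<^sup>2)"
    by (rule mult_right_mono) simp
  also have "\<dots> = (1 + norm c) ^ n * (fact n * exp (1 + ?u - a * ?u\<^sup>2))"
    by (simp add: exp_diff exp_minus field_simps)
  also have "\<dots> \<le> (1 + norm c) ^ n * (fact n * exp (1 + 1 / (4 * a)))"
  proof -
    have "0 \<le> (2 * a * ?u - 1)\<^sup>2 / (4 * a)" using assms by simp
    also have "\<dots> = a * ?u\<^sup>2 - ?u + 1 / (4 * a)" using assms by (simp add: field_simps power2_eq_square)
    finally show ?thesis by (intro mult_left_mono) auto
  qed
  finally show "(1 + norm y) ^ n * exp (- a * ?u\<^sup>2) \<le> (1 + norm c) ^ n * (fact n * exp (1 + 1 / (4 * a)))" .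
qed auto

lemma gauss_family_bounded:
  assumes "gauss_family c F" "a > 0"
  shows "\<exists>C. \<forall>y. (1 + norm y) ^ n * \<bar>F a y\<bar> \<le> C"
  using assms(1)
proof induction
  case (base k p)
  obtain C l where p: "\<And>y. \<bar>p y\<bar> \<le> C * (1 + norm y) ^ l" using real_polynomial_function_bound[OF base(2)] by blast
  obtain C' where C': "C' \<ge> 0" "\<And>y. (1 + norm y) ^ (n + l) * exp (- a * (norm (y - c))\<^sup>2) \<le> C'"
    using polynomial_gaussian_bounded[OF assms(2)] by blast
  have C: "C \<ge> 0" using order_trans[OF abs_ge_zero p[of 0]] by simp
  have "(1 + norm y) ^ n * \<bar>k a * (p y * exp (- a * (norm (y - c))\<^sup>2))\<bar> \<le> \<bar>k a\<bar> * (C * C')" for y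
  proof -
    have "(1 + norm y) ^ n * \<bar>k a * (p y * exp (- a * (norm (y - c))\<^sup>2))\<bar>
        = \<bar>k a\<bar> * (\<bar>p y\<bar> * ((1 + norm y) ^ n * exp (- a * (norm (y - c))\<^sup>2)))" by (simp add: abs_mult)
    also have "\<dots> \<le> \<bar>k a\<bar> * ((C * (1 + norm y) ^ l) * ((1 + norm y) ^ n * exp (- a * (norm (y - c))\<^sup>2)))"
      by (intro mult_left_mono mult_right_mono p) auto
    also have "\<dots> = \<bar>k a\<bar> * (C * ((1 + norm y) ^ (n + l) * exp (- a * (norm (y - c))\<^sup>2)))"
      by (simp add: power_add mult_ac)
    also have "\<dots> \<le> \<bar>k a\<bar> * (C * C')" by (intro mult_left_mono C') (use C in auto)
    finally show ?thesis .
  qed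
  then show ?case by blast
next
  case (add F G)
  then obtain C C' where *: "\<And>y. (1 + norm y) ^ n * \<bar>F a y\<bar> \<le> C" "\<And>y. (1 + norm y) ^ n * \<bar>G a y\<bar> \<le> C'" by metis
  have "(1 + norm y) ^ n * \<bar>F a y + G a y\<bar> \<le> C + C'" for y
  proof -
    have "(1 + norm y) ^ n * \<bar>F a y + G a y\<bar> \<le> (1 + norm y) ^ n * (\<bar>F a y\<bar> + \<bar>G a y\<bar>)"
      by (intro mult_left_mono abs_triangle_ineq) auto
    then show ?thesis using *[of y] by (simp add: distrib_left)
  qed
  then show ?case by blast
qed

text \<open>From 1 - exp (- v) \<le> v, the larger exponential being bounded by exp (- l q).\<close>

lemma abs_exp_diff_le:
  fixes a b q :: real
  assumes "q \<ge> 0" "a \<ge> l" "b \<ge> l"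
  shows "\<bar>exp (- a * q) - exp (- b * q)\<bar> \<le> \<bar>a - b\<bar> * q * exp (- l * q)"
proof -
  have *: "exp (- a * q) - exp (- b * q) \<le> (b - a) * q * exp (- l * q)" "exp (- b * q) \<le> exp (- a * q)"
    if "a \<le> b" "a \<ge> l" for a b
  proof -
    have "exp (- b * q) = exp (- a * q) * exp (- (b - a) * q)" by (simp add: algebra_simps flip: exp_add)
    then have "exp (- a * q) - exp (- b * q) = exp (- a * q) * (1 - exp (- (b - a) * q))" by (simp add: algebra_simps)
    also have "\<dots> \<le> exp (- a * q) * ((b - a) * q)"
      using exp_ge_add_one_self[of "- (b - a) * q"] by (intro mult_left_mono, linarith) simp
    also have "\<dots> \<le> exp (- l * q) * ((b - a) * q)"
      using that assms by (intro mult_right_mono) (auto intro: mult_right_mono)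
    finally show "exp (- a * q) - exp (- b * q) \<le> (b - a) * q * exp (- l * q)" by (simp add: mult_ac)
    show "exp (- b * q) \<le> exp (- a * q)" using that assms by (simp add: mult_right_mono)
  qed
  show ?thesis
    using *[of a b] *[of b a] assms by (cases "a \<le> b") (auto simp: abs_if)
qed

text \<open>Convergence is recorded through a null sequence \<open>e\<close> instead of suprema, so
  that sums are handled by adding the sequences. Eventually s i > a / 2, and a Gaussian with
  parameter a / 2 dominates every term.\<close>

lemma gauss_family_continuous:
  assumes "gauss_family c F" and s: "s \<longlonglongrightarrow> a" and a: "a > 0"
  shows "\<exists>e. e \<longlonglongrightarrow> 0 \<and> (\<forall>\<^sub>F i in sequentially. \<forall>y. (1 + norm y) ^ n * \<bar>F (s i) y - F a y\<bar> \<le> e i)"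
  using assms(1)
proof induction
  case (base k p)
  obtain C l where p: "\<And>y. \<bar>p y\<bar> \<le> C * (1 + norm y) ^ l" using real_polynomial_function_bound[OF base(2)] by blast
  have C: "C \<ge> 0" using order_trans[OF abs_ge_zero p[of 0]] by simp
  obtain A where A: "A \<ge> 0" "\<And>y. (1 + norm y) ^ (n + l) * exp (- (a / 2) * (norm (y - c))\<^sup>2) \<le> A"
    using polynomial_gaussian_bounded[OF half_gt_zero[OF a]] by blast
  obtain B where B: "B \<ge> 0" "\<And>y. (1 + norm y) ^ (n + l + 2) * exp (- (a / 2) * (norm (y - c))\<^sup>2) \<le> B"
    using polynomial_gaussian_bounded[OF half_gt_zero[OF a]] by blast
  define D where "D = (1 + norm c)\<^sup>2"
  \<comment> \<open>The first summand accounts for the change of the coefficient k, the second for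
    the change of the exponent, where |y - c|^2 \<le> D (1 + |y|)^2 costs the two extra powers in
    the choice of \<open>B\<close>.\<close>
  define e where "e = (\<lambda>i. \<bar>k (s i) - k a\<bar> * (C * A) + \<bar>k a\<bar> * (C * (\<bar>s i - a\<bar> * (D * B))))"
  have ks: "(\<lambda>i. k (s i)) \<longlonglongrightarrow> k a"
  proof -
    have "isCont k a" using base(1) a by (simp add: continuous_on_eq_continuous_at)
    then show ?thesis using s by (rule isCont_tendsto_compose)
  qed
  have "e \<longlonglongrightarrow> \<bar>k a - k a\<bar> * (C * A) + \<bar>k a\<bar> * (C * (\<bar>a - a\<bar> * (D * B)))"
    unfolding e_def by (intro tendsto_intros ks s)
  then have "e \<longlonglongrightarrow> 0" by simp
  moreover have "\<forall>\<^sub>F i in sequentially. s i > a / 2" using order_tendstoD(1)[OF s, of "a / 2"] a by simp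
  then have "\<forall>\<^sub>F i in sequentially. \<forall>y. (1 + norm y) ^ n *
      \<bar>k (s i) * (p y * exp (- s i * (norm (y - c))\<^sup>2)) - k a * (p y * exp (- a * (norm (y - c))\<^sup>2))\<bar> \<le> e i"
  proof (rule eventually_mono, intro allI)
    fix i and y :: 'a assume i: "s i > a / 2"
    let ?q = "(norm (y - c))\<^sup>2" and ?w = "(1 + norm y) ^ n"
    have q: "?q \<le> D * (1 + norm y)\<^sup>2"
    proof -
      have "norm (y - c) \<le> (1 + norm c) * (1 + norm y)"
        using norm_triangle_ineq4[of y c] mult_nonneg_nonneg[OF norm_ge_zero[of c] norm_ge_zero[of y]]
        unfolding distrib_left distrib_right by linarith
      then have "?q \<le> ((1 + norm c) * (1 + norm y))\<^sup>2" by (intro power_mono) auto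
      then show ?thesis by (simp add: D_def power_mult_distrib)
    qed
    have 1: "?w * (\<bar>p y\<bar> * exp (- s i * ?q)) \<le> C * A"
    proof -
      have "?w * (\<bar>p y\<bar> * exp (- s i * ?q)) \<le> ?w * ((C * (1 + norm y) ^ l) * exp (- (a / 2) * ?q))"
        using mult_right_mono[of "a / 2" "s i" ?q] i C by (intro mult_left_mono mult_mono p) auto
      also have "\<dots> = C * ((1 + norm y) ^ (n + l) * exp (- (a / 2) * ?q))" by (simp add: power_add)
      also have "\<dots> \<le> C * A" by (intro mult_left_mono A C)
      finally show ?thesis .
    qed
    have 2: "?w * (\<bar>p y\<bar> * \<bar>exp (- s i * ?q) - exp (- a * ?q)\<bar>) \<le> C * (\<bar>s i - a\<bar> * (D * B))"
    proof -
      have "?w * (\<bar>p y\<bar> * \<bar>exp (- s i * ?q) - exp (- a * ?q)\<bar>)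
          \<le> ?w * ((C * (1 + norm y) ^ l) * (\<bar>s i - a\<bar> * ?q * exp (- (a / 2) * ?q)))"
        using i a C by (intro mult_left_mono mult_mono p abs_exp_diff_le) auto
      also have "\<dots> \<le> ?w * ((C * (1 + norm y) ^ l) * (\<bar>s i - a\<bar> * (D * (1 + norm y)\<^sup>2) * exp (- (a / 2) * ?q)))"
        using C by (intro mult_left_mono mult_right_mono q) auto
      also have "\<dots> = C * (\<bar>s i - a\<bar> * (D * ((1 + norm y) ^ (n + l + 2) * exp (- (a / 2) * ?q))))"
        by (simp add: power_add power2_eq_square mult_ac)
      also have "\<dots> \<le> C * (\<bar>s i - a\<bar> * (D * B))"
        using C by (intro mult_left_mono B) (auto simp: D_def)
      finally show ?thesis .
    qed
    have "k (s i) * (p y * exp (- s i * ?q)) - k a * (p y * exp (- a * ?q))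
        = (k (s i) - k a) * (p y * exp (- s i * ?q)) + k a * (p y * (exp (- s i * ?q) - exp (- a * ?q)))"
      by (simp add: algebra_simps)
    then have "\<bar>k (s i) * (p y * exp (- s i * ?q)) - k a * (p y * exp (- a * ?q))\<bar>
        \<le> \<bar>(k (s i) - k a) * (p y * exp (- s i * ?q))\<bar> + \<bar>k a * (p y * (exp (- s i * ?q) - exp (- a * ?q)))\<bar>"
      by (simp only: abs_triangle_ineq)
    then have "\<bar>k (s i) * (p y * exp (- s i * ?q)) - k a * (p y * exp (- a * ?q))\<bar>
        \<le> \<bar>k (s i) - k a\<bar> * (\<bar>p y\<bar> * exp (- s i * ?q)) + \<bar>k a\<bar> * (\<bar>p y\<bar> * \<bar>exp (- s i * ?q) - exp (- a * ?q)\<bar>)"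
      unfolding abs_mult abs_exp_cancel .
    then have "?w * \<bar>k (s i) * (p y * exp (- s i * ?q)) - k a * (p y * exp (- a * ?q))\<bar>
        \<le> ?w * (\<bar>k (s i) - k a\<bar> * (\<bar>p y\<bar> * exp (- s i * ?q)) + \<bar>k a\<bar> * (\<bar>p y\<bar> * \<bar>exp (- s i * ?q) - exp (- a * ?q)\<bar>))"
      by (rule mult_left_mono) simp
    also have "\<dots> = \<bar>k (s i) - k a\<bar> * (?w * (\<bar>p y\<bar> * exp (- s i * ?q)))
        + \<bar>k a\<bar> * (?w * (\<bar>p y\<bar> * \<bar>exp (- s i * ?q) - exp (- a * ?q)\<bar>))"
      by (simp add: distrib_left mult_ac)
    also have "\<dots> \<le> e i" unfolding e_def by (intro add_mono mult_left_mono 1 2) auto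
    finally show "?w * \<bar>k (s i) * (p y * exp (- s i * ?q)) - k a * (p y * exp (- a * ?q))\<bar> \<le> e i" .
  qed
  ultimately show ?case by blast
next
  case (add F G)
  from add.IH(1) obtain e where e1: "e \<longlonglongrightarrow> 0"
    "\<forall>\<^sub>F i in sequentially. \<forall>y. (1 + norm y) ^ n * \<bar>F (s i) y - F a y\<bar> \<le> e i" by blast
  from add.IH(2) obtain e' where e2: "e' \<longlonglongrightarrow> 0"
    "\<forall>\<^sub>F i in sequentially. \<forall>y. (1 + norm y) ^ n * \<bar>G (s i) y - G a y\<bar> \<le> e' i" by blast
  have "\<forall>\<^sub>F i in sequentially. \<forall>y. (1 + norm y) ^ n * \<bar>F (s i) y + G (s i) y - (F a y + G a y)\<bar> \<le> e i + e' i"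
    using e1(2) e2(2)
  proof eventually_elim
    case (elim i)
    show ?case
    proof
      fix y
      have "(1 + norm y) ^ n * \<bar>F (s i) y + G (s i) y - (F a y + G a y)\<bar>
          \<le> (1 + norm y) ^ n * (\<bar>F (s i) y - F a y\<bar> + \<bar>G (s i) y - G a y\<bar>)"
        by (intro mult_left_mono) auto
      then show "(1 + norm y) ^ n * \<bar>F (s i) y + G (s i) y - (F a y + G a y)\<bar> \<le> e i + e' i"
        using elim(1)[rule_format, of y] elim(2)[rule_format, of y] by (simp add: distrib_left)
    qed
  qed
  moreover have "(\<lambda>i. e i + e' i) \<longlonglongrightarrow> 0" using tendsto_add[OF e1(1) e2(1)] by simp
  ultimately show ?case by blast
qed

lemma gauss_family_schwartz:
  assumes F: "gauss_family c F" and a: "a > 0"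
  shows "F a \<in> schwartz"
  unfolding schwartz_def
proof (intro CollectI ballI conjI allI)
  fix bs :: "'a list" and n
  obtain F' where F': "gauss_family c F'" "iter_partial_deriv bs (F a) = F' a"
    using gauss_family_iter_partial_deriv[OF F] by blast
  show "iter_partial_deriv bs (F a) differentiable_on UNIV"
    unfolding F' by (rule gauss_family_differentiable[OF F'(1)])
  show "bounded (range (\<lambda>x. (1 + norm x) ^ n * iter_partial_deriv bs (F a) x))"
    unfolding F' using gauss_family_bounded[OF F'(1) a, of n] by (auto simp: bounded_iff abs_mult)
qed

lemma gauss_family_schwartz_tendsto:
  assumes F: "gauss_family c F" and s: "s \<longlonglongrightarrow> a" and a: "a > 0" and s0: "\<And>i. s i > 0"
  shows "schwartz_tendsto (\<lambda>i. F (s i)) (F a)"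
  unfolding schwartz_tendsto_def
proof (intro allI ballI)
  fix n and bs :: "'a list" assume bs: "bs \<in> lists Basis"
  obtain F' where F': "gauss_family c F'" "\<And>a. iter_partial_deriv bs (F a) = F' a"
    using gauss_family_iter_partial_deriv[OF F] by blast
  have "iter_partial_deriv bs (\<lambda>x. F (s i) x - F a x) = (\<lambda>x. F' (s i) x - F' a x)" for i
    using iter_partial_deriv_diff[of "F (s i)" "F a" bs] gauss_family_schwartz[OF F] s0 a bs
    by (auto simp: schwartz_def F'(2))
  then have eq: "schwartz_seminorm n bs (\<lambda>x. F (s i) x - F a x) = (SUP x. (1 + norm x) ^ n * \<bar>F' (s i) x - F' a x\<bar>)" for i
    by (simp add: schwartz_seminorm_def)
  obtain e where e: "e \<longlonglongrightarrow> 0"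
    "\<forall>\<^sub>F i in sequentially. \<forall>y. (1 + norm y) ^ n * \<bar>F' (s i) y - F' a y\<bar> \<le> e i"
    using gauss_family_continuous[OF F'(1) s a] by blast
  show "(\<lambda>i. schwartz_seminorm n bs (\<lambda>x. F (s i) x - F a x)) \<longlonglongrightarrow> 0"
    unfolding eq
  proof (rule tendsto_sandwich[OF _ _ tendsto_const e(1)])
    show "\<forall>\<^sub>F i in sequentially. (SUP x. (1 + norm x) ^ n * \<bar>F' (s i) x - F' a x\<bar>) \<le> e i"
      using e(2) by (rule eventually_mono) (auto intro: cSUP_least)
    \<comment> \<open>A supremum is controlled only for a set bounded above, so even nonnegativity
      has to be drawn from the bound \<open>e i\<close>.\<close>
    show "\<forall>\<^sub>F i in sequentially. 0 \<le> (SUP x. (1 + norm x) ^ n * \<bar>F' (s i) x - F' a x\<bar>)"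
      using e(2)
    proof eventually_elim
      case (elim i)
      have "0 \<le> (1 + norm (0::'a)) ^ n * \<bar>F' (s i) 0 - F' a 0\<bar>" by simp
      also have "\<dots> \<le> (SUP x. (1 + norm x) ^ n * \<bar>F' (s i) x - F' a x\<bar>)"
        by (rule cSUP_upper) (use elim in \<open>auto intro: bdd_aboveI2\<close>)
      finally show ?case .
    qed
  qed
qed

subsection \<open>Second moments of integrated processes\<close>

text \<open>The right-hand side sees the family only through its covariances. So two families on
  different spaces with equal covariances have integrals with equal second moments, which is what
  allows the noise to be exchanged for a deterministic family.\<close>

lemma square_integral_eq_double_integral:
  fixes F :: "'s \<Rightarrow> 'w \<Rightarrow> real"
  assumes N: "finite_measure N" and M: "sigma_finite_measure M"
    and F[measurable]: "(\<lambda>(s, \<omega>). F s \<omega>) \<in> borel_measurable (N \<Otimes>\<^sub>M M)"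
    and A: "\<And>s. s \<in> space N \<Longrightarrow> (\<integral>\<^sup>+\<omega>. ennreal ((F s \<omega>)\<^sup>2) \<partial>M) \<le> ennreal A"
  shows "(\<integral>\<^sup>+\<omega>. ennreal ((\<integral>s. F s \<omega> \<partial>N)\<^sup>2) \<partial>M)
    = ennreal (\<integral>s. (\<integral>s'. (\<integral>\<omega>. F s \<omega> * F s' \<omega> \<partial>M) \<partial>N) \<partial>N)"
proof -
  interpret N: finite_measure N by fact
  interpret M: sigma_finite_measure M by fact
  interpret NN: pair_sigma_finite N N ..
  have NNs: "sigma_finite_measure (N \<Otimes>\<^sub>M N)" by (rule NN.P.sigma_finite_measure_axioms)
  interpret NNM: pair_sigma_finite "N \<Otimes>\<^sub>M N" M
    unfolding pair_sigma_finite_def using NNs M by simp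
  define G where "G = (\<lambda>(p, \<omega>). F (fst p) \<omega> * F (snd p) \<omega>)"
  have G[measurable]: "G \<in> borel_measurable ((N \<Otimes>\<^sub>M N) \<Otimes>\<^sub>M M)"
    unfolding G_def by measurable
  have slice[measurable]: "F s \<in> borel_measurable M" if "s \<in> space N" for s
    using measurable_compose[OF measurable_Pair1'[OF that] F] by simp
  have "integrable ((N \<Otimes>\<^sub>M N) \<Otimes>\<^sub>M M) G"
  proof (rule integrableI_bounded)
    have "(\<integral>\<^sup>+q. ennreal (norm (G q)) \<partial>((N \<Otimes>\<^sub>M N) \<Otimes>\<^sub>M M)) = (\<integral>\<^sup>+p. (\<integral>\<^sup>+\<omega>. ennreal (norm (G (p, \<omega>))) \<partial>M) \<partial>(N \<Otimes>\<^sub>M N))"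
      by (rule M.nn_integral_fst[symmetric]) measurable
    also have "\<dots> \<le> (\<integral>\<^sup>+p. ennreal A + ennreal A \<partial>(N \<Otimes>\<^sub>M N))"
    proof (rule nn_integral_mono)
      fix p assume "p \<in> space (N \<Otimes>\<^sub>M N)"
      then have p: "fst p \<in> space N" "snd p \<in> space N" by (auto simp: space_pair_measure)
      have "(\<integral>\<^sup>+\<omega>. ennreal (norm (G (p, \<omega>))) \<partial>M) \<le> (\<integral>\<^sup>+\<omega>. ennreal ((F (fst p) \<omega>)\<^sup>2) + ennreal ((F (snd p) \<omega>)\<^sup>2) \<partial>M)"
      proof (rule nn_integral_mono)
        fix \<omega>
        let ?a = "F (fst p) \<omega>" and ?b = "F (snd p) \<omega>"
        have "\<bar>?a * ?b\<bar> \<le> ?a\<^sup>2 + ?b\<^sup>2"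
          using sum_squares_bound[of "\<bar>?a\<bar>" "\<bar>?b\<bar>"] mult_nonneg_nonneg[OF abs_ge_zero[of ?a] abs_ge_zero[of ?b]]
          unfolding abs_mult power2_abs mult.assoc by linarith
        then show "ennreal (norm (G (p, \<omega>))) \<le> ennreal (?a\<^sup>2) + ennreal (?b\<^sup>2)"
          by (simp add: G_def ennreal_leI flip: ennreal_plus)
      qed
      also have "\<dots> = (\<integral>\<^sup>+\<omega>. ennreal ((F (fst p) \<omega>)\<^sup>2) \<partial>M) + (\<integral>\<^sup>+\<omega>. ennreal ((F (snd p) \<omega>)\<^sup>2) \<partial>M)"
        using p by (intro nn_integral_add) auto
      also have "\<dots> \<le> ennreal A + ennreal A" by (intro add_mono A p)
      finally show "(\<integral>\<^sup>+\<omega>. ennreal (norm (G (p, \<omega>))) \<partial>M) \<le> ennreal A + ennreal A" .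
    qed
    also have "\<dots> < \<infinity>"
      by (simp add: space_pair_measure N.emeasure_pair_measure_Times less_top[symmetric]
          ennreal_mult_eq_top_iff N.emeasure_finite)
    finally show "(\<integral>\<^sup>+q. ennreal (norm (G q)) \<partial>((N \<Otimes>\<^sub>M N) \<Otimes>\<^sub>M M)) < \<infinity>" .
  qed measurable
  then have Gint: "integrable ((N \<Otimes>\<^sub>M N) \<Otimes>\<^sub>M M) (\<lambda>(p, \<omega>). G (p, \<omega>))" by simp
  \<comment> \<open>The product is integrable over pairs only for almost every \<omega>; for these
    the double integral factors.\<close>
  have AE: "AE \<omega> in M. (\<integral>p. G (p, \<omega>) \<partial>(N \<Otimes>\<^sub>M N)) = (\<integral>s. F s \<omega> \<partial>N)\<^sup>2"
    using NNM.AE_integrable_snd[OF Gint]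
  proof eventually_elim
    case (elim \<omega>)
    have "(\<integral>p. G (p, \<omega>) \<partial>(N \<Otimes>\<^sub>M N)) = (\<integral>s. (\<integral>s'. G ((s, s'), \<omega>) \<partial>N) \<partial>N)"
      by (rule NN.integral_fst'[symmetric]) (fact elim)
    also have "\<dots> = (\<integral>s. F s \<omega> * (\<integral>s'. F s' \<omega> \<partial>N) \<partial>N)" by (simp add: G_def)
    finally show ?case by (simp add: power2_eq_square)
  qed
  have Gint2: "integrable (N \<Otimes>\<^sub>M N) (\<lambda>p. \<integral>\<omega>. G (p, \<omega>) \<partial>M)"
    using NNM.integrable_fst[OF Gint] .
  have "(\<integral>\<^sup>+\<omega>. ennreal ((\<integral>s. F s \<omega> \<partial>N)\<^sup>2) \<partial>M) = (\<integral>\<^sup>+\<omega>. ennreal (\<integral>p. G (p, \<omega>) \<partial>(N \<Otimes>\<^sub>M N)) \<partial>M)"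
    by (rule nn_integral_cong_AE) (use AE in eventually_elim, simp)
  also have "\<dots> = ennreal (\<integral>\<omega>. (\<integral>p. G (p, \<omega>) \<partial>(N \<Otimes>\<^sub>M N)) \<partial>M)"
    by (rule nn_integral_eq_integral[OF NNM.integrable_snd[OF Gint]]) (use AE in eventually_elim, simp)
  also have "(\<integral>\<omega>. (\<integral>p. G (p, \<omega>) \<partial>(N \<Otimes>\<^sub>M N)) \<partial>M) = (\<integral>p. (\<integral>\<omega>. G (p, \<omega>) \<partial>M) \<partial>(N \<Otimes>\<^sub>M N))"
    using NNM.Fubini_integral[OF Gint] by simp
  also have "\<dots> = (\<integral>s. (\<integral>s'. (\<integral>\<omega>. G ((s, s'), \<omega>) \<partial>M) \<partial>N) \<partial>N)"
    by (rule NN.integral_fst'[symmetric, OF Gint2])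
  finally show ?thesis by (simp add: G_def)
qed

section \<open>Joint measurability and second moments of the noise\<close>

definition lower_grid :: "nat \<Rightarrow> real \<Rightarrow> real" where
  "lower_grid n x = real_of_int \<lfloor>real (Suc n) * x\<rfloor> / real (Suc n)"

lemma lower_grid_le: "lower_grid n x \<le> x"
  unfolding lower_grid_def by (simp add: divide_le_eq mult.commute)

lemma lower_grid_nonneg: "0 \<le> x \<Longrightarrow> 0 \<le> lower_grid n x"
  unfolding lower_grid_def by simp

lemma lower_grid_tendsto: "(\<lambda>n. lower_grid n x) \<longlonglongrightarrow> x"
proof (rule tendsto_sandwich)
  show "\<forall>\<^sub>F n in sequentially. x - 1 / real (Suc n) \<le> lower_grid n x"
  proof (intro always_eventually allI)
    fix n
    have "real (Suc n) * x - 1 \<le> real_of_int \<lfloor>real (Suc n) * x\<rfloor>" by linarith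
    then have "(real (Suc n) * x - 1) / real (Suc n) \<le> lower_grid n x"
      unfolding lower_grid_def by (intro divide_right_mono) auto
    then show "x - 1 / real (Suc n) \<le> lower_grid n x" by (simp add: diff_divide_distrib)
  qed
  show "\<forall>\<^sub>F n in sequentially. lower_grid n x \<le> x" by (simp add: lower_grid_le)
  show "(\<lambda>n. x - 1 / real (Suc n)) \<longlonglongrightarrow> x"
    using tendsto_diff[OF tendsto_const[of x] LIMSEQ_inverse_real_of_nat] by (simp add: inverse_eq_divide)
qed auto

text \<open>At each stage the rounded parameter takes countably many values, so measurability for
  every fixed q is enough.\<close>

lemma borel_measurable_grid_limit:
  fixes Z :: "real \<Rightarrow> 'b \<Rightarrow> real"
  assumes Z: "\<And>q. Z q \<in> borel_measurable N" and \<tau>[measurable]: "\<tau> \<in> borel_measurable N"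
    and lim: "\<And>b. b \<in> space N \<Longrightarrow> (\<lambda>n. Z (lower_grid n (\<tau> b)) b) \<longlonglongrightarrow> L b"
  shows "L \<in> borel_measurable N"
proof (rule borel_measurable_LIMSEQ_real)
  fix n
  have "(\<lambda>b. Z (real_of_int i / real (Suc n)) b) \<in> borel_measurable N" for i by (rule Z)
  moreover have "(\<lambda>b. \<lfloor>real (Suc n) * \<tau> b\<rfloor>) \<in> measurable N (count_space UNIV)" by measurable
  ultimately show "(\<lambda>b. Z (lower_grid n (\<tau> b)) b) \<in> borel_measurable N"
    unfolding lower_grid_def by (rule measurable_compose_countable)
qed (rule lim)

lemma integrable_square_gaussian_law:
  assumes "v \<ge> 0"
  shows "integrable (gaussian_law 0 v) (\<lambda>z. z\<^sup>2)"
proof (cases "v = 0")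
  case True
  then show ?thesis
    by (auto simp: gaussian_law_def nn_integral_return intro!: integrableI_bounded)
next
  case False
  then have "integrable lborel (\<lambda>z. normal_density 0 (sqrt v) z * (z - 0) ^ 2)"
    using assms by (intro integrable_normal_moment) auto
  then show ?thesis
    using False by (simp add: gaussian_law_def integrable_density)
qed

text \<open>The second moment is read off the increment over [0, s], as \<open>B 0\<close> vanishes
  almost surely.\<close>

lemma wiener_process_integrable_square:
  assumes B: "wiener_process M B" and "s \<ge> 0"
  shows "integrable M (\<lambda>\<omega>. (B s \<omega>)\<^sup>2)"
proof -
  have [measurable]: "B u \<in> borel_measurable M" if "u \<ge> 0" for u
    using B that by (auto simp: wiener_process_def)
  have B0: "AE \<omega> in M. B 0 \<omega> = 0" using B by (auto simp: wiener_process_def)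
  obtain q where q: "q \<ge> 0" "\<And>s t. 0 \<le> s \<Longrightarrow> s < t \<Longrightarrow>
      distr M borel (\<lambda>\<omega>. B t \<omega> - B s \<omega>) = gaussian_law 0 (q * (t - s))"
    using B by (auto simp: wiener_process_def)
  have "integrable M (\<lambda>\<omega>. (B s \<omega> - B 0 \<omega>)\<^sup>2)"
  proof (cases "s = 0")
    case False
    then have "integrable (distr M borel (\<lambda>\<omega>. B s \<omega> - B 0 \<omega>)) (\<lambda>z. z\<^sup>2)"
      using q(2)[of 0 s] q(1) \<open>s \<ge> 0\<close> by (simp add: integrable_square_gaussian_law)
    then show ?thesis using \<open>s \<ge> 0\<close> by (subst (asm) integrable_distr_eq) auto
  qed simp
  moreover have "integrable M (\<lambda>\<omega>. (B s \<omega>)\<^sup>2) \<longleftrightarrow> integrable M (\<lambda>\<omega>. (B s \<omega> - B 0 \<omega>)\<^sup>2)"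
    by (rule integrable_cong_AE) (use \<open>s \<ge> 0\<close> B0 in \<open>auto elim: eventually_mono\<close>)
  ultimately show ?thesis by simp
qed

lemma tempered_distributionD:
  assumes "tempered_distribution T" "\<And>n. F n \<in> schwartz" "f \<in> schwartz" "schwartz_tendsto F f"
  shows "(\<lambda>n. T (F n)) \<longlonglongrightarrow> T f"
  using assms unfolding tempered_distribution_def by blast

text \<open>Time is discretised twice: first in the process with a fixed test function, using
  continuity of paths, then in the test function, using continuity of the distribution
  \<open>W s \<omega>\<close>. Approximation from below keeps the grid times under t, where
  \<open>\<psi>\<close> is Schwartz.\<close>

lemma homogeneous_wiener_process_measurable:
  assumes W: "homogeneous_wiener_process M Q W"
    and \<psi>: "\<And>s. 0 \<le> s \<Longrightarrow> s < t \<Longrightarrow> \<psi> s \<in> schwartz"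
    and lim: "\<And>S s. S \<longlonglongrightarrow> s \<Longrightarrow> (\<And>n. 0 \<le> S n \<and> S n \<le> s) \<Longrightarrow> s < t \<Longrightarrow> schwartz_tendsto (\<lambda>n. \<psi> (S n)) (\<psi> s)"
  shows "(\<lambda>(s, \<omega>). if 0 \<le> s \<and> s < t then W s \<omega> (\<psi> s) else 0) \<in> borel_measurable (lborel \<Otimes>\<^sub>M M)"
proof -
  \<comment> \<open>\<open>max 0\<close> keeps all times in the half-line on which paths are
    continuous.\<close>
  have proc: "(\<lambda>(s, \<omega>). W (max 0 s) \<omega> \<phi>) \<in> borel_measurable (lborel \<Otimes>\<^sub>M M)" if \<phi>: "\<phi> \<in> schwartz" for \<phi>
  proof (rule borel_measurable_grid_limit[where Z="\<lambda>q (s, \<omega>). W (max 0 q) \<omega> \<phi>" and \<tau>=fst])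
    have [measurable]: "(\<lambda>\<omega>. W (max 0 q) \<omega> \<phi>) \<in> borel_measurable M" for q
      using W \<phi> by (auto simp: homogeneous_wiener_process_def gaussian_process_def)
    show "(\<lambda>(s, \<omega>). W (max 0 q) \<omega> \<phi>) \<in> borel_measurable (lborel \<Otimes>\<^sub>M M)" for q
      by (simp add: case_prod_unfold)
    fix b assume "b \<in> space ((lborel :: real measure) \<Otimes>\<^sub>M M)"
    then have "snd b \<in> space M" by (auto simp: space_pair_measure)
    then have c: "continuous_on {0..} (\<lambda>s. W s (snd b) \<phi>)"
      using W \<phi> by (auto simp: homogeneous_wiener_process_def)
    have "(\<lambda>n. W (max 0 (lower_grid n (fst b))) (snd b) \<phi>) \<longlonglongrightarrow> W (max 0 (fst b)) (snd b) \<phi>"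
      by (rule continuous_on_tendsto_compose[OF c]) (auto intro!: tendsto_intros lower_grid_tendsto)
    then show "(\<lambda>n. (\<lambda>(s, \<omega>). W (max 0 (lower_grid n (fst b))) \<omega> \<phi>) b) \<longlonglongrightarrow> (case b of (s, \<omega>) \<Rightarrow> W (max 0 s) \<omega> \<phi>)"
      by (simp add: case_prod_unfold)
  qed measurable
  show ?thesis
  proof (rule borel_measurable_grid_limit[where \<tau>=fst and
        Z="\<lambda>q (s, \<omega>). if 0 \<le> s \<and> s < t \<and> 0 \<le> q \<and> q < t then W (max 0 s) \<omega> (\<psi> q) else 0"])
    fix q
    show "(\<lambda>(s, \<omega>). if 0 \<le> s \<and> s < t \<and> 0 \<le> q \<and> q < t then W (max 0 s) \<omega> (\<psi> q) else 0) \<in> borel_measurable (lborel \<Otimes>\<^sub>M M)"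
    proof (cases "0 \<le> q \<and> q < t")
      case True
      then have [measurable]: "(\<lambda>p. W (max 0 (fst p)) (snd p) (\<psi> q)) \<in> borel_measurable (lborel \<Otimes>\<^sub>M M)"
        using proc[OF \<psi>[of q]] by (simp add: case_prod_unfold)
      show ?thesis unfolding case_prod_unfold by measurable
    next
      case False
      then have "(\<lambda>(s, \<omega>). if 0 \<le> s \<and> s < t \<and> 0 \<le> q \<and> q < t then W (max 0 s) \<omega> (\<psi> q) else 0) = (\<lambda>_. 0)"
        by (auto simp: fun_eq_iff)
      then show ?thesis by simp
    qed
  next
    fix b assume "b \<in> space ((lborel :: real measure) \<Otimes>\<^sub>M M)"
    obtain s \<omega> where b: "b = (s, \<omega>)" by (cases b)
    then have \<omega>: "\<omega> \<in> space M" using \<open>b \<in> _\<close> by (auto simp: space_pair_measure)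
    show "(\<lambda>n. (\<lambda>(s, \<omega>). if 0 \<le> s \<and> s < t \<and> 0 \<le> lower_grid n (fst b) \<and> lower_grid n (fst b) < t
          then W (max 0 s) \<omega> (\<psi> (lower_grid n (fst b))) else 0) b)
      \<longlonglongrightarrow> (case b of (s, \<omega>) \<Rightarrow> if 0 \<le> s \<and> s < t then W s \<omega> (\<psi> s) else 0)"
    proof (cases "0 \<le> s \<and> s < t")
      case True
      have g: "0 \<le> lower_grid n s \<and> lower_grid n s \<le> s" for n
        using True by (simp add: lower_grid_le lower_grid_nonneg)
      then have gt: "lower_grid n s < t" for n using True by (meson le_less_trans)
      have "tempered_distribution (W s \<omega>)"
        using W \<omega> True by (auto simp: homogeneous_wiener_process_def)
      moreover have "schwartz_tendsto (\<lambda>n. \<psi> (lower_grid n s)) (\<psi> s)"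
        using True g by (intro lim lower_grid_tendsto) auto
      moreover have "\<forall>n. \<psi> (lower_grid n s) \<in> schwartz" "\<psi> s \<in> schwartz" using \<psi> g gt True by auto
      ultimately have "(\<lambda>n. W s \<omega> (\<psi> (lower_grid n s))) \<longlonglongrightarrow> W s \<omega> (\<psi> s)"
        using tempered_distributionD[of "W s \<omega>" "\<lambda>n. \<psi> (lower_grid n s)"] by blast
      then show ?thesis using True g gt by (simp add: b max_def)
    next
      case False
      then show ?thesis by (auto simp: b)
    qed
  qed measurable
qed

lemma homogeneous_wiener_process_integrable_square:
  assumes W: "homogeneous_wiener_process M Q W" and "s \<ge> 0" "\<phi> \<in> schwartz"
  shows "integrable M (\<lambda>\<omega>. (W s \<omega> \<phi>)\<^sup>2)"
  using assms by (intro wiener_process_integrable_square) (auto simp: homogeneous_wiener_process_def)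

subsection \<open>The symbol of the Poisson kernel\<close>

text \<open>With q = |\<eta>|^2 this is g_r. At r = 0 division by zero gives the value 0, which is
  also the limit when x0 > 0 and q \<ge> 0.\<close>

definition poisson_symbol :: "real \<Rightarrow> real \<Rightarrow> real \<Rightarrow> real" where
  "poisson_symbol x0 r q = x0 / (r * sqrt (4 * pi * r)) * exp (- x0\<^sup>2 / (4 * r)) * exp (- r * q)"

text \<open>The last factor is the logarithmic derivative of the symbol in r.\<close>

definition poisson_symbol_deriv :: "real \<Rightarrow> real \<Rightarrow> real \<Rightarrow> real" where
  "poisson_symbol_deriv x0 r q = poisson_symbol x0 r q * (x0\<^sup>2 / (4 * r\<^sup>2) - 3 / (2 * r) - q)"

lemma poisson_symbol_has_derivative:
  assumes "r > 0"
  shows "((\<lambda>r. poisson_symbol x0 r q) has_real_derivative poisson_symbol_deriv x0 r q) (at r)"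
proof -
  have s: "sqrt (4 * pi * r) > 0" "sqrt (4 * pi * r) * sqrt (4 * pi * r) = 4 * pi * r" using assms by auto
  have "((\<lambda>r. r * sqrt (4 * pi * r)) has_real_derivative 3 / 2 * sqrt (4 * pi * r)) (at r)"
    by (rule DERIV_cong[OF DERIV_mult[OF DERIV_ident DERIV_chain'[OF _ DERIV_real_sqrt]]])
      (use assms s in \<open>auto intro!: derivative_eq_intros simp: field_simps\<close>)
  from DERIV_cdivide[OF DERIV_inverse_fun[OF this], of "1 / x0"]
  have 1: "((\<lambda>r. x0 / (r * sqrt (4 * pi * r))) has_real_derivative x0 / (r * sqrt (4 * pi * r)) * (- 3 / (2 * r))) (at r)"
    using assms s by (cases "x0 = 0") (auto simp: field_simps power2_eq_square elim!: DERIV_cong)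
  have 2: "((\<lambda>r. exp (- x0\<^sup>2 / (4 * r))) has_real_derivative exp (- x0\<^sup>2 / (4 * r)) * (x0\<^sup>2 / (4 * r\<^sup>2))) (at r)"
    using assms by (auto intro!: derivative_eq_intros simp: field_simps power2_eq_square)
  have 3: "((\<lambda>r. exp (- r * q)) has_real_derivative exp (- r * q) * (- q)) (at r)"
    by (auto intro!: derivative_eq_intros)
  have alg: "(A * u * B + B * v * A) * C + C * w * (A * B) = A * B * C * (v + u + w)" for A B C u v w :: real
    by (simp add: algebra_simps)
  show ?thesis
    unfolding poisson_symbol_def poisson_symbol_deriv_def
    by (rule DERIV_cong[OF DERIV_mult[OF DERIV_mult[OF 1 2] 3]], rule trans[OF alg]) simp
qed

lemma poisson_symbol_square:
  assumes "r > 0"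
  shows "(poisson_symbol x0 r q)\<^sup>2 = x0\<^sup>2 / (4 * pi) * ((1 / r) ^ 3 * exp (- (x0\<^sup>2 / 2) * (1 / r))) * exp (- 2 * r * q)"
proof -
  have "(exp (- x0\<^sup>2 / (4 * r)))\<^sup>2 = exp (- (x0\<^sup>2 / 2) * (1 / r))" "(exp (- r * q))\<^sup>2 = exp (- 2 * r * q)"
    by (simp_all flip: exp_double)
  then have "(poisson_symbol x0 r q)\<^sup>2 = (x0 / (r * sqrt (4 * pi * r)))\<^sup>2 * exp (- (x0\<^sup>2 / 2) * (1 / r)) * exp (- 2 * r * q)"
    unfolding poisson_symbol_def power_mult_distrib by (simp only:)
  also have "(x0 / (r * sqrt (4 * pi * r)))\<^sup>2 = x0\<^sup>2 / (4 * pi) * (1 / r) ^ 3"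
    using assms by (simp add: power_divide power_mult_distrib power3_eq_cube power2_eq_square)
  finally show ?thesis by (simp only: mult.assoc)
qed

text \<open>The factor exp (- c / r) absorbs any power of 1 / r, by u^n \<le> n! exp u at u = c /
  r.\<close>

lemma inverse_power_exp_le:
  fixes c r :: real
  assumes "c > 0" "r > 0"
  shows "(1 / r) ^ n * exp (- c * (1 / r)) \<le> fact n / c ^ n"
proof -
  have "(c * (1 / r)) ^ n \<le> fact n * exp (c * (1 / r))"
    using assms by (intro power_le_fact_exp) simp
  then have "c ^ n * (1 / r) ^ n * exp (- c * (1 / r)) \<le> fact n * exp (c * (1 / r)) * exp (- c * (1 / r))"
    unfolding power_mult_distrib by (intro mult_right_mono) auto
  also have "\<dots> = fact n" by (simp add: mult.assoc flip: exp_add)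
  finally show ?thesis using assms by (simp add: field_simps)
qed

text \<open>Only r = 0 needs an argument: in the squared symbol 1 / r^3 is written as r^2 / r^5, and
  absorbing the fifth power leaves a bound of order r for the symbol.\<close>

lemma continuous_on_poisson_symbol:
  assumes "x0 > 0" "q \<ge> 0"
  shows "continuous_on {0..} (\<lambda>r. poisson_symbol x0 r q)"
proof -
  define c where "c = x0\<^sup>2 / 2"
  have c: "c > 0" using assms by (simp add: c_def)
  define A where "A = x0\<^sup>2 / (4 * pi) * (fact 5 / c ^ 5)"
  have bound: "\<bar>poisson_symbol x0 r q\<bar> \<le> sqrt A * r" if r: "r \<ge> 0" for r
  proof (cases "r = 0")
    case False
    with r have r: "r > 0" by simp
    have "(1 / r) ^ 3 * exp (- c * (1 / r)) = r\<^sup>2 * ((1 / r) ^ 5 * exp (- c * (1 / r)))"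
      using r by (simp add: field_simps eval_nat_numeral)
    also have "\<dots> \<le> r\<^sup>2 * (fact 5 / c ^ 5)"
      by (intro mult_left_mono inverse_power_exp_le c r) simp
    finally have "x0\<^sup>2 / (4 * pi) * ((1 / r) ^ 3 * exp (- c * (1 / r))) \<le> x0\<^sup>2 / (4 * pi) * (r\<^sup>2 * (fact 5 / c ^ 5))"
      by (intro mult_left_mono) auto
    also have "\<dots> = A * r\<^sup>2" by (simp add: A_def)
    finally have "x0\<^sup>2 / (4 * pi) * ((1 / r) ^ 3 * exp (- c * (1 / r))) * exp (- 2 * r * q) \<le> A * r\<^sup>2 * 1"
      by (rule mult_mono) (use r assms c in \<open>auto simp: A_def\<close>)
    then have "(poisson_symbol x0 r q)\<^sup>2 \<le> A * r\<^sup>2"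
      using poisson_symbol_square[OF r, of x0 q] by (simp add: c_def)
    then have "sqrt ((poisson_symbol x0 r q)\<^sup>2) \<le> sqrt (A * r\<^sup>2)" by (rule real_sqrt_le_mono)
    then show ?thesis using r by (simp add: real_sqrt_mult)
  qed (simp add: poisson_symbol_def)
  show ?thesis
    unfolding continuous_on_def
  proof
    fix r :: real assume r: "r \<in> {0..}"
    show "((\<lambda>r. poisson_symbol x0 r q) \<longlongrightarrow> poisson_symbol x0 r q) (at r within {0..})"
    proof (cases "r = 0")
      case True
      have "((\<lambda>r. poisson_symbol x0 r q) \<longlongrightarrow> 0) (at 0 within {0..})"
      proof (rule Lim_null_comparison)
        show "\<forall>\<^sub>F r in at 0 within {0..}. norm (poisson_symbol x0 r q) \<le> sqrt A * r"
          using bound by (auto simp: eventually_at_filter)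
        show "((\<lambda>r. sqrt A * r) \<longlongrightarrow> 0) (at 0 within {0..})"
          by (auto intro!: tendsto_eq_intros)
      qed
      then show ?thesis using True by (simp add: poisson_symbol_def)
    next
      case False
      then have "isCont (\<lambda>r. poisson_symbol x0 r q) r"
        using poisson_symbol_has_derivative[of r x0 q] r by (auto intro: DERIV_isCont)
      then show ?thesis unfolding isCont_def by (rule tendsto_within_subset) simp
    qed
  qed
qed

section \<open>Time integrals of the squared symbol\<close>

lemma nn_integral_reversed_FTC:
  fixes E e :: "real \<Rightarrow> real"
  assumes "0 \<le> t" "continuous_on {0..t} E"
    and "\<And>r. 0 < r \<Longrightarrow> r < t \<Longrightarrow> (E has_real_derivative e r) (at r)"
    and "\<And>r. 0 \<le> r \<Longrightarrow> r \<le> t \<Longrightarrow> 0 \<le> e r"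
  shows "(\<integral>\<^sup>+s. ennreal (e (t - s)) * indicator {0..t} s \<partial>lborel) = ennreal (E t - E 0)"
proof -
  have "((\<lambda>s. e (t - s)) has_integral (- E (t - t)) - (- E (t - 0))) {0..t}"
  proof (rule fundamental_theorem_of_calculus_interior)
    show "continuous_on {0..t} (\<lambda>s. - E (t - s))"
      by (intro continuous_intros continuous_on_compose2[OF assms(2)]) auto
    show "((\<lambda>s. - E (t - s)) has_vector_derivative e (t - s)) (at s)" if "s \<in> {0<..<t}" for s
    proof -
      have "((\<lambda>s. t - s) has_real_derivative - 1) (at s)" by (auto intro!: derivative_eq_intros)
      from DERIV_chain'[OF this assms(3)[of "t - s"]] that
      have "((\<lambda>s. E (t - s)) has_real_derivative - e (t - s)) (at s)" by simp
      from DERIV_minus[OF this] show ?thesis by (simp add: has_real_derivative_iff_has_vector_derivative)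
    qed
  qed fact
  then have "((\<lambda>s. e (t - s)) has_integral (E t - E 0)) {0..t}" by simp
  then show ?thesis by (intro nn_integral_has_integral_lebesgue') (use assms(4) in auto)
qed

text \<open>The factor exp (- 2 r q) is dropped. Half of the exponent in exp (- x0^2 / (2 r)) pays
  for one power of 1 / r; what remains, (1 / r)^2 exp (- d / r), is up to a constant an exact
  derivative.\<close>

lemma nn_integral_poisson_symbol_square_le:
  assumes x0: "x0 > 0" and q: "q \<ge> 0" and t: "t > 0"
  shows "(\<integral>\<^sup>+s. ennreal ((poisson_symbol x0 (t - s) q)\<^sup>2) * indicator {0..<t} s \<partial>lborel) \<le> ennreal (2 / x0\<^sup>2)"
proof -
  define d where "d = x0\<^sup>2 / 4"
  have d: "d > 0" using x0 by (simp add: d_def)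
  \<comment> \<open>An antiderivative of \<open>e\<close>, continuous at 0 with value 0. For r \<ge>
    0 it is at most 4 / (pi x0^2), and 4 / pi \<le> 2.\<close>
  define E where "E = (\<lambda>r. if r = 0 then 0 else 4 / (pi * x0\<^sup>2) * exp (- d * (1 / r)))"
  define e where "e = (\<lambda>r. 1 / pi * ((1 / r)\<^sup>2 * exp (- d * (1 / r))))"
  have "(\<integral>\<^sup>+s. ennreal ((poisson_symbol x0 (t - s) q)\<^sup>2) * indicator {0..<t} s \<partial>lborel)
      \<le> (\<integral>\<^sup>+s. ennreal (e (t - s)) * indicator {0..t} s \<partial>lborel)"
  proof (rule nn_integral_mono)
    fix s
    show "ennreal ((poisson_symbol x0 (t - s) q)\<^sup>2) * indicator {0..<t} s \<le> ennreal (e (t - s)) * indicator {0..t} s"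
    proof (cases "0 \<le> s \<and> s < t")
      case True
      define r where "r = t - s"
      have r: "r > 0" using True by (simp add: r_def)
      have "(1 / r) ^ 3 * exp (- (x0\<^sup>2 / 2) * (1 / r)) = (1 / r)\<^sup>2 * (1 / r * exp (- (x0\<^sup>2 / 2) * (1 / r)))"
        by (simp add: power3_eq_cube power2_eq_square)
      also have "\<dots> \<le> (1 / r)\<^sup>2 * (2 / (x0\<^sup>2 / 2) * exp (- ((x0\<^sup>2 / 2) / 2) * (1 / r)))"
        using x0 r by (intro mult_left_mono mult_exp_minus_le) auto
      finally have "x0\<^sup>2 / (4 * pi) * ((1 / r) ^ 3 * exp (- (x0\<^sup>2 / 2) * (1 / r)))
          \<le> x0\<^sup>2 / (4 * pi) * ((1 / r)\<^sup>2 * (2 / (x0\<^sup>2 / 2) * exp (- ((x0\<^sup>2 / 2) / 2) * (1 / r))))"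
        by (intro mult_left_mono) auto
      also have "\<dots> = e r" using x0 by (simp add: e_def d_def)
      finally have "x0\<^sup>2 / (4 * pi) * ((1 / r) ^ 3 * exp (- (x0\<^sup>2 / 2) * (1 / r))) * exp (- 2 * r * q) \<le> e r * 1"
        using r q by (intro mult_mono) (auto simp: e_def)
      then have "(poisson_symbol x0 r q)\<^sup>2 \<le> e r" unfolding poisson_symbol_square[OF r] by simp
      then show ?thesis using True by (simp add: r_def ennreal_leI)
    qed auto
  qed
  also have "\<dots> = ennreal (E t - E 0)"
  proof (rule nn_integral_reversed_FTC)
    show "continuous_on {0..t} E"
      unfolding continuous_on_def
    proof
      fix r assume r: "r \<in> {0..t}"
      show "(E \<longlongrightarrow> E r) (at r within {0..t})"
      proof (cases "r = 0")
        case True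
        have "(E \<longlongrightarrow> 0) (at 0 within {0..t})"
        proof (rule Lim_null_comparison)
          have "norm (E r) \<le> 4 / (pi * x0\<^sup>2) * (r / d)" if "r > 0" for r
          proof -
            have "1 / r * exp (- d * (1 / r)) \<le> 1 / d"
              using inverse_power_exp_le[OF d that, of 1] by simp
            then have "exp (- d * (1 / r)) \<le> r / d" using that by (simp add: field_simps)
            then have "4 / (pi * x0\<^sup>2) * exp (- d * (1 / r)) \<le> 4 / (pi * x0\<^sup>2) * (r / d)"
              by (intro mult_left_mono) auto
            then show ?thesis using that by (simp add: E_def)
          qed
          then show "\<forall>\<^sub>F r in at 0 within {0..t}. norm (E r) \<le> 4 / (pi * x0\<^sup>2) * (r / d)"
            by (auto simp: eventually_at_filter)
          show "((\<lambda>r. 4 / (pi * x0\<^sup>2) * (r / d)) \<longlongrightarrow> 0) (at 0 within {0..t})"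
            using d x0 by (auto intro!: tendsto_eq_intros)
        qed
        then show ?thesis using True by (simp add: E_def)
      next
        case False
        have "((\<lambda>r. 4 / (pi * x0\<^sup>2) * exp (- d * (1 / r))) \<longlongrightarrow> 4 / (pi * x0\<^sup>2) * exp (- d * (1 / r))) (at r within {0..t})"
          by (intro tendsto_intros) (use False in auto)
        moreover have "\<forall>\<^sub>F u in at r within {0..t}. 4 / (pi * x0\<^sup>2) * exp (- d * (1 / u)) = E u"
          using eventually_neq_at_within[of 0 r "{0..t}"] by eventually_elim (simp add: E_def)
        ultimately show ?thesis using False by (auto simp: E_def elim: Lim_transform_eventually)
      qed
    qed
    show "(E has_real_derivative e r) (at r)" if "0 < r" for r
    proof -
      have "((\<lambda>r. 4 / (pi * x0\<^sup>2) * exp (- d * (1 / r))) has_real_derivative e r) (at r)"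
        using that x0 by (auto intro!: derivative_eq_intros simp: e_def d_def field_simps power2_eq_square)
      then show ?thesis
        by (rule has_field_derivative_transform_within_open[OF _ open_greaterThan[of 0]]) (use that in \<open>auto simp: E_def\<close>)
    qed
  qed (use t in \<open>auto simp: e_def\<close>)
  also have "E t - E 0 \<le> 2 / x0\<^sup>2"
  proof -
    have "4 / (pi * x0\<^sup>2) * exp (- d * (1 / t)) \<le> 4 / (pi * x0\<^sup>2) * 1"
      using d t by (intro mult_left_mono) auto
    also have "\<dots> \<le> 2 / x0\<^sup>2" using pi_gt3 x0 by (simp add: field_simps)
    finally show ?thesis using t by (simp add: E_def)
  qed
  finally show ?thesis by (simp add: ennreal_leI)
qed

text \<open>Here all powers of 1 / r are absorbed, at the price 3! / (x0^2 / 2)^3, and it is exp (-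
  2 r q) that is integrated. This gives 6 / (pi x0^4 q), and pi > 3.\<close>

lemma nn_integral_poisson_symbol_square_le':
  assumes x0: "x0 > 0" and q: "q > 0" and t: "t > 0"
  shows "(\<integral>\<^sup>+s. ennreal ((poisson_symbol x0 (t - s) q)\<^sup>2) * indicator {0..<t} s \<partial>lborel) \<le> ennreal (2 / (x0 ^ 4 * q))"
proof -
  define E where "E = (\<lambda>r. - (6 / (pi * x0 ^ 4 * q) * exp (- 2 * r * q)))"
  define e where "e = (\<lambda>r. 12 / (pi * x0 ^ 4) * exp (- 2 * r * q))"
  have "(\<integral>\<^sup>+s. ennreal ((poisson_symbol x0 (t - s) q)\<^sup>2) * indicator {0..<t} s \<partial>lborel)
      \<le> (\<integral>\<^sup>+s. ennreal (e (t - s)) * indicator {0..t} s \<partial>lborel)"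
  proof (rule nn_integral_mono)
    fix s
    show "ennreal ((poisson_symbol x0 (t - s) q)\<^sup>2) * indicator {0..<t} s \<le> ennreal (e (t - s)) * indicator {0..t} s"
    proof (cases "0 \<le> s \<and> s < t")
      case True
      define r where "r = t - s"
      have r: "r > 0" using True by (simp add: r_def)
      have "(1 / r) ^ 3 * exp (- (x0\<^sup>2 / 2) * (1 / r)) \<le> fact 3 / (x0\<^sup>2 / 2) ^ 3"
        using x0 r by (intro inverse_power_exp_le) auto
      then have "x0\<^sup>2 / (4 * pi) * ((1 / r) ^ 3 * exp (- (x0\<^sup>2 / 2) * (1 / r))) \<le> x0\<^sup>2 / (4 * pi) * (fact 3 / (x0\<^sup>2 / 2) ^ 3)"
        by (intro mult_left_mono) auto
      also have "\<dots> = 12 / (pi * x0 ^ 4)" using x0 by (simp add: fact_numeral field_simps eval_nat_numeral)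
      finally have "(poisson_symbol x0 r q)\<^sup>2 \<le> e r"
        unfolding poisson_symbol_square[OF r] e_def by (rule mult_right_mono) simp
      then show ?thesis using True by (simp add: r_def ennreal_leI)
    qed auto
  qed
  also have "\<dots> = ennreal (E t - E 0)"
  proof (rule nn_integral_reversed_FTC)
    show "continuous_on {0..t} E" unfolding E_def by (intro continuous_intros)
    show "(E has_real_derivative e r) (at r)" for r
      unfolding E_def e_def using q x0 by (auto intro!: derivative_eq_intros simp: field_simps)
  qed (use t x0 in \<open>auto simp: e_def\<close>)
  also have "E t - E 0 \<le> 2 / (x0 ^ 4 * q)"
  proof -
    have "E t - E 0 \<le> 6 / (pi * x0 ^ 4 * q)" using q x0 by (simp add: E_def)
    also have "\<dots> \<le> 2 / (x0 ^ 4 * q)" using pi_gt3 x0 q by (simp add: field_simps)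
    finally show ?thesis .
  qed
  finally show ?thesis by (simp add: ennreal_leI)
qed

text \<open>This provides domination, uniformly down to r = 0. High frequencies are controlled by
  exp (- r q), which weakens as r tends to 0; the powers of 1 / r lost in this way are recovered
  from exp (- x0^2 / (4 r)).\<close>

lemma poisson_symbol_deriv_bound:
  assumes x0: "x0 > 0" and t: "t > 0"
  shows "\<exists>C\<ge>0. \<forall>r q. 0 < r \<longrightarrow> r \<le> t \<longrightarrow> 0 \<le> q \<longrightarrow> \<bar>poisson_symbol_deriv x0 r q\<bar> \<le> C / (1 + q) ^ p"
proof -
  define c where "c = x0\<^sup>2 / 4"
  have c: "c > 0" using x0 by (simp add: c_def)
  \<comment> \<open>The number of factors 1 + 1 / r to absorb: two from the prefactor, two from the
    bracket, and p + 1 from exchanging exp (- r q) for powers of 1 + q.\<close>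
  define N where "N = p + 5"
  define D where "D = c + 3 / 2 + 1"
  have D: "D > 0" using c by (simp add: D_def)
  define C where "C = x0 * D * (1 + t) ^ (p + 1) * (fact (p + 1) * exp 1) * (fact N * exp c / c ^ N)"
  have C: "C \<ge> 0" using x0 D c t by (simp add: C_def)
  have "\<bar>poisson_symbol_deriv x0 r q\<bar> \<le> C / (1 + q) ^ p" if r: "0 < r" "r \<le> t" and q: "0 \<le> q" for r q
  proof -
    define w where "w = 1 / r"
    have w: "w > 0" using r by (simp add: w_def)
    have a: "x0 / (r * sqrt (4 * pi * r)) \<le> x0 * (1 + w)\<^sup>2"
    proof -
      have "1 / sqrt (4 * pi * r) \<le> 1 + w"
      proof -
        have "r \<le> 4 * pi * r" using r pi_gt3 by simp
        then have "1 / sqrt (4 * pi * r) \<le> 1 / sqrt r" using r by (intro divide_left_mono) (auto intro: real_sqrt_le_mono)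
        also have "\<dots> = sqrt w" by (simp add: w_def real_sqrt_divide)
        also have "\<dots> \<le> 1 + w"
          using w by (intro real_le_lsqrt) (auto simp: power2_eq_square algebra_simps)
        finally show ?thesis .
      qed
      then have "w * (1 / sqrt (4 * pi * r)) \<le> (1 + w) * (1 + w)" using w r by (intro mult_mono) auto
      then have "x0 * (w * (1 / sqrt (4 * pi * r))) \<le> x0 * ((1 + w) * (1 + w))"
        by (rule mult_left_mono) (use x0 in simp)
      then show ?thesis by (simp add: w_def power2_eq_square)
    qed
    have b: "\<bar>x0\<^sup>2 / (4 * r\<^sup>2) - 3 / (2 * r) - q\<bar> \<le> D * (1 + w)\<^sup>2 * (1 + q)"
    proof -
      have "\<bar>x0\<^sup>2 / (4 * r\<^sup>2) - 3 / (2 * r) - q\<bar> \<le> c * w\<^sup>2 + 3 / 2 * w + q"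
        using r q c w by (auto simp: w_def c_def power_divide abs_le_iff)
      also have "\<dots> \<le> c * ((1 + w)\<^sup>2 * (1 + q)) + 3 / 2 * ((1 + w)\<^sup>2 * (1 + q)) + 1 * ((1 + w)\<^sup>2 * (1 + q))"
      proof -
        have "1 * (1 + q) \<le> (1 + w)\<^sup>2 * (1 + q)" "(1 + w)\<^sup>2 * 1 \<le> (1 + w)\<^sup>2 * (1 + q)"
          using w q by (auto intro!: mult_right_mono simp: power2_eq_square algebra_simps)
        moreover have "w\<^sup>2 \<le> (1 + w)\<^sup>2" "w \<le> (1 + w)\<^sup>2" using w by (auto simp: power2_eq_square algebra_simps)
        ultimately show ?thesis using c by (intro add_mono mult_left_mono) auto
      qed
      also have "\<dots> = D * ((1 + w)\<^sup>2 * (1 + q))" unfolding D_def by (simp only: distrib_right)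
      finally show ?thesis by (simp only: mult.assoc)
    qed
    \<comment> \<open>One power of 1 + q beyond p pays for the q inside the bracket.\<close>
    have e: "(1 + q) ^ (p + 1) * exp (- r * q) \<le> ((1 + t) * (1 + w)) ^ (p + 1) * (fact (p + 1) * exp 1)"
    proof -
      \<comment> \<open>Writing 1 + q = w (r + r q) trades q for r q at the cost of one factor 1 +
        w.\<close>
      have "1 + q \<le> ((1 + t) * (1 + w)) * (1 + r * q)"
      proof -
        have "1 + q = w * (r + r * q)" using r by (simp add: w_def field_simps)
        also have "\<dots> \<le> (1 + w) * ((1 + t) * (1 + r * q))"
        proof (intro mult_mono)
          have "0 \<le> t * (r * q)" using t r q by simp
          then show "r + r * q \<le> (1 + t) * (1 + r * q)" using r by (simp add: algebra_simps)
        qed (use w r q in auto)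
        finally show ?thesis by (simp only: mult_ac)
      qed
      then have "(1 + q) ^ (p + 1) \<le> ((1 + t) * (1 + w) * (1 + r * q)) ^ (p + 1)"
        using q by (intro power_mono) auto
      also have "\<dots> = ((1 + t) * (1 + w)) ^ (p + 1) * (1 + r * q) ^ (p + 1)" by (rule power_mult_distrib)
      also have "\<dots> \<le> ((1 + t) * (1 + w)) ^ (p + 1) * (fact (p + 1) * exp (1 + r * q))"
        using t w r q by (intro mult_left_mono power_le_fact_exp) auto
      finally have "(1 + q) ^ (p + 1) * exp (- r * q)
          \<le> ((1 + t) * (1 + w)) ^ (p + 1) * (fact (p + 1) * exp (1 + r * q)) * exp (- r * q)"
        by (rule mult_right_mono) simp
      also have "\<dots> = ((1 + t) * (1 + w)) ^ (p + 1) * (fact (p + 1) * exp 1)"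
        by (simp add: exp_add exp_minus)
      finally show ?thesis .
    qed
    have f: "(1 + w) ^ N * exp (- c * w) \<le> fact N * exp c / c ^ N"
    proof -
      have "(c * (1 + w)) ^ N \<le> fact N * exp (c * (1 + w))" using c w by (intro power_le_fact_exp) auto
      then have "c ^ N * (1 + w) ^ N * exp (- c * w) \<le> fact N * exp (c * (1 + w)) * exp (- c * w)"
        unfolding power_mult_distrib by (rule mult_right_mono) simp
      also have "\<dots> = fact N * exp c" by (simp add: distrib_left exp_add exp_minus)
      finally show ?thesis using c by (simp add: field_simps)
    qed
    have "(1 + q) ^ p * \<bar>poisson_symbol_deriv x0 r q\<bar>
        = (1 + q) ^ p * (x0 / (r * sqrt (4 * pi * r)) * exp (- c * w) * exp (- r * q) * \<bar>x0\<^sup>2 / (4 * r\<^sup>2) - 3 / (2 * r) - q\<bar>)"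
      using x0 r by (simp add: poisson_symbol_deriv_def poisson_symbol_def abs_mult c_def w_def)
    also have "\<dots> \<le> (1 + q) ^ p * (x0 * (1 + w)\<^sup>2 * exp (- c * w) * exp (- r * q) * (D * (1 + w)\<^sup>2 * (1 + q)))"
      using q x0 by (intro mult_left_mono mult_mono a b) auto
    also have "\<dots> = x0 * D * (1 + w) ^ 4 * exp (- c * w) * ((1 + q) ^ (p + 1) * exp (- r * q))"
      by (simp add: eval_nat_numeral mult_ac)
    also have "\<dots> \<le> x0 * D * (1 + w) ^ 4 * exp (- c * w) * (((1 + t) * (1 + w)) ^ (p + 1) * (fact (p + 1) * exp 1))"
      using x0 D w by (intro mult_left_mono e) auto
    also have "\<dots> = x0 * D * (1 + t) ^ (p + 1) * (fact (p + 1) * exp 1) * ((1 + w) ^ N * exp (- c * w))"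
      by (simp add: N_def power_mult_distrib power_add eval_nat_numeral mult_ac del: fact_Suc)
    also have "\<dots> \<le> C" unfolding C_def using x0 D t by (intro mult_left_mono f) auto
    finally show ?thesis using q by (simp add: field_simps)
  qed
  with C show ?thesis by blast
qed

lemma poisson_symbol_deriv_measurable [measurable]:
  assumes [measurable]: "f \<in> borel_measurable M" "g \<in> borel_measurable M"
  shows "(\<lambda>x. poisson_symbol_deriv x0 (f x) (g x)) \<in> borel_measurable M"
  unfolding poisson_symbol_deriv_def poisson_symbol_def by measurable

lemma poisson_symbol_measurable [measurable]:
  assumes [measurable]: "f \<in> borel_measurable M" "g \<in> borel_measurable M"
  shows "(\<lambda>x. poisson_symbol x0 (f x) (g x)) \<in> borel_measurable M"
  unfolding poisson_symbol_def by measurable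

text \<open>Fundamental theorem of calculus; the end s = t contributes nothing, since the symbol
  vanishes at r = 0. Integrability is the case p = 0 of the uniform bound.\<close>

lemma integral_poisson_symbol_deriv:
  assumes x0: "x0 > 0" and q: "q \<ge> 0" and \<sigma>: "0 \<le> \<sigma>" "\<sigma> < t"
  shows "(LBINT s:{\<sigma>..t}. poisson_symbol_deriv x0 (t - s) q) = poisson_symbol x0 (t - \<sigma>) q"
proof -
  obtain C where C: "C \<ge> 0" "\<And>r. 0 < r \<Longrightarrow> r \<le> t \<Longrightarrow> \<bar>poisson_symbol_deriv x0 r q\<bar> \<le> C"
    using poisson_symbol_deriv_bound[OF x0, of t 0] q \<sigma> by auto
  have z: "poisson_symbol_deriv x0 0 q = 0" "poisson_symbol x0 0 q = 0"
    by (simp_all add: poisson_symbol_deriv_def poisson_symbol_def)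
  have int: "set_integrable lborel {\<sigma>..t} (\<lambda>s. poisson_symbol_deriv x0 (t - s) q)"
    unfolding set_integrable_def
  proof (rule Bochner_Integration.integrable_bound)
    show "integrable lborel (\<lambda>s. indicator {\<sigma>..t} s *\<^sub>R C)"
      by (rule borel_integrable_compact) auto
    show "AE s in lborel. norm (indicator {\<sigma>..t} s *\<^sub>R poisson_symbol_deriv x0 (t - s) q) \<le> norm (indicator {\<sigma>..t} s *\<^sub>R C)"
    proof (intro always_eventually allI)
      fix s
      have "\<bar>poisson_symbol_deriv x0 (t - s) q\<bar> \<le> C" if "\<sigma> \<le> s" "s \<le> t"
        using C(2)[of "t - s"] C(1) z that \<sigma> by (cases "s = t") auto
      then show "norm (indicator {\<sigma>..t} s *\<^sub>R poisson_symbol_deriv x0 (t - s) q) \<le> norm (indicator {\<sigma>..t} s *\<^sub>R C)"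
        using C(1) by (auto simp: indicator_def)
    qed
  qed measurable
  have "((\<lambda>s. poisson_symbol_deriv x0 (t - s) q) has_integral
      (- poisson_symbol x0 (t - t) q) - (- poisson_symbol x0 (t - \<sigma>) q)) {\<sigma>..t}"
  proof (rule fundamental_theorem_of_calculus_interior)
    show "continuous_on {\<sigma>..t} (\<lambda>s. - poisson_symbol x0 (t - s) q)"
      by (intro continuous_intros continuous_on_compose2[OF continuous_on_poisson_symbol[OF x0 q]]) auto
    show "((\<lambda>s. - poisson_symbol x0 (t - s) q) has_vector_derivative poisson_symbol_deriv x0 (t - s) q) (at s)"
      if "s \<in> {\<sigma><..<t}" for s
    proof -
      have "((\<lambda>s. t - s) has_real_derivative - 1) (at s)" by (auto intro!: derivative_eq_intros)
      from DERIV_chain'[OF this poisson_symbol_has_derivative[of "t - s" x0 q]] that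
      have "((\<lambda>s. poisson_symbol x0 (t - s) q) has_real_derivative - poisson_symbol_deriv x0 (t - s) q) (at s)" by simp
      from DERIV_minus[OF this] show ?thesis by (simp add: has_real_derivative_iff_has_vector_derivative)
    qed
  qed (use \<sigma> in auto)
  then have "integral {\<sigma>..t} (\<lambda>s. poisson_symbol_deriv x0 (t - s) q) = poisson_symbol x0 (t - \<sigma>) q"
    by (simp add: z integral_unique)
  with set_borel_integral_eq_integral(2)[OF int] show ?thesis by simp
qed

subsection \<open>Covariance of the boundary kernels\<close>

text \<open>The boundary kernel in the parameter a = 1 / (4 r), in which it is a Gaussian family.
  Then pi / a is 4 pi r, and its power is the normalisation in dimension m + 1.\<close>

definition boundary_family :: "real \<times> (real ^ 'm) \<Rightarrow> real \<Rightarrow> real ^ 'm \<Rightarrow> real" where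
  "boundary_family x a y =
    fst x * (4 * a) * (pi / a) powr (- ((1 + real CARD('m)) / 2)) * exp (- a * (fst x)\<^sup>2)
    * (4 * a\<^sup>2 * ((fst x)\<^sup>2 + (norm (y - snd x))\<^sup>2) - 2 * a * (real CARD('m) + 3)) * exp (- a * (norm (y - snd x))\<^sup>2)"

lemma boundary_kernel_eq_family:
  fixes G :: "real \<Rightarrow> real \<times> (real ^ 'm) \<Rightarrow> real \<times> (real ^ 'm) \<Rightarrow> real"
  assumes G: "dirichlet_heat_kernel half_space G" and r: "r > 0" and x: "x \<in> half_space"
  shows "boundary_kernel G r x = boundary_family x (1 / (4 * r))"
proof
  fix y
  have n: "(norm (x - (0, y)))\<^sup>2 = (fst x)\<^sup>2 + (norm (y - snd x))\<^sup>2"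
    by (simp add: norm_prod_def norm_minus_commute)
  have h: "heat_kernel r (x - (0, y)) = (4 * pi * r) powr (- ((1 + real CARD('m)) / 2))
      * (exp (- (1 / (4 * r)) * (fst x)\<^sup>2) * exp (- (1 / (4 * r)) * (norm (y - snd x))\<^sup>2))"
    using r unfolding heat_kernel_def n by (simp add: field_simps flip: exp_add)
  have alg: "u / r * (N / d - k / e) * (P * (e1 * e2)) = u * (1 / r) * P * e1 * (1 / d * N - 1 / e * k) * e2"
    for u N d k e P e1 e2 :: real
    by (simp add: divide_inverse mult_ac)
  have "pi / (1 / (4 * r)) = 4 * pi * r" using r by simp
  moreover have "4 * (1 / (4 * r)) = 1 / r" "4 * (1 / (4 * r))\<^sup>2 = 1 / (4 * r\<^sup>2)"
    "2 * (1 / (4 * r)) = 1 / (2 * r)"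
    using r by (simp_all add: power2_eq_square)
  ultimately show "boundary_kernel G r x y = boundary_family x (1 / (4 * r)) y"
    unfolding boundary_family_def boundary_kernel_eq[OF G r x] n h by (simp only: alg)
qed

lemma real_polynomial_function_norm2_diff: "real_polynomial_function (\<lambda>y::'a::euclidean_space. (norm (y - c))\<^sup>2)"
proof -
  have "(\<lambda>y. (norm (y - c))\<^sup>2) = (\<lambda>y. \<Sum>b\<in>Basis. ((y - c) \<bullet> b) * ((y - c) \<bullet> b))"
    unfolding power2_norm_eq_inner by (rule ext, rule euclidean_inner)
  then show ?thesis
    by (auto intro!: real_polynomial_function_sum real_polynomial_function.intros(4) real_polynomial_function_inner_diff)
qed

lemma gauss_family_boundary: "gauss_family (snd x) (boundary_family (x :: real \<times> (real ^ 'm)))"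
proof -
  define k where "k = (\<lambda>a. fst x * (4 * a) * (pi / a) powr (- ((1 + real CARD('m)) / 2)) * exp (- a * (fst x)\<^sup>2))"
  have k: "continuous_on {0<..} k" unfolding k_def by (intro continuous_intros) auto
  have "boundary_family x = (\<lambda>a y.
      (k a * (4 * a\<^sup>2 * (fst x)\<^sup>2 - 2 * a * (real CARD('m) + 3))) * (1 * exp (- a * (norm (y - snd x))\<^sup>2))
      + (k a * (4 * a\<^sup>2)) * ((norm (y - snd x))\<^sup>2 * exp (- a * (norm (y - snd x))\<^sup>2)))"
    by (simp add: boundary_family_def k_def fun_eq_iff algebra_simps)
  then show ?thesis
    by (simp only:) (intro gauss_family.intros continuous_intros k real_polynomial_function.intros(2) real_polynomial_function_norm2_diff)
qed

text \<open>In the tangential variable the kernel is a combination of a Gaussian and |z|^2 times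
  that Gaussian, whose transforms are known; the phase comes from the centre
  \<open>snd x\<close>.\<close>

lemma
  fixes x :: "real \<times> (real ^ 'm)" and \<eta> :: "real ^ 'm"
  assumes a: "a > 0"
  shows integrable_boundary_family: "integrable lborel (boundary_family x a)"
    and fourier_boundary_family: "fourier (\<lambda>y. complex_of_real (boundary_family x a y)) \<eta>
      = exp (\<i> * complex_of_real (snd x \<bullet> \<eta>)) * complex_of_real (poisson_symbol_deriv (fst x) (1 / (4 * a)) ((norm \<eta>)\<^sup>2))"
proof -
  define k where "k = fst x * (4 * a) * (pi / a) powr (- ((1 + real CARD('m)) / 2)) * exp (- a * (fst x)\<^sup>2)"
  define k0 where "k0 = k * (4 * a\<^sup>2 * (fst x)\<^sup>2 - 2 * a * (real CARD('m) + 3))"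
  define k1 where "k1 = k * (4 * a\<^sup>2)"
  define P where "P = (\<lambda>z :: real ^ 'm. k0 * exp (- a * (norm z)\<^sup>2) + k1 * ((norm z)\<^sup>2 * exp (- a * (norm z)\<^sup>2)))"
  have P: "boundary_family x a = (\<lambda>y. P (y - snd x))"
    by (simp add: boundary_family_def k_def k0_def k1_def P_def fun_eq_iff algebra_simps)
  have Pint: "integrable lborel P"
    unfolding P_def using integrable_gaussian[OF a] integrable_norm2_gaussian[OF a]
    by (intro Bochner_Integration.integrable_add integrable_mult_right)
  then show "integrable lborel (boundary_family x a)"
    using lborel_integral_translate(1)[of P "- snd x"] by (simp add: P)
  have [measurable]: "P \<in> borel_measurable borel" using Pint by auto
  let ?m = "real CARD('m)" and ?q = "(norm \<eta>)\<^sup>2"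
  let ?S = "(pi / a) powr (?m / 2) * exp (- ?q / (4 * a))"
  have "has_bochner_integral lborel
    (\<lambda>z. complex_of_real k0 * (exp (\<i> * complex_of_real (z \<bullet> \<eta>)) * complex_of_real (exp (- a * (norm z)\<^sup>2)))
      + complex_of_real k1 * (exp (\<i> * complex_of_real (z \<bullet> \<eta>)) * complex_of_real ((norm z)\<^sup>2 * exp (- a * (norm z)\<^sup>2))))
    (complex_of_real k0 * complex_of_real ?S
      + complex_of_real k1 * complex_of_real ((?m / (2 * a) - ?q / (4 * a\<^sup>2)) * (pi / a) powr (?m / 2) * exp (- ?q / (4 * a))))"
    using gaussian_fourier[OF a, of \<eta>] norm2_gaussian_fourier[OF a, of \<eta>]
    by (intro has_bochner_integral_add has_bochner_integral_mult_right) simp_all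
  then have "fourier (\<lambda>z. complex_of_real (P z)) \<eta>
      = complex_of_real (k0 * ?S + k1 * ((?m / (2 * a) - ?q / (4 * a\<^sup>2)) * (pi / a) powr (?m / 2) * exp (- ?q / (4 * a))))"
    unfolding fourier_def has_bochner_integral_iff by (simp add: P_def algebra_simps)
  \<comment> \<open>The dimension drops out: the transform of the |z|^2 term yields 2 a m, which
    cancels the m in - 2 a (m + 3) and leaves - 6 a, that is - 3 / (2 r).\<close>
  also have "k0 * ?S + k1 * ((?m / (2 * a) - ?q / (4 * a\<^sup>2)) * (pi / a) powr (?m / 2) * exp (- ?q / (4 * a)))
      = (k * ?S) * (4 * a\<^sup>2 * (fst x)\<^sup>2 - 6 * a - ?q)"
    using a by (simp add: k0_def k1_def field_simps power2_eq_square)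
  \<comment> \<open>Integrating out the m tangential directions leaves the one-dimensional
    normalisation of the normal direction.\<close>
  also have "k * ?S = poisson_symbol (fst x) (1 / (4 * a)) ?q"
  proof -
    have "(pi / a) powr (- ((1 + ?m) / 2)) * (pi / a) powr (?m / 2) = (pi / a) powr (- (1 / 2))"
      by (simp add: add_divide_distrib flip: powr_add)
    also have "\<dots> = 1 / sqrt (pi / a)" using a by (simp add: powr_minus powr_half_sqrt inverse_eq_divide)
    finally have "(pi / a) powr (- ((1 + ?m) / 2)) * (pi / a) powr (?m / 2) = 1 / sqrt (pi / a)" .
    moreover have "k * ?S = fst x * (4 * a) * ((pi / a) powr (- ((1 + ?m) / 2)) * (pi / a) powr (?m / 2))
        * exp (- a * (fst x)\<^sup>2) * exp (- ?q / (4 * a))"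
      by (simp only: k_def mult_ac)
    ultimately show ?thesis using a by (simp add: poisson_symbol_def)
  qed
  also have "poisson_symbol (fst x) (1 / (4 * a)) ?q * (4 * a\<^sup>2 * (fst x)\<^sup>2 - 6 * a - ?q)
      = poisson_symbol_deriv (fst x) (1 / (4 * a)) ?q"
    using a by (simp add: poisson_symbol_deriv_def power2_eq_square)
  finally show "fourier (\<lambda>y. complex_of_real (boundary_family x a y)) \<eta>
      = exp (\<i> * complex_of_real (snd x \<bullet> \<eta>)) * complex_of_real (poisson_symbol_deriv (fst x) (1 / (4 * a)) ?q)"
    using fourier_translate[of "\<lambda>z. complex_of_real (P z)" "snd x" \<eta>] by (simp add: P)
qed

text \<open>The phase is common to both transforms and cancels against its conjugate, which leaves a
  product of real symbols.\<close>

lemma spectral_measure_boundary_family: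
  fixes x :: "real \<times> (real ^ 'm)"
  assumes Q: "spectral_measure Q \<nu>" and a: "a > 0" and a': "a' > 0"
  shows "Q (boundary_family x a) (boundary_family x a')
    = (\<integral>\<eta>. poisson_symbol_deriv (fst x) (1 / (4 * a)) ((norm \<eta>)\<^sup>2)
        * poisson_symbol_deriv (fst x) (1 / (4 * a')) ((norm \<eta>)\<^sup>2) \<partial>\<nu>)" (is "_ = integral\<^sup>L \<nu> ?h")
proof -
  let ?f = "\<lambda>y. complex_of_real (boundary_family x a y)" and ?g = "\<lambda>y. complex_of_real (boundary_family x a' y)"
  have f: "integrable lborel ?f" and g: "integrable lborel ?g"
    using integrable_boundary_family[OF a, of x] integrable_boundary_family[OF a', of x]
    by (simp_all add: complex_of_real_integrable_eq)
  have [measurable]: "?g \<in> borel_measurable borel" using g by auto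
  have g': "integrable lborel (reflect_cnj ?g)"
    unfolding reflect_cnj_def using lborel_integral_uminus(1)[of ?g] g by simp
  have "fourier (convolution ?f (reflect_cnj ?g)) \<eta> = complex_of_real (?h \<eta>)" for \<eta>
  proof -
    have "exp (\<i> * complex_of_real (snd x \<bullet> \<eta>)) * cnj (exp (\<i> * complex_of_real (snd x \<bullet> \<eta>))) = 1"
      by (simp add: exp_cnj flip: exp_add)
    moreover have "e * u * (e' * v) = (e * e') * (u * v)" for e e' u v :: complex by (simp add: mult_ac)
    ultimately show ?thesis
      unfolding fourier_convolution[OF f g'] fourier_reflect_cnj[OF \<open>?g \<in> _\<close>]
        fourier_boundary_family[OF a] fourier_boundary_family[OF a'] complex_cnj_mult complex_cnj_complex_of_real of_real_mult
      by (simp only: mult_1_left)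
  qed
  moreover have "complex_of_real (Q (boundary_family x a) (boundary_family x a')) = fourier_measure \<nu> (convolution ?f (reflect_cnj ?g))"
    using Q gauss_family_schwartz[OF gauss_family_boundary[of x]] a a' unfolding spectral_measure_def by blast
  ultimately have "complex_of_real (Q (boundary_family x a) (boundary_family x a')) = (\<integral>\<eta>. complex_of_real (?h \<eta>) \<partial>\<nu>)"
    by (simp only: fourier_measure_def)
  then show ?thesis by (simp only: integral_complex_of_real of_real_eq_iff)
qed

section \<open>Tempered measures\<close>

lemma tempered_measure_polynomial:
  assumes "symmetric_tempered_measure \<nu>"
  shows "\<exists>p. (\<integral>\<^sup>+y. ennreal (1 / (1 + (norm y)\<^sup>2) ^ p) \<partial>\<nu>) < \<infinity>"
proof -
  have [measurable_cong]: "sets \<nu> = sets borel" using assms by (simp add: symmetric_tempered_measure_def)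
  obtain r where r: "r < 0" "(\<integral>\<^sup>+ y. ennreal ((1 + norm y) powr r) \<partial>\<nu>) < \<infinity>"
    using assms by (auto simp: symmetric_tempered_measure_def)
  obtain p where p: "real p \<ge> - r" using real_arch_simple by blast
  \<comment> \<open>Temperedness is stated in powers of 1 + |y|, the decay of the symbol in powers
    of 1 + |y|^2; the factor 2^p comes from 1 + |y| \<le> 2 (1 + |y|^2).\<close>
  have "1 / (1 + (norm y)\<^sup>2) ^ p \<le> 2 ^ p * (1 + norm y) powr r" for y
  proof -
    have "2 * norm y \<le> 1 + (norm y)\<^sup>2" using sum_squares_bound[of 1 "norm y"] by simp
    then have "1 + norm y \<le> 2 * (1 + (norm y)\<^sup>2)" using zero_le_power2[of "norm y"] unfolding distrib_left by linarith
    then have "(1 + norm y) ^ p \<le> (2 * (1 + (norm y)\<^sup>2)) ^ p" by (intro power_mono) auto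
    then have "(1 + norm y) ^ p \<le> 2 ^ p * (1 + (norm y)\<^sup>2) ^ p" by (simp only: power_mult_distrib)
    then have "1 / (1 + (norm y)\<^sup>2) ^ p \<le> 2 ^ p * (1 / (1 + norm y) ^ p)"
      by (simp add: divide_simps add_pos_nonneg)
    also have "1 / (1 + norm y) ^ p = (1 + norm y) powr (- real p)"
      by (simp add: powr_minus powr_realpow add_pos_nonneg inverse_eq_divide)
    also have "\<dots> \<le> (1 + norm y) powr r" using p by (intro powr_mono) auto
    finally show ?thesis by simp
  qed
  then have "(\<integral>\<^sup>+y. ennreal (1 / (1 + (norm y)\<^sup>2) ^ p) \<partial>\<nu>) \<le> (\<integral>\<^sup>+y. ennreal (2 ^ p) * ennreal ((1 + norm y) powr r) \<partial>\<nu>)"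
    by (intro nn_integral_mono) (auto simp: ennreal_mult[symmetric] intro!: ennreal_leI)
  also have "\<dots> = ennreal (2 ^ p) * (\<integral>\<^sup>+y. ennreal ((1 + norm y) powr r) \<partial>\<nu>)"
    by (rule nn_integral_cmult) measurable
  also have "\<dots> < \<infinity>" using r(2) by (simp add: ennreal_mult_less_top)
  finally show ?thesis by blast
qed

text \<open>Balls about 0 have finite measure because the integrable weight is bounded below on
  them.\<close>

lemma tempered_measure_sigma_finite:
  assumes \<nu>: "symmetric_tempered_measure \<nu>"
  shows "sigma_finite_measure \<nu>"
proof
  have sets[measurable_cong]: "sets \<nu> = sets borel" using \<nu> by (simp add: symmetric_tempered_measure_def)
  then have space: "space \<nu> = UNIV" using sets_eq_imp_space_eq[OF sets] by simp
  obtain p where p: "(\<integral>\<^sup>+y. ennreal (1 / (1 + (norm y)\<^sup>2) ^ p) \<partial>\<nu>) < \<infinity>"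
    using tempered_measure_polynomial[OF \<nu>] by blast
  have fin: "emeasure \<nu> (cball 0 (real n)) \<noteq> \<infinity>" for n
  proof -
    let ?c = "(1 + (real n)\<^sup>2) ^ p"
    have "emeasure \<nu> (cball 0 (real n)) = (\<integral>\<^sup>+y. indicator (cball 0 (real n)) y \<partial>\<nu>)" by (simp add: sets)
    also have "\<dots> \<le> (\<integral>\<^sup>+y. ennreal ?c * ennreal (1 / (1 + (norm y)\<^sup>2) ^ p) \<partial>\<nu>)"
    proof (rule nn_integral_mono)
      fix y :: 'a
      show "indicator (cball 0 (real n)) y \<le> ennreal ?c * ennreal (1 / (1 + (norm y)\<^sup>2) ^ p)"
      proof (cases "norm y \<le> real n")
        case True
        then have "(norm y)\<^sup>2 \<le> (real n)\<^sup>2" by (intro power_mono) auto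
        then have "(1 + (norm y)\<^sup>2) ^ p \<le> ?c" by (intro power_mono) auto
        then have "1 \<le> ?c * (1 / (1 + (norm y)\<^sup>2) ^ p)" by (simp add: add_pos_nonneg)
        then show ?thesis using True by (simp add: ennreal_mult[symmetric] ennreal_ge_1)
      qed simp
    qed
    also have "\<dots> = ennreal ?c * (\<integral>\<^sup>+y. ennreal (1 / (1 + (norm y)\<^sup>2) ^ p) \<partial>\<nu>)"
      by (rule nn_integral_cmult) measurable
    also have "\<dots> < \<infinity>" using p by (simp add: ennreal_mult_less_top)
    finally show ?thesis by simp
  qed
  have "(\<Union>n. cball (0::'a) (real n)) = UNIV"
    by (auto simp: real_arch_simple)
  then show "\<exists>A. countable A \<and> A \<subseteq> sets \<nu> \<and> \<Union> A = space \<nu> \<and> (\<forall>a\<in>A. emeasure \<nu> a \<noteq> \<infinity>)"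
    using fin by (intro exI[of _ "range (\<lambda>n. cball 0 (real n))"]) (auto simp: sets space)
qed

lemma (in pair_sigma_finite)
  fixes f :: "'a \<Rightarrow> real" and g :: "'b \<Rightarrow> real"
  assumes f: "integrable M1 f" and g: "integrable M2 g"
  shows integrable_pair_product: "integrable (M1 \<Otimes>\<^sub>M M2) (\<lambda>(x, y). f x * g y)"
    and integral_pair_product: "(\<integral>p. (case p of (x, y) \<Rightarrow> f x * g y) \<partial>(M1 \<Otimes>\<^sub>M M2)) = integral\<^sup>L M1 f * integral\<^sup>L M2 g"
proof -
  have [measurable]: "f \<in> borel_measurable M1" "g \<in> borel_measurable M2" using f g by auto
  show int: "integrable (M1 \<Otimes>\<^sub>M M2) (\<lambda>(x, y). f x * g y)"
    using f g by (intro Fubini_integrable) (auto simp: abs_mult)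
  show "(\<integral>p. (case p of (x, y) \<Rightarrow> f x * g y) \<partial>(M1 \<Otimes>\<^sub>M M2)) = integral\<^sup>L M1 f * integral\<^sup>L M2 g"
    using integral_fst'[OF int] by simp
qed

section \<open>The second moment of the solution\<close>

theorem proposition10:
  fixes M :: "'w measure"
    and W :: "real \<Rightarrow> 'w \<Rightarrow> (real ^ 'm \<Rightarrow> real) \<Rightarrow> real"
    and Q :: "(real ^ 'm \<Rightarrow> real) \<Rightarrow> (real ^ 'm \<Rightarrow> real) \<Rightarrow> real"
    and \<nu> :: "(real ^ 'm) measure"
    and G :: "real \<Rightarrow> real \<times> (real ^ 'm) \<Rightarrow> real \<times> (real ^ 'm) \<Rightarrow> real"
  assumes "homogeneous_wiener_process M Q W"
    and "spectral_measure Q \<nu>"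
    and "dirichlet_heat_kernel half_space G"
  shows "\<exists>C::real. \<forall>t>0. \<forall>x\<in>half_space.
    (\<integral>\<^sup>+ \<omega>. ennreal (\<bar>boundary_noise_solution G W t x \<omega>\<bar>\<^sup>2) \<partial>M)
    \<le> ennreal (C * exp t) *
      (\<integral>\<^sup>+ y. ennreal (fst x powi (-2) * indicator {y. norm y \<le> 1} y
                + fst x powi (-4) * norm y powr (- 1 / real CARD('m)) * indicator {y. norm y > 1} y) \<partial>\<nu>)"
proof (intro exI[of _ 2] allI impI ballI)
  fix t :: real and x :: "real \<times> (real ^ 'm)"
  assume t: "t > 0" and x: "x \<in> half_space"
  note W = assms(1) and Q = assms(2) and G = assms(3)
  define x0 where "x0 = fst x"
  have x0: "x0 > 0" using x by (auto simp: half_space_def x0_def)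
  have \<nu>: "symmetric_tempered_measure \<nu>" using Q by (simp add: spectral_measure_def)
  then have sets[measurable_cong]: "sets \<nu> = sets borel" by (simp add: symmetric_tempered_measure_def)
  interpret \<nu>: sigma_finite_measure \<nu> by (rule tempered_measure_sigma_finite[OF \<nu>])
  interpret M: prob_space M using W by (simp add: homogeneous_wiener_process_def)
  \<comment> \<open>Lebesgue measure on [0, t) as a finite measure on the whole line. Leaving out s
    = t avoids the boundary kernel at time 0.\<close>
  define N where "N = density lborel (\<lambda>s. ennreal (indicator {0..<t} s))"
  have setsN[measurable_cong]: "sets N = sets borel" by (simp add: N_def)
  have N_int: "integral\<^sup>L N f = (\<integral>s. indicator {0..<t} s *\<^sub>R f s \<partial>lborel)" if "f \<in> borel_measurable borel" for f :: "real \<Rightarrow> real"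
    unfolding N_def using that by (subst integral_density) auto
  have N_nn: "(\<integral>\<^sup>+s. f s \<partial>N) = (\<integral>\<^sup>+s. f s * indicator {0..<t} s \<partial>lborel)" if "f \<in> borel_measurable borel" for f
    unfolding N_def using that by (subst nn_integral_density) (auto simp: mult.commute ennreal_indicator)
  have N_em: "emeasure N (space N) = ennreal t"
  proof -
    have "emeasure N (space N) = (\<integral>\<^sup>+s. 1 \<partial>N)" by simp
    also have "\<dots> = ennreal t" using t by (subst N_nn) auto
    finally show ?thesis .
  qed
  interpret N: finite_measure N by (rule finite_measureI) (simp add: N_em)
  interpret N\<nu>: pair_sigma_finite N \<nu> ..
  define h where "h = (\<lambda>r (y :: real ^ 'm). poisson_symbol_deriv x0 r ((norm y)\<^sup>2))"
  have hm[measurable]: "h r \<in> borel_measurable borel" for r unfolding h_def by measurable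
  obtain p where p: "(\<integral>\<^sup>+y. ennreal (1 / (1 + (norm y)\<^sup>2) ^ p) \<partial>\<nu>) < \<infinity>"
    using tempered_measure_polynomial[OF \<nu>] by blast
  obtain C where C: "C \<ge> 0" "\<And>r q. 0 < r \<Longrightarrow> r \<le> t \<Longrightarrow> 0 \<le> q \<Longrightarrow> \<bar>poisson_symbol_deriv x0 r q\<bar> \<le> C / (1 + q) ^ p"
    using poisson_symbol_deriv_bound[OF x0 t, of p] by blast
  \<comment> \<open>A bound for the integral of \<open>(h r y)\<^sup>2\<close> against \<nu>,
    uniform in 0 < r \<le> t; it is finite although the right-hand side of the theorem may not
    be.\<close>
  define B where "B = C\<^sup>2 * enn2real (\<integral>\<^sup>+y. ennreal (1 / (1 + (norm y)\<^sup>2) ^ p) \<partial>\<nu>)"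
  have B0: "B \<ge> 0" by (simp add: B_def)
  have hB: "(\<integral>\<^sup>+y. ennreal ((h r y)\<^sup>2) \<partial>\<nu>) \<le> ennreal B" if "0 < r" "r \<le> t" for r
  proof -
    have "(h r y)\<^sup>2 \<le> C\<^sup>2 * (1 / (1 + (norm y)\<^sup>2) ^ p)" for y
    proof -
      let ?u = "(1 + (norm y)\<^sup>2) ^ p"
      have u: "?u \<ge> 1" by (intro one_le_power) auto
      have "\<bar>h r y\<bar>\<^sup>2 \<le> (C / ?u)\<^sup>2" unfolding h_def using that by (intro power_mono C) auto
      also have "\<dots> = C\<^sup>2 * (1 / ?u) * (1 / ?u)" by (simp add: power2_eq_square)
      also have "\<dots> \<le> C\<^sup>2 * (1 / ?u) * 1"
      proof (rule mult_left_mono)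
        show "1 / ?u \<le> 1" using frac_le[of 1 1 1 ?u] u by linarith
      qed simp
      finally show ?thesis by simp
    qed
    then have "(\<integral>\<^sup>+y. ennreal ((h r y)\<^sup>2) \<partial>\<nu>) \<le> (\<integral>\<^sup>+y. ennreal (C\<^sup>2) * ennreal (1 / (1 + (norm y)\<^sup>2) ^ p) \<partial>\<nu>)"
      by (intro nn_integral_mono) (auto simp: ennreal_mult[symmetric] intro!: ennreal_leI)
    also have "\<dots> = ennreal (C\<^sup>2) * (\<integral>\<^sup>+y. ennreal (1 / (1 + (norm y)\<^sup>2) ^ p) \<partial>\<nu>)"
      by (rule nn_integral_cmult) measurable
    also have "\<dots> = ennreal B" using p by (simp add: B_def ennreal_mult less_top)
    finally show ?thesis .
  qed
  have hsq: "integrable \<nu> (\<lambda>y. (h r y)\<^sup>2)" "(\<integral>y. (h r y)\<^sup>2 \<partial>\<nu>) \<le> B" if r: "0 < r" "r \<le> t" for r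
  proof -
    show int: "integrable \<nu> (\<lambda>y. (h r y)\<^sup>2)"
      by (rule integrableI_bounded) (use hB[OF r] in \<open>auto intro: le_less_trans\<close>)
    show "(\<integral>y. (h r y)\<^sup>2 \<partial>\<nu>) \<le> B"
      using hB[OF r] B0 by (simp add: nn_integral_eq_integral[OF int])
  qed
  have hh: "integrable \<nu> (\<lambda>y. h r y * h r' y)" if "0 < r" "r \<le> t" "0 < r'" "r' \<le> t" for r r'
  proof (rule Bochner_Integration.integrable_bound)
    show "integrable \<nu> (\<lambda>y. (h r y)\<^sup>2 + (h r' y)\<^sup>2)" by (intro Bochner_Integration.integrable_add hsq that)
    show "AE y in \<nu>. norm (h r y * h r' y) \<le> norm ((h r y)\<^sup>2 + (h r' y)\<^sup>2)"
    proof (intro always_eventually allI)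
      fix y
      show "norm (h r y * h r' y) \<le> norm ((h r y)\<^sup>2 + (h r' y)\<^sup>2)"
        using sum_squares_bound[of "\<bar>h r y\<bar>" "\<bar>h r' y\<bar>"] mult_nonneg_nonneg[OF abs_ge_zero[of "h r y"] abs_ge_zero[of "h r' y"]]
        unfolding real_norm_def abs_mult power2_abs mult.assoc by linarith
    qed
  qed measurable
  define \<psi> where "\<psi> = (\<lambda>s. boundary_family x (1 / (4 * (t - s))))"
  have \<psi>: "boundary_kernel G (t - s) x = \<psi> s" if "s < t" for s
    using boundary_kernel_eq_family[OF G _ x, of "t - s"] that by (simp add: \<psi>_def)
  have \<psi>S: "\<psi> s \<in> schwartz" if "s < t" for s
    unfolding \<psi>_def using that by (intro gauss_family_schwartz[OF gauss_family_boundary]) simp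
  have Q\<psi>: "Q (\<psi> s) (\<psi> s') = (\<integral>y. h (t - s) y * h (t - s') y \<partial>\<nu>)" if "s < t" "s' < t" for s s'
  proof -
    have "1 / (4 * (1 / (4 * u))) = u" for u :: real by simp
    then show ?thesis
      using spectral_measure_boundary_family[OF Q, of "1 / (4 * (t - s))" "1 / (4 * (t - s'))" x] that
      by (simp only: \<psi>_def h_def x0_def zero_less_divide_1_iff zero_less_mult_iff zero_less_numeral) simp
  qed
  \<comment> \<open>Both families vanish for s outside [0, t), so that \<open>F1sq\<close>,
    \<open>F2sq\<close> and \<open>corr\<close> hold for every real s. In \<open>F2\<close> the
    lower limit 0 \<le> \<sigma> is supplied by \<open>N\<close>.\<close>
  define F1 where "F1 = (\<lambda>s \<omega>. if 0 \<le> s \<and> s < t then W s \<omega> (\<psi> s) else 0)"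
  define F2 where "F2 = (\<lambda>s (\<sigma>, y). if 0 \<le> s \<and> s < t \<and> \<sigma> < s then h (t - s) y else 0)"
  have F1m[measurable]: "(\<lambda>(s, \<omega>). F1 s \<omega>) \<in> borel_measurable (lborel \<Otimes>\<^sub>M M)"
    unfolding F1_def
  proof (rule homogeneous_wiener_process_measurable[OF W])
    show "\<psi> s \<in> schwartz" if "s < t" for s using \<psi>S that .
    fix S :: "nat \<Rightarrow> real" and s assume S: "S \<longlonglongrightarrow> s" "\<And>n. 0 \<le> S n \<and> S n \<le> s" and s: "s < t"
    have S': "S n < t" for n using S(2)[of n] s by linarith
    show "schwartz_tendsto (\<lambda>n. \<psi> (S n)) (\<psi> s)"
      unfolding \<psi>_def
    proof (rule gauss_family_schwartz_tendsto[OF gauss_family_boundary])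
      show "(\<lambda>n. 1 / (4 * (t - S n))) \<longlonglongrightarrow> 1 / (4 * (t - s))"
        using s by (intro tendsto_intros S(1)) auto
    qed (use s S' in auto)
  qed
  have F2m: "(\<lambda>(s, q). F2 s q) \<in> borel_measurable (N \<Otimes>\<^sub>M (N \<Otimes>\<^sub>M \<nu>))"
    unfolding F2_def h_def case_prod_unfold by measurable
  have F1_slice: "(\<lambda>s. F1 s \<omega>) \<in> borel_measurable borel" if "\<omega> \<in> space M" for \<omega>
    using measurable_compose[OF measurable_Pair2'[OF that] F1m] by simp
  have F1sq: "(\<integral>\<^sup>+\<omega>. ennreal ((F1 s \<omega>)\<^sup>2) \<partial>M) \<le> ennreal (t * B)" for s
  proof (cases "0 \<le> s \<and> s < t")
    case True
    have int: "integrable M (\<lambda>\<omega>. (W s \<omega> (\<psi> s))\<^sup>2)"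
      using True by (intro homogeneous_wiener_process_integrable_square[OF W] \<psi>S) auto
    have "(\<integral>\<omega>. W s \<omega> (\<psi> s) * W s \<omega> (\<psi> s) \<partial>M) = min s s * Q (\<psi> s) (\<psi> s)"
      using W True \<psi>S[of s] unfolding homogeneous_wiener_process_def by blast
    then have "(\<integral>\<omega>. (W s \<omega> (\<psi> s))\<^sup>2 \<partial>M) = s * (\<integral>y. (h (t - s) y)\<^sup>2 \<partial>\<nu>)"
      using True by (simp add: power2_eq_square Q\<psi>)
    also have "\<dots> \<le> t * B" using True B0 by (intro mult_mono hsq) auto
    finally show ?thesis using True by (simp add: F1_def nn_integral_eq_integral[OF int] ennreal_leI)
  qed (auto simp: F1_def)
  have F2sq: "(\<integral>\<^sup>+q. ennreal ((F2 s q)\<^sup>2) \<partial>(N \<Otimes>\<^sub>M \<nu>)) \<le> ennreal (t * B)" for s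
  proof -
    have "(\<integral>\<^sup>+q. ennreal ((F2 s q)\<^sup>2) \<partial>(N \<Otimes>\<^sub>M \<nu>)) = (\<integral>\<^sup>+\<sigma>. (\<integral>\<^sup>+y. ennreal ((F2 s (\<sigma>, y))\<^sup>2) \<partial>\<nu>) \<partial>N)"
    proof (rule \<nu>.nn_integral_fst[symmetric])
      show "(\<lambda>q. ennreal ((F2 s q)\<^sup>2)) \<in> borel_measurable (N \<Otimes>\<^sub>M \<nu>)"
        unfolding F2_def case_prod_unfold by measurable
    qed
    also have "\<dots> \<le> (\<integral>\<^sup>+\<sigma>. ennreal B \<partial>N)"
    proof (rule nn_integral_mono)
      fix \<sigma>
      show "(\<integral>\<^sup>+y. ennreal ((F2 s (\<sigma>, y))\<^sup>2) \<partial>\<nu>) \<le> ennreal B"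
        using hB[of "t - s"] by (cases "0 \<le> s \<and> s < t \<and> \<sigma> < s") (auto simp: F2_def)
    qed
    also have "\<dots> = ennreal (t * B)" using t B0 by (simp add: N_em ennreal_mult mult.commute)
    finally show ?thesis .
  qed
  have corr: "(\<integral>\<omega>. F1 s \<omega> * F1 s' \<omega> \<partial>M) = (\<integral>q. F2 s q * F2 s' q \<partial>(N \<Otimes>\<^sub>M \<nu>))" for s s'
  proof (cases "0 \<le> s \<and> s < t \<and> 0 \<le> s' \<and> s' < t")
    case True
    have "(\<integral>\<omega>. F1 s \<omega> * F1 s' \<omega> \<partial>M) = (\<integral>\<omega>. W s \<omega> (\<psi> s) * W s' \<omega> (\<psi> s') \<partial>M)"
      using True by (simp add: F1_def)
    also have "\<dots> = min s s' * Q (\<psi> s) (\<psi> s')"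
      using W True \<psi>S[of s] \<psi>S[of s'] unfolding homogeneous_wiener_process_def by blast
    also have "\<dots> = min s s' * (\<integral>y. h (t - s) y * h (t - s') y \<partial>\<nu>)" using True by (simp add: Q\<psi>)
    \<comment> \<open>The factor min s s' is the mass that \<open>N\<close> gives to the \<sigma>
      below both s and s'; this turns the covariance into one integral over pairs (\<sigma>,
      y).\<close>
    also have "min s s' = (\<integral>\<sigma>. indicat_real {..<min s s'} \<sigma> \<partial>N)"
    proof -
      have "(\<integral>\<sigma>. indicat_real {..<min s s'} \<sigma> \<partial>N) = (\<integral>\<sigma>. indicat_real {0..<min s s'} \<sigma> \<partial>lborel)"
      proof -
        have "(\<lambda>\<sigma>. indicat_real {0..<t} \<sigma> *\<^sub>R indicat_real {..<min s s'} \<sigma>) = indicat_real {0..<min s s'}"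
          using True by (auto simp: fun_eq_iff indicator_def)
        then show ?thesis using N_int[of "indicat_real {..<min s s'}"] by simp
      qed
      also have "\<dots> = min s s'" using True by simp
      finally show ?thesis by simp
    qed
    also have "\<dots> * (\<integral>y. h (t - s) y * h (t - s') y \<partial>\<nu>)
        = (\<integral>q. (case q of (\<sigma>, y) \<Rightarrow> indicator {..<min s s'} \<sigma> * (h (t - s) y * h (t - s') y)) \<partial>(N \<Otimes>\<^sub>M \<nu>))"
      using True
      by (intro N\<nu>.integral_pair_product[symmetric] hh N.integrable_const_bound[where B=1]) auto
    also have "\<dots> = (\<integral>q. F2 s q * F2 s' q \<partial>(N \<Otimes>\<^sub>M \<nu>))"
      using True by (intro Bochner_Integration.integral_cong refl) (auto simp: F2_def indicator_def)
    finally show ?thesis .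
  next
    case False
    then have "(\<lambda>\<omega>. F1 s \<omega> * F1 s' \<omega>) = (\<lambda>_. 0)" "(\<lambda>q. F2 s q * F2 s' q) = (\<lambda>_. 0)"
      by (auto simp: F1_def F2_def fun_eq_iff)
    then show ?thesis by simp
  qed
  \<comment> \<open>The integrands over {0..t} and [0, t) can differ only at the single point s =
    t.\<close>
  have u: "boundary_noise_solution G W t x \<omega> = (\<integral>s. F1 s \<omega> \<partial>N)" if "\<omega> \<in> space M" for \<omega>
    unfolding boundary_noise_solution_def set_lebesgue_integral_def N_int[OF F1_slice[OF that]]
    by (rule integral_discrete_difference[where X="{t}"]) (auto simp: F1_def \<psi> indicator_def)
  have "(\<integral>\<^sup>+\<omega>. ennreal (\<bar>boundary_noise_solution G W t x \<omega>\<bar>\<^sup>2) \<partial>M) = (\<integral>\<^sup>+\<omega>. ennreal ((\<integral>s. F1 s \<omega> \<partial>N)\<^sup>2) \<partial>M)"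
    by (intro nn_integral_cong) (simp add: u)
  also have "\<dots> = ennreal (\<integral>s. (\<integral>s'. (\<integral>\<omega>. F1 s \<omega> * F1 s' \<omega> \<partial>M) \<partial>N) \<partial>N)"
  proof (rule square_integral_eq_double_integral[OF N.finite_measure_axioms M.sigma_finite_measure_axioms _ F1sq])
    show "(\<lambda>(s, \<omega>). F1 s \<omega>) \<in> borel_measurable (N \<Otimes>\<^sub>M M)"
      using F1m by (simp cong: measurable_cong_sets sets_pair_measure_cong add: N_def)
  qed
  \<comment> \<open>The second-moment identity is read backwards, now for \<open>F2\<close>.\<close>
  also have "\<dots> = (\<integral>\<^sup>+q. ennreal ((\<integral>s. F2 s q \<partial>N)\<^sup>2) \<partial>(N \<Otimes>\<^sub>M \<nu>))"
    unfolding corr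
    by (rule square_integral_eq_double_integral
        [OF N.finite_measure_axioms N\<nu>.P.sigma_finite_measure_axioms F2m F2sq, symmetric])
  also have "\<dots> = (\<integral>\<^sup>+y. (\<integral>\<^sup>+\<sigma>. ennreal ((\<integral>s. F2 s (\<sigma>, y) \<partial>N)\<^sup>2) \<partial>N) \<partial>\<nu>)"
  proof (rule N\<nu>.nn_integral_snd[symmetric])
    have "(\<lambda>(q, s). F2 s q) \<in> borel_measurable ((N \<Otimes>\<^sub>M \<nu>) \<Otimes>\<^sub>M N)"
      unfolding F2_def h_def case_prod_unfold by measurable
    then have "(\<lambda>q. \<integral>s. F2 s q \<partial>N) \<in> borel_measurable (N \<Otimes>\<^sub>M \<nu>)"
      by (rule N.borel_measurable_lebesgue_integral)
    then show "(\<lambda>q. ennreal ((\<integral>s. F2 s q \<partial>N)\<^sup>2)) \<in> borel_measurable (N \<Otimes>\<^sub>M \<nu>)"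
      by simp
  qed
  also have "\<dots> \<le> (\<integral>\<^sup>+y. ennreal 2 * ennreal (x0 powi (-2) * indicator {y. norm y \<le> 1} y
      + x0 powi (-4) * norm y powr (- 1 / real CARD('m)) * indicator {y. norm y > 1} y) \<partial>\<nu>)"
  proof (rule nn_integral_mono)
    fix y :: "real ^ 'm"
    let ?q = "(norm y)\<^sup>2"
    let ?R = "x0 powi (-2) * indicator {y. norm y \<le> 1} y
      + x0 powi (-4) * norm y powr (- 1 / real CARD('m)) * indicator {y. norm y > 1} y"
    \<comment> \<open>For fixed \<sigma> and y the time integral runs over \<sigma> < s < t; adding
      the two endpoints changes nothing and makes the integral explicit.\<close>
    have F2int: "(\<integral>s. F2 s (\<sigma>, y) \<partial>N) = poisson_symbol x0 (t - \<sigma>) ?q" if "0 \<le> \<sigma>" "\<sigma> < t" for \<sigma>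
    proof -
      have [measurable]: "(\<lambda>s. F2 s (\<sigma>, y)) \<in> borel_measurable borel"
        unfolding F2_def h_def by simp
      have "(\<integral>s. F2 s (\<sigma>, y) \<partial>N) = (\<integral>s. indicator {0..<t} s *\<^sub>R F2 s (\<sigma>, y) \<partial>lborel)"
        by (rule N_int) measurable
      also have "\<dots> = (LBINT s:{\<sigma>..t}. poisson_symbol_deriv x0 (t - s) ?q)"
        unfolding set_lebesgue_integral_def
        by (rule integral_discrete_difference[where X="{\<sigma>, t}"]) (use that in \<open>auto simp: F2_def h_def indicator_def\<close>)
      also have "\<dots> = poisson_symbol x0 (t - \<sigma>) ?q"
        using that by (intro integral_poisson_symbol_deriv x0) auto
      finally show ?thesis .
    qed
    have "(\<integral>\<^sup>+\<sigma>. ennreal ((\<integral>s. F2 s (\<sigma>, y) \<partial>N)\<^sup>2) \<partial>N)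
        = (\<integral>\<^sup>+\<sigma>. ennreal ((poisson_symbol x0 (t - \<sigma>) ?q)\<^sup>2) \<partial>N)"
    proof (rule nn_integral_cong_AE)
      have "AE \<sigma> in N. \<sigma> \<in> {0..<t}"
        unfolding N_def by (subst AE_density) (auto simp: indicator_def)
      then show "AE \<sigma> in N. ennreal ((\<integral>s. F2 s (\<sigma>, y) \<partial>N)\<^sup>2) = ennreal ((poisson_symbol x0 (t - \<sigma>) ?q)\<^sup>2)"
        by eventually_elim (simp add: F2int)
    qed
    also have "\<dots> = (\<integral>\<^sup>+\<sigma>. ennreal ((poisson_symbol x0 (t - \<sigma>) ?q)\<^sup>2) * indicator {0..<t} \<sigma> \<partial>lborel)"
      by (rule N_nn) measurable
    also have "\<dots> \<le> ennreal (2 * ?R)"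
    proof (cases "norm y \<le> 1")
      case True
      then have "2 * ?R = 2 / x0\<^sup>2" by (simp add: power_int_minus inverse_eq_divide)
      then show ?thesis using nn_integral_poisson_symbol_square_le[OF x0 _ t, of ?q] by simp
    next
      case False
      then have y: "norm y > 1" by simp
      \<comment> \<open>As norm y > 1, powers of it increase with the exponent, and - 2 \<le> - 1 /
        m because m \<ge> 1.\<close>
      have "1 / ?q = norm y powr (- 2)"
        using y by (simp add: powr_minus inverse_eq_divide flip: powr_numeral)
      also have "\<dots> \<le> norm y powr (- 1 / real CARD('m))"
      proof (rule powr_mono)
        have "1 / real CARD('m) \<le> 1 / 1" by (rule divide_left_mono) (simp_all add: Suc_leI)
        then show "- 2 \<le> - 1 / real CARD('m)" by linarith
      qed (use y in simp)
      finally have "2 / x0 ^ 4 * (1 / ?q) \<le> 2 / x0 ^ 4 * norm y powr (- 1 / real CARD('m))"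
        using x0 by (intro mult_left_mono) auto
      also have "\<dots> = 2 * ?R" using y by (simp add: power_int_minus inverse_eq_divide)
      finally have "2 / (x0 ^ 4 * ?q) \<le> 2 * ?R" by simp
      moreover have "?q > 0" using y by auto
      ultimately show ?thesis
        using nn_integral_poisson_symbol_square_le'[OF x0 _ t, of ?q] by (meson ennreal_leI order_trans)
    qed
    also have "\<dots> = ennreal 2 * ennreal ?R"
      by (rule ennreal_mult) (use x0 in auto)
    finally show "(\<integral>\<^sup>+\<sigma>. ennreal ((\<integral>s. F2 s (\<sigma>, y) \<partial>N)\<^sup>2) \<partial>N) \<le> ennreal 2 * ennreal ?R" .
  qed
  also have "\<dots> = ennreal 2 * (\<integral>\<^sup>+y. ennreal (x0 powi (-2) * indicator {y. norm y \<le> 1} y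
      + x0 powi (-4) * norm y powr (- 1 / real CARD('m)) * indicator {y. norm y > 1} y) \<partial>\<nu>)"
    by (rule nn_integral_cmult) measurable
  \<comment> \<open>The factor exp t enters through 1 \<le> exp t for t > 0; the constant 2 is the
    one in both time-integral bounds.\<close>
  also have "\<dots> \<le> ennreal (2 * exp t) * (\<integral>\<^sup>+y. ennreal (x0 powi (-2) * indicator {y. norm y \<le> 1} y
      + x0 powi (-4) * norm y powr (- 1 / real CARD('m)) * indicator {y. norm y > 1} y) \<partial>\<nu>)"
    using t by (intro mult_right_mono ennreal_leI) auto
  finally show "(\<integral>\<^sup>+ \<omega>. ennreal (\<bar>boundary_noise_solution G W t x \<omega>\<bar>\<^sup>2) \<partial>M)
    \<le> ennreal (2 * exp t) *
      (\<integral>\<^sup>+ y. ennreal (fst x powi (-2) * indicator {y. norm y \<le> 1} y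
                + fst x powi (-4) * norm y powr (- 1 / real CARD('m)) * indicator {y. norm y > 1} y) \<partial>\<nu>)"
    unfolding x0_def .
qed

end
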